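(* Let $h : B \to C$, $f : B \to A$ and $g : A \to C$ be Kan fibrations of simplicial sets (the square with $f$, $g$, $h$ is not required to commute, i.e. $gf = h$ is not assumed). Then the initial algebra of the dependent polynomial functor $D_f = \Sigma_g \circ \Pi_f \circ h^*$ on $\mathbf{sSet}/C$ is fibrant in $\mathbf{sSet}/C$, i.e. its structure map to $C$ is a Kan fibration.
   Context: $\mathbf{sSet}$ is the category of simplicial sets. Given maps $h : B\to C$, $f : B\to A$, $g : A\to C$ in a locally cartesian closed category $\mathcal{E}$, the dependent polynomial functor is the composite $D_f : \mathcal{E}/C \xrightarrow{h^*} \mathcal{E}/B \xrightarrow{\Pi_f} \mathcal{E}/A \xrightarrow{\Sigma_g} \mathcal{E}/C$, where $h^*$ is pullback along $h$, $\Pi_f$ is the right adjoint to pullback along $f$, and $\Sigma_g$ is composition with $g$. An algebra for an endofunctor $F$ is an object $X$ with a map $FX\to X$; a morphism of algebras $(X,\alpha)\to(Y,\beta)$ is a map $k : X\to Y$ with $k\alpha = \beta\, F(k)$; the initial algebra is the initial object of the category of algebras. Initial algebras of dependent polynomial functors exist in categories of presheaves, in particular in simplicial sets. *)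

theory Defs
  imports "HOL-Library.FuncSet"
begin

section \<open>Simplicial sets\<close>

text \<open>
  \<open>\<Delta> m n\<close> is the set of morphisms \<open>[m] \<rightarrow> [n]\<close> of the simplex category.  Functions are kept
  extensional, so that equality of morphisms is equality in HOL; composition is \<^const>\<open>compose\<close>.
\<close>

definition \<Delta> :: "nat \<Rightarrow> nat \<Rightarrow> (nat \<Rightarrow> nat) set" where
  "\<Delta> m n = {\<theta> \<in> {..m} \<rightarrow>\<^sub>E {..n}. mono_on {..m} \<theta>}"

definition \<Delta>_id :: "nat \<Rightarrow> nat \<Rightarrow> nat" where
  "\<Delta>_id n = (\<lambda>i\<in>{..n}. i)"

text \<open>
  A presheaf on the simplex category: \<open>simplices X n\<close> is the set of \<open>n\<close>-simplices, and for
  \<open>\<theta> \<in> \<Delta> m n\<close> the restriction along \<open>\<theta>\<close> is \<open>act X m n \<theta>\<close>, from \<open>n\<close>-simplices to \<open>m\<close>-simplices.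
\<close>

record 'a sset =
  simplices :: "nat \<Rightarrow> 'a set"
  act :: "nat \<Rightarrow> nat \<Rightarrow> (nat \<Rightarrow> nat) \<Rightarrow> 'a \<Rightarrow> 'a"

definition is_sset :: "'a sset \<Rightarrow> bool" where
  "is_sset X \<longleftrightarrow>
     (\<forall>m n. \<forall>\<theta>\<in>\<Delta> m n. \<forall>x\<in>simplices X n. act X m n \<theta> x \<in> simplices X m) \<and>
     (\<forall>n. \<forall>x\<in>simplices X n. act X n n (\<Delta>_id n) x = x) \<and>
     (\<forall>l m n. \<forall>\<psi>\<in>\<Delta> l m. \<forall>\<theta>\<in>\<Delta> m n. \<forall>x\<in>simplices X n.
        act X l n (compose {..l} \<theta> \<psi>) x = act X l m \<psi> (act X m n \<theta> x))"

text \<open>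
  Simplicial maps are not required to be extensional; two of them count as equal if they agree
  on all simplices of the domain.
\<close>

type_synonym ('a, 'b) smap = "nat \<Rightarrow> 'a \<Rightarrow> 'b"

definition is_smap :: "'a sset \<Rightarrow> 'b sset \<Rightarrow> ('a, 'b) smap \<Rightarrow> bool" where
  "is_smap X Y k \<longleftrightarrow>
     (\<forall>n. \<forall>x\<in>simplices X n. k n x \<in> simplices Y n) \<and>
     (\<forall>m n. \<forall>\<theta>\<in>\<Delta> m n. \<forall>x\<in>simplices X n. k m (act X m n \<theta> x) = act Y m n \<theta> (k n x))"

definition smap_eq :: "'a sset \<Rightarrow> ('a, 'b) smap \<Rightarrow> ('a, 'b) smap \<Rightarrow> bool" where
  "smap_eq X k k' \<longleftrightarrow> (\<forall>n. \<forall>x\<in>simplices X n. k n x = k' n x)"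


section \<open>Kan fibrations\<close>

definition std_simplex :: "nat \<Rightarrow> (nat \<Rightarrow> nat) sset" where
  "std_simplex n = \<lparr>simplices = (\<lambda>m. \<Delta> m n), act = (\<lambda>l m \<psi> \<theta>. compose {..l} \<theta> \<psi>)\<rparr>"

text \<open>The union of the codimension-one faces of the standard simplex that contain the vertex \<open>k\<close>.\<close>

definition horn :: "nat \<Rightarrow> nat \<Rightarrow> (nat \<Rightarrow> nat) sset" where
  "horn n k = \<lparr>simplices = (\<lambda>m. {\<theta> \<in> \<Delta> m n. \<exists>j\<in>{..n} - {k}. j \<notin> \<theta> ` {..m}}),
               act = act (std_simplex n)\<rparr>"

definition kan_fibration :: "'a sset \<Rightarrow> 'b sset \<Rightarrow> ('a, 'b) smap \<Rightarrow> bool" where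
  "kan_fibration X Y p \<longleftrightarrow>
     is_sset X \<and> is_sset Y \<and> is_smap X Y p \<and>
     (\<forall>n k u v. 1 \<le> n \<and> k \<le> n \<and> is_smap (horn n k) X u \<and> is_smap (std_simplex n) Y v \<and>
        smap_eq (horn n k) (\<lambda>m \<theta>. p m (u m \<theta>)) v \<longrightarrow>
        (\<exists>w. is_smap (std_simplex n) X w \<and> smap_eq (horn n k) w u \<and>
             smap_eq (std_simplex n) (\<lambda>m \<theta>. p m (w m \<theta>)) v))"


section \<open>Slices and the dependent polynomial functor\<close>

type_synonym ('x, 'c) over = "'x sset \<times> ('x, 'c) smap"

fun is_over :: "'c sset \<Rightarrow> ('x, 'c) over \<Rightarrow> bool" where
  "is_over C (X, p) \<longleftrightarrow> is_sset X \<and> is_sset C \<and> is_smap X C p"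

fun over_map :: "('x, 'c) over \<Rightarrow> ('y, 'c) over \<Rightarrow> ('x, 'y) smap \<Rightarrow> bool" where
  "over_map (X, p) (Y, q) k \<longleftrightarrow> is_smap X Y k \<and> smap_eq X (\<lambda>n x. q n (k n x)) p"

abbreviation total_space :: "('x, 'c) over \<Rightarrow> 'x sset" where
  "total_space \<equiv> fst"

text \<open>Pullback along \<open>h\<close>, a simplicial map with domain \<open>B\<close>, on objects and on morphisms.\<close>

fun pullback :: "'b sset \<Rightarrow> ('b, 'c) smap \<Rightarrow> ('x, 'c) over \<Rightarrow> ('b \<times> 'x, 'b) over" where
  "pullback B h (X, p) =
     (\<lparr>simplices = (\<lambda>n. {(b, x). b \<in> simplices B n \<and> x \<in> simplices X n \<and> h n b = p n x}),
       act = (\<lambda>m n \<theta> (b, x). (act B m n \<theta> b, act X m n \<theta> x))\<rparr>,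
      \<lambda>n. fst)"

definition pullback_map :: "('x, 'y) smap \<Rightarrow> ('b \<times> 'x, 'b \<times> 'y) smap" where
  "pullback_map k = (\<lambda>n (b, x). (b, k n x))"

text \<open>
  The simplices, in all dimensions, of the pullback of \<open>f : B \<rightarrow> A\<close> along the map from the
  standard \<open>n\<close>-simplex to \<open>A\<close> that classifies \<open>a\<close>; the first component is the dimension.
\<close>

definition fibre :: "'a sset \<Rightarrow> 'b sset \<Rightarrow> ('b, 'a) smap \<Rightarrow> nat \<Rightarrow> 'a
    \<Rightarrow> (nat \<times> (nat \<Rightarrow> nat) \<times> 'b) set" where
  "fibre A B f n a = {(m, \<theta>, b). \<theta> \<in> \<Delta> m n \<and> b \<in> simplices B m \<and> f m b = act A m n \<theta> a}"

text \<open>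
  The dependent product along \<open>f\<close>.  By the Yoneda lemma and the adjunction, an \<open>n\<close>-simplex of it
  over \<open>a\<close> is a simplicial map over \<open>B\<close> from the above pullback to \<open>E\<close>.  That this is right adjoint
  to pullback along \<open>f\<close> is proved below.
\<close>

fun dprod :: "'a sset \<Rightarrow> 'b sset \<Rightarrow> ('b, 'a) smap \<Rightarrow> ('e, 'b) over
    \<Rightarrow> ('a \<times> (nat \<times> (nat \<Rightarrow> nat) \<times> 'b \<Rightarrow> 'e), 'a) over" where
  "dprod A B f (E, q) =
     (\<lparr>simplices = (\<lambda>n. {(a, s). a \<in> simplices A n \<and> s \<in> extensional (fibre A B f n a) \<and>
          (\<forall>(m, \<theta>, b)\<in>fibre A B f n a.
             s (m, \<theta>, b) \<in> simplices E m \<and> q m (s (m, \<theta>, b)) = b \<and>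
             (\<forall>l. \<forall>\<psi>\<in>\<Delta> l m.
                s (l, compose {..l} \<theta> \<psi>, act B l m \<psi> b) = act E l m \<psi> (s (m, \<theta>, b))))}),
       act = (\<lambda>m n \<theta> (a, s).
          (act A m n \<theta> a,
           \<lambda>(l, \<psi>, b)\<in>fibre A B f m (act A m n \<theta> a). s (l, compose {..l} \<theta> \<psi>, b)))\<rparr>,
      \<lambda>n. fst)"

definition dprod_map :: "'a sset \<Rightarrow> 'b sset \<Rightarrow> ('b, 'a) smap \<Rightarrow> ('e, 'd) smap
    \<Rightarrow> ('a \<times> (nat \<times> (nat \<Rightarrow> nat) \<times> 'b \<Rightarrow> 'e), 'a \<times> (nat \<times> (nat \<Rightarrow> nat) \<times> 'b \<Rightarrow> 'd)) smap" where
  "dprod_map A B f k =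
     (\<lambda>n (a, s). (a, \<lambda>(m, \<theta>, b)\<in>fibre A B f n a. k m (s (m, \<theta>, b))))"

text \<open>Composition with \<open>g\<close>; it does not change the underlying simplicial map of a morphism.\<close>

fun dsum :: "('a, 'c) smap \<Rightarrow> ('y, 'a) over \<Rightarrow> ('y, 'c) over" where
  "dsum g (Y, r) = (Y, \<lambda>n y. g n (r n y))"

type_synonym ('a, 'b, 'x) dpoly = "'a \<times> (nat \<times> (nat \<Rightarrow> nat) \<times> 'b \<Rightarrow> 'b \<times> 'x)"

definition dpoly :: "'a sset \<Rightarrow> 'b sset \<Rightarrow> ('b, 'c) smap \<Rightarrow> ('b, 'a) smap \<Rightarrow> ('a, 'c) smap
    \<Rightarrow> ('x, 'c) over \<Rightarrow> (('a, 'b, 'x) dpoly, 'c) over" where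
  "dpoly A B h f g X = dsum g (dprod A B f (pullback B h X))"

definition dpoly_map :: "'a sset \<Rightarrow> 'b sset \<Rightarrow> ('b, 'a) smap \<Rightarrow> ('x, 'y) smap
    \<Rightarrow> (('a, 'b, 'x) dpoly, ('a, 'b, 'y) dpoly) smap" where
  "dpoly_map A B f k = dprod_map A B f (pullback_map k)"


section \<open>Algebras\<close>

definition dpoly_algebra :: "'a sset \<Rightarrow> 'b sset \<Rightarrow> 'c sset
    \<Rightarrow> ('b, 'c) smap \<Rightarrow> ('b, 'a) smap \<Rightarrow> ('a, 'c) smap
    \<Rightarrow> ('x, 'c) over \<Rightarrow> (('a, 'b, 'x) dpoly, 'x) smap \<Rightarrow> bool" where
  "dpoly_algebra A B C h f g X \<alpha> \<longleftrightarrow>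
     is_over C X \<and> over_map (dpoly A B h f g X) X \<alpha>"

definition dpoly_algebra_map :: "'a sset \<Rightarrow> 'b sset
    \<Rightarrow> ('b, 'c) smap \<Rightarrow> ('b, 'a) smap \<Rightarrow> ('a, 'c) smap
    \<Rightarrow> ('x, 'c) over \<Rightarrow> (('a, 'b, 'x) dpoly, 'x) smap
    \<Rightarrow> ('y, 'c) over \<Rightarrow> (('a, 'b, 'y) dpoly, 'y) smap \<Rightarrow> ('x, 'y) smap \<Rightarrow> bool" where
  "dpoly_algebra_map A B h f g X \<alpha> Y \<beta> k \<longleftrightarrow>
     over_map X Y k \<and>
     smap_eq (total_space (dpoly A B h f g X))
       (\<lambda>n t. k n (\<alpha> n t)) (\<lambda>n t. \<beta> n (dpoly_map A B f k n t))"

definition initial_among :: "'y itself \<Rightarrow> 'a sset \<Rightarrow> 'b sset \<Rightarrow> 'c sset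
    \<Rightarrow> ('b, 'c) smap \<Rightarrow> ('b, 'a) smap \<Rightarrow> ('a, 'c) smap
    \<Rightarrow> ('x, 'c) over \<Rightarrow> (('a, 'b, 'x) dpoly, 'x) smap \<Rightarrow> bool" where
  "initial_among (_ :: 'y itself) A B C h f g X \<alpha> \<longleftrightarrow>
     (\<forall>(Y :: ('y, 'c) over) \<beta>. dpoly_algebra A B C h f g Y \<beta> \<longrightarrow>
        (\<exists>k. dpoly_algebra_map A B h f g X \<alpha> Y \<beta> k) \<and>
        (\<forall>k k'. dpoly_algebra_map A B h f g X \<alpha> Y \<beta> k \<and>
                dpoly_algebra_map A B h f g X \<alpha> Y \<beta> k' \<longrightarrow> smap_eq (total_space X) k k'))"

text \<open>
  A HOL formula cannot quantify over all types in which the simplices of another algebra might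
  live.  Initiality is therefore required against the algebras with simplices in the type of \<open>X\<close>
  itself and in the type of the value of the functor at \<open>X\<close>.  The theorem
  \<open>initial_algebra_all_types\<close> below shows that this already implies initiality against the
  algebras with simplices in any type whatsoever.
\<close>

definition initial_dpoly_algebra :: "'a sset \<Rightarrow> 'b sset \<Rightarrow> 'c sset
    \<Rightarrow> ('b, 'c) smap \<Rightarrow> ('b, 'a) smap \<Rightarrow> ('a, 'c) smap
    \<Rightarrow> ('x, 'c) over \<Rightarrow> (('a, 'b, 'x) dpoly, 'x) smap \<Rightarrow> bool" where
  "initial_dpoly_algebra A B C h f g X (\<alpha> :: (('a, 'b, 'x) dpoly, 'x) smap) \<longleftrightarrow>
     dpoly_algebra A B C h f g X \<alpha> \<and>
     initial_among TYPE('x) A B C h f g X \<alpha> \<and>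
     initial_among TYPE(('a, 'b, 'x) dpoly) A B C h f g X \<alpha>"


section \<open>Basic facts\<close>

lemma compose_\<Delta>: "compose {..l} \<theta> \<psi> \<in> \<Delta> l n" if "\<theta> \<in> \<Delta> m n" "\<psi> \<in> \<Delta> l m"
proof -
  have "compose {..l} \<theta> \<psi> \<in> {..l} \<rightarrow>\<^sub>E {..n}"
    using that by (auto simp: \<Delta>_def compose_def PiE_def Pi_def)
  moreover have "mono_on {..l} (compose {..l} \<theta> \<psi>)"
    using that by (auto simp: \<Delta>_def compose_def PiE_def Pi_def mono_on_def)
  ultimately show ?thesis by (simp add: \<Delta>_def)
qed

lemma \<Delta>_id_in: "\<Delta>_id n \<in> \<Delta> n n"
  by (auto simp: \<Delta>_def \<Delta>_id_def mono_on_def)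

lemma compose_\<Delta>_id_right: "\<theta> \<in> \<Delta> m n \<Longrightarrow> compose {..m} \<theta> (\<Delta>_id m) = \<theta>"
  by (rule ext) (auto simp: \<Delta>_def \<Delta>_id_def compose_def PiE_def extensional_def)

lemma compose_\<Delta>_id_left: "\<theta> \<in> \<Delta> m n \<Longrightarrow> compose {..m} (\<Delta>_id n) \<theta> = \<theta>"
  by (rule ext) (auto simp: \<Delta>_def \<Delta>_id_def compose_def PiE_def extensional_def)

lemma compose_\<Delta>_assoc:
  "\<phi> \<in> \<Delta> k l \<Longrightarrow>
    compose {..k} (compose {..l} \<theta> \<psi>) \<phi> = compose {..k} \<theta> (compose {..k} \<psi> \<phi>)"
  by (rule ext) (auto simp: \<Delta>_def compose_def PiE_def Pi_def)

lemma is_ssetD: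
  assumes "is_sset X"
  shows act_in: "\<theta> \<in> \<Delta> m n \<Longrightarrow> x \<in> simplices X n \<Longrightarrow> act X m n \<theta> x \<in> simplices X m"
    and act_id: "x \<in> simplices X n \<Longrightarrow> act X n n (\<Delta>_id n) x = x"
    and act_comp: "\<psi> \<in> \<Delta> l m \<Longrightarrow> \<theta> \<in> \<Delta> m n \<Longrightarrow> x \<in> simplices X n \<Longrightarrow>
        act X l n (compose {..l} \<theta> \<psi>) x = act X l m \<psi> (act X m n \<theta> x)"
  using assms by (auto simp: is_sset_def)

lemma is_smapD:
  assumes "is_smap X Y k"
  shows smap_in: "x \<in> simplices X n \<Longrightarrow> k n x \<in> simplices Y n"
    and smap_act: "\<theta> \<in> \<Delta> m n \<Longrightarrow> x \<in> simplices X n \<Longrightarrow>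
        k m (act X m n \<theta> x) = act Y m n \<theta> (k n x)"
  using assms by (auto simp: is_smap_def)

lemma over_mapD:
  assumes "over_map (X, p) (Y, q) k"
  shows "is_smap X Y k" and "x \<in> simplices X n \<Longrightarrow> q n (k n x) = p n x"
  using assms by (auto simp: smap_eq_def)

lemma over_map_iff:
  "over_map X Y k \<longleftrightarrow> is_smap (total_space X) (total_space Y) k \<and>
     smap_eq (total_space X) (\<lambda>n x. snd Y n (k n x)) (snd X)"
  by (cases X; cases Y) simp

lemma fibre_iff:
  "(m, \<theta>, b) \<in> fibre A B f n a \<longleftrightarrow>
     \<theta> \<in> \<Delta> m n \<and> b \<in> simplices B m \<and> f m b = act A m n \<theta> a"
  by (simp add: fibre_def)

lemma pullback_over:
  assumes "is_sset B" "is_smap B C h" "is_over C (X, p)"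
  shows "is_over B (pullback B h (X, p))"
  using assms by (auto simp: is_sset_def is_smap_def)


section \<open>The dependent product is right adjoint to pullback\<close>

context
  fixes A :: "'a sset" and B :: "'b sset" and f :: "('b, 'a) smap"
  assumes A: "is_sset A" and B: "is_sset B" and f: "is_smap B A f"
begin

lemma fibre_act:
  assumes "(m, \<theta>, b) \<in> fibre A B f n a" "\<psi> \<in> \<Delta> l m" "a \<in> simplices A n"
  shows "(l, compose {..l} \<theta> \<psi>, act B l m \<psi> b) \<in> fibre A B f n a"
  using assms
  by (auto simp: fibre_iff compose_\<Delta> act_in[OF B] smap_act[OF f] act_comp[OF A])

lemma fibre_shift:
  assumes "(l, \<psi>, b) \<in> fibre A B f m (act A m n \<theta> a)" "\<theta> \<in> \<Delta> m n" "a \<in> simplices A n"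
  shows "(l, compose {..l} \<theta> \<psi>, b) \<in> fibre A B f n a"
  using assms by (auto simp: fibre_iff compose_\<Delta> act_comp[OF A])

lemma fibre_id:
  "b \<in> simplices B n \<Longrightarrow> (n, \<Delta>_id n, b) \<in> fibre A B f n (f n b)"
  by (simp add: fibre_iff \<Delta>_id_in act_id[OF A] smap_in[OF f])

lemma dprod_memI:
  assumes "a \<in> simplices A n" "s \<in> extensional (fibre A B f n a)"
    and "\<And>m \<theta> b. (m, \<theta>, b) \<in> fibre A B f n a \<Longrightarrow> s (m, \<theta>, b) \<in> simplices E m"
    and "\<And>m \<theta> b. (m, \<theta>, b) \<in> fibre A B f n a \<Longrightarrow> q m (s (m, \<theta>, b)) = b"
    and "\<And>m \<theta> b l \<psi>. (m, \<theta>, b) \<in> fibre A B f n a \<Longrightarrow> \<psi> \<in> \<Delta> l m \<Longrightarrow>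
           s (l, compose {..l} \<theta> \<psi>, act B l m \<psi> b) = act E l m \<psi> (s (m, \<theta>, b))"
  shows "(a, s) \<in> simplices (total_space (dprod A B f (E, q))) n"
  using assms by auto

lemma dprod_memD:
  assumes "(a, s) \<in> simplices (total_space (dprod A B f (E, q))) n"
  shows "a \<in> simplices A n" "s \<in> extensional (fibre A B f n a)"
    and "(m, \<theta>, b) \<in> fibre A B f n a \<Longrightarrow> s (m, \<theta>, b) \<in> simplices E m"
    and "(m, \<theta>, b) \<in> fibre A B f n a \<Longrightarrow> q m (s (m, \<theta>, b)) = b"
    and "(m, \<theta>, b) \<in> fibre A B f n a \<Longrightarrow> \<psi> \<in> \<Delta> l m \<Longrightarrow>
           s (l, compose {..l} \<theta> \<psi>, act B l m \<psi> b) = act E l m \<psi> (s (m, \<theta>, b))"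
  using assms by auto

lemma dprod_act:
  "act (total_space (dprod A B f Eq)) m n \<theta> (a, s) =
     (act A m n \<theta> a,
      \<lambda>(l, \<psi>, b)\<in>fibre A B f m (act A m n \<theta> a). s (l, compose {..l} \<theta> \<psi>, b))"
  by (cases Eq) simp

lemma dprod_act_in:
  assumes s: "(a, s) \<in> simplices (total_space (dprod A B f (E, q))) n" and \<theta>: "\<theta> \<in> \<Delta> m n"
  shows "act (total_space (dprod A B f (E, q))) m n \<theta> (a, s) \<in> simplices (total_space (dprod A B f (E, q))) m"
  unfolding dprod_act
proof (rule dprod_memI, goal_cases)
  case 1 show ?case using \<theta> dprod_memD(1)[OF s] by (rule act_in[OF A])
next
  case 2 show ?case by simp
next
  case (3 l \<psi> b) then show ?case
    using dprod_memD(3)[OF s fibre_shift[OF 3 \<theta> dprod_memD(1)[OF s]]] by simp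
next
  case (4 l \<psi> b) then show ?case
    using dprod_memD(4)[OF s fibre_shift[OF 4 \<theta> dprod_memD(1)[OF s]]] by simp
next
  case (5 l \<psi> b k \<phi>)
  have "(k, compose {..k} \<psi> \<phi>, act B k l \<phi> b) \<in> fibre A B f m (act A m n \<theta> a)"
    using 5 act_in[OF A \<theta> dprod_memD(1)[OF s]] by (rule fibre_act)
  then show ?case
    using 5 dprod_memD(5)[OF s fibre_shift[OF 5(1) \<theta> dprod_memD(1)[OF s]] 5(2)]
    by (simp add: compose_\<Delta>_assoc)
qed

lemma dprod_over: "is_over A (dprod A B f (E, q))"
proof -
  let ?P = "total_space (dprod A B f (E, q))"
  have "is_sset ?P"
    unfolding is_sset_def
  proof (intro conjI allI ballI; clarify?)
    fix m n \<theta> a s assume "\<theta> \<in> \<Delta> m n" "(a, s) \<in> simplices ?P n"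
    then show "act ?P m n \<theta> (a, s) \<in> simplices ?P m" by (rule dprod_act_in[rotated])
  next
    fix n a s assume s: "(a, s) \<in> simplices ?P n"
    have "(\<lambda>(l, \<psi>, b)\<in>fibre A B f n a. s (l, compose {..l} (\<Delta>_id n) \<psi>, b)) = s"
      by (rule extensionalityI[OF restrict_extensional dprod_memD(2)[OF s]])
        (auto simp: fibre_iff compose_\<Delta>_id_left)
    then show "act ?P n n (\<Delta>_id n) (a, s) = (a, s)"
      by (simp add: dprod_act act_id[OF A dprod_memD(1)[OF s]])
  next
    fix l m n \<psi> \<theta> a s
    assume \<psi>: "\<psi> \<in> \<Delta> l m" and \<theta>: "\<theta> \<in> \<Delta> m n" and s: "(a, s) \<in> simplices ?P n"
    note a = dprod_memD(1)[OF s]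
    have "(\<lambda>(k, \<phi>, b)\<in>fibre A B f l (act A l m \<psi> (act A m n \<theta> a)).
             s (k, compose {..k} (compose {..l} \<theta> \<psi>) \<phi>, b)) =
          (\<lambda>(k, \<phi>, b)\<in>fibre A B f l (act A l m \<psi> (act A m n \<theta> a)).
             (\<lambda>(l, \<psi>, b)\<in>fibre A B f m (act A m n \<theta> a). s (l, compose {..l} \<theta> \<psi>, b))
               (k, compose {..k} \<psi> \<phi>, b))"
    proof (rule restrict_ext, clarify)
      fix k \<phi> b assume t: "(k, \<phi>, b) \<in> fibre A B f l (act A l m \<psi> (act A m n \<theta> a))"
      then show "s (k, compose {..k} (compose {..l} \<theta> \<psi>) \<phi>, b) =
          (\<lambda>(l, \<psi>, b)\<in>fibre A B f m (act A m n \<theta> a). s (l, compose {..l} \<theta> \<psi>, b))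
               (k, compose {..k} \<psi> \<phi>, b)"
        using fibre_shift[OF t \<psi> act_in[OF A \<theta> a]] by (auto simp: fibre_iff compose_\<Delta>_assoc)
    qed
    then show "act ?P l n (compose {..l} \<theta> \<psi>) (a, s) = act ?P l m \<psi> (act ?P m n \<theta> (a, s))"
      by (simp only: dprod_act act_comp[OF A \<psi> \<theta> a])
  qed
  then show ?thesis by (auto simp: A is_smap_def)
qed

text \<open>
  The counit evaluates a section at the identity.  It is a map over \<open>B\<close>, and every map over \<open>B\<close>
  from a pullback along \<open>f\<close> factors through it by a unique map over \<open>A\<close>.
\<close>

definition dprod_counit :: "('b \<times> 'a \<times> (nat \<times> (nat \<Rightarrow> nat) \<times> 'b \<Rightarrow> 'e), 'e) smap" where
  "dprod_counit = (\<lambda>n (b, a, s). s (n, \<Delta>_id n, b))"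

theorem dprod_counit_over:
  "over_map (pullback B f (dprod A B f (E, q))) (E, q) dprod_counit"
proof -
  let ?P = "total_space (dprod A B f (E, q))"
  have *: "b \<in> simplices B n \<and> (a, s) \<in> simplices ?P n \<and> f n b = a"
    if "(b, a, s) \<in> simplices (total_space (pullback B f (dprod A B f (E, q)))) n" for b a s n
    using that by auto
  have "is_smap (total_space (pullback B f (dprod A B f (E, q)))) E dprod_counit"
    unfolding is_smap_def
  proof (intro conjI allI ballI; clarify)
    fix n b a s assume "(b, a, s) \<in> simplices (total_space (pullback B f (dprod A B f (E, q)))) n"
    then show "dprod_counit n (b, a, s) \<in> simplices E n"
      using *[of b a s n] dprod_memD(3) fibre_id unfolding dprod_counit_def by fastforce
  next
    fix m n \<theta> b a s
    assume \<theta>: "\<theta> \<in> \<Delta> m n"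
      and "(b, a, s) \<in> simplices (total_space (pullback B f (dprod A B f (E, q)))) n"
    with * have b: "b \<in> simplices B n" and s: "(a, s) \<in> simplices ?P n" and a: "a = f n b" by auto
    have "dprod_counit m (act B m n \<theta> b, act ?P m n \<theta> (a, s)) =
            s (m, compose {..m} \<theta> (\<Delta>_id m), act B m n \<theta> b)"
      using fibre_id[OF act_in[OF B \<theta> b]] smap_act[OF f \<theta> b]
      by (simp add: dprod_counit_def dprod_act a)
    also have "\<dots> = s (m, compose {..m} (\<Delta>_id n) \<theta>, act B m n \<theta> b)"
      by (simp add: compose_\<Delta>_id_left[OF \<theta>] compose_\<Delta>_id_right[OF \<theta>])
    also have "\<dots> = act E m n \<theta> (dprod_counit n (b, a, s))"
      using dprod_memD(5)[OF s _ \<theta>] fibre_id[OF b] by (simp add: dprod_counit_def a)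
    finally show "dprod_counit m
          (act (total_space (pullback B f (dprod A B f (E, q)))) m n \<theta> (b, a, s)) =
        act E m n \<theta> (dprod_counit n (b, a, s))"
      by simp
  qed
  moreover have "q n (dprod_counit n (b, a, s)) = b"
    if "(b, a, s) \<in> simplices (total_space (pullback B f (dprod A B f (E, q)))) n" for n b a s
    using *[OF that] dprod_memD(4) fibre_id unfolding dprod_counit_def by fastforce
  ultimately show ?thesis by (auto simp: smap_eq_def)
qed

theorem dprod_universal:
  assumes Y: "is_over A (Y, r)" and k: "over_map (pullback B f (Y, r)) (E, q) k"
  shows "\<exists>u. over_map (Y, r) (dprod A B f (E, q)) u \<and>
           smap_eq (total_space (pullback B f (Y, r))) (\<lambda>n t. dprod_counit n (pullback_map u n t)) k"
    and "\<And>u u'. over_map (Y, r) (dprod A B f (E, q)) u \<Longrightarrow>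
           smap_eq (total_space (pullback B f (Y, r))) (\<lambda>n t. dprod_counit n (pullback_map u n t)) k \<Longrightarrow>
           over_map (Y, r) (dprod A B f (E, q)) u' \<Longrightarrow>
           smap_eq (total_space (pullback B f (Y, r))) (\<lambda>n t. dprod_counit n (pullback_map u' n t)) k \<Longrightarrow>
           smap_eq Y u u'"
proof -
  let ?P = "total_space (dprod A B f (E, q))"
  have Ys: "is_sset Y" and r: "is_smap Y A r" using Y by auto
  have k_in: "k n (b, y) \<in> simplices E n" and k_over: "q n (k n (b, y)) = b"
    if "b \<in> simplices B n" "y \<in> simplices Y n" "f n b = r n y" for n b y
    using k that by (auto simp: is_smap_def smap_eq_def)
  have k_act: "k m (act B m n \<theta> b, act Y m n \<theta> y) = act E m n \<theta> (k n (b, y))"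
    if "\<theta> \<in> \<Delta> m n" "b \<in> simplices B n" "y \<in> simplices Y n" "f n b = r n y" for m n \<theta> b y
    using k that by (auto simp: is_smap_def)
  define u where
    "u n y = (r n y, \<lambda>(m, \<theta>, b)\<in>fibre A B f n (r n y). k m (b, act Y m n \<theta> y))" for n y
  have u_in: "u n y \<in> simplices ?P n" if y: "y \<in> simplices Y n" for n y
    unfolding u_def
  proof (rule dprod_memI, goal_cases)
    case 1 show ?case using y by (rule smap_in[OF r])
  next
    case 2 show ?case by simp
  next
    case (3 m \<theta> b) then show ?case
      using k_in[of b m "act Y m n \<theta> y"] y by (simp add: fibre_iff act_in[OF Ys] smap_act[OF r])
  next
    case (4 m \<theta> b) then show ?case
      using k_over[of b m "act Y m n \<theta> y"] y by (simp add: fibre_iff act_in[OF Ys] smap_act[OF r])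
  next
    case (5 m \<theta> b l \<psi>) then show ?case
      using fibre_act[OF 5 smap_in[OF r y]] k_act[of \<psi> l m b "act Y m n \<theta> y"] y
      by (simp add: fibre_iff act_in[OF Ys] smap_act[OF r] act_comp[OF Ys])
  qed
  have u_act: "u m (act Y m n \<theta> y) = act ?P m n \<theta> (u n y)"
    if y: "y \<in> simplices Y n" and \<theta>: "\<theta> \<in> \<Delta> m n" for m n \<theta> y
    unfolding u_def dprod_act smap_act[OF r \<theta> y]
  proof (rule arg_cong[where f = "Pair _"], rule restrict_ext, clarify)
    fix l \<psi> b assume t: "(l, \<psi>, b) \<in> fibre A B f m (act A m n \<theta> (r n y))"
    then show "k l (b, act Y l m \<psi> (act Y m n \<theta> y)) =
        (\<lambda>(m, \<theta>, b)\<in>fibre A B f n (r n y). k m (b, act Y m n \<theta> y)) (l, compose {..l} \<theta> \<psi>, b)"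
      using fibre_shift[OF t \<theta> smap_in[OF r y]] y \<theta> act_comp[OF Ys, of \<psi> l m \<theta> n y]
      by (auto simp: fibre_iff)
  qed
  have "is_smap Y ?P u"
    unfolding is_smap_def by (intro conjI allI ballI; rule u_in u_act; assumption)
  moreover have "snd (dprod A B f (E, q)) n (u n y) = r n y" for n y
    by (simp add: u_def)
  ultimately have u: "over_map (Y, r) (dprod A B f (E, q)) u"
    by (simp add: over_map_iff smap_eq_def del: dprod.simps over_map.simps)
  have "dprod_counit n (b, u n y) = k n (b, y)"
    if "b \<in> simplices B n" "y \<in> simplices Y n" "f n b = r n y" for n b y
    using fibre_id[OF that(1)] that(2,3) by (simp add: dprod_counit_def u_def act_id[OF Ys])
  then have "smap_eq (total_space (pullback B f (Y, r)))
      (\<lambda>n t. dprod_counit n (pullback_map u n t)) k"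
    by (auto simp: smap_eq_def pullback_map_def)
  with u show "\<exists>u. over_map (Y, r) (dprod A B f (E, q)) u \<and>
      smap_eq (total_space (pullback B f (Y, r))) (\<lambda>n t. dprod_counit n (pullback_map u n t)) k"
    by blast
next
  let ?P = "total_space (dprod A B f (E, q))"
  have Ys: "is_sset Y" and r: "is_smap Y A r" using Y by auto
  have key: "u n y = (r n y, \<lambda>(m, \<theta>, b)\<in>fibre A B f n (r n y). k m (b, act Y m n \<theta> y))"
    if u: "over_map (Y, r) (dprod A B f (E, q)) u"
      and c: "smap_eq (total_space (pullback B f (Y, r))) (\<lambda>n t. dprod_counit n (pullback_map u n t)) k"
      and y: "y \<in> simplices Y n" for u n y
  proof -
    have um: "is_smap Y ?P u" and fst_u: "fst (u n y) = r n y"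
      using u y by (auto simp: smap_eq_def)
    obtain s where uy: "u n y = (r n y, s)" using fst_u by (cases "u n y") auto
    have s: "(r n y, s) \<in> simplices ?P n" using smap_in[OF um y] by (simp only: uy)
    have "s = (\<lambda>(m, \<theta>, b)\<in>fibre A B f n (r n y). k m (b, act Y m n \<theta> y))"
    proof (rule extensionalityI[OF dprod_memD(2)[OF s] restrict_extensional], clarify)
      fix m \<theta> b assume t: "(m, \<theta>, b) \<in> fibre A B f n (r n y)"
      then have \<theta>: "\<theta> \<in> \<Delta> m n" and b: "b \<in> simplices B m" and fb: "f m b = act A m n \<theta> (r n y)"
        by (auto simp: fibre_iff)
      have y': "act Y m n \<theta> y \<in> simplices Y m" "f m b = r m (act Y m n \<theta> y)"
        using \<theta> y by (auto simp: act_in[OF Ys] smap_act[OF r] fb)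
      have "k m (b, act Y m n \<theta> y) = dprod_counit m (b, u m (act Y m n \<theta> y))"
        using c b y' by (auto simp: smap_eq_def pullback_map_def)
      also have "\<dots> = dprod_counit m (b, act ?P m n \<theta> (u n y))"
        by (simp only: smap_act[OF um \<theta> y])
      also have "\<dots> = s (m, \<theta>, b)"
        using fibre_id[OF b] by (simp add: uy dprod_act dprod_counit_def fb compose_\<Delta>_id_right[OF \<theta>])
      finally show "s (m, \<theta>, b) =
          (\<lambda>(m, \<theta>, b)\<in>fibre A B f n (r n y). k m (b, act Y m n \<theta> y)) (m, \<theta>, b)"
        using t by simp
    qed
    then show ?thesis by (simp only: uy)
  qed
  fix u u'
  assume u: "over_map (Y, r) (dprod A B f (E, q)) u"
    "smap_eq (total_space (pullback B f (Y, r))) (\<lambda>n t. dprod_counit n (pullback_map u n t)) k"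
    and u': "over_map (Y, r) (dprod A B f (E, q)) u'"
    "smap_eq (total_space (pullback B f (Y, r))) (\<lambda>n t. dprod_counit n (pullback_map u' n t)) k"
  have "u n y = u' n y" if "y \<in> simplices Y n" for n y
    by (rule trans[OF key[OF u that] key[OF u' that, symmetric]])
  then show "smap_eq Y u u'" by (simp add: smap_eq_def)
qed

end

section \<open>Initiality does not depend on the type\<close>

context
  fixes A :: "'a sset" and B :: "'b sset" and C :: "'c sset"
    and h :: "('b, 'c) smap" and f :: "('b, 'a) smap" and g :: "('a, 'c) smap"
  assumes A: "is_sset A" and B: "is_sset B"
    and h: "is_smap B C h" and f: "is_smap B A f" and g: "is_smap A C g"
begin

lemma total_dsum: "total_space (dsum g Y) = total_space Y"
  by (cases Y) simp

lemma dpoly_memI: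
  assumes "a \<in> simplices A n" "s \<in> extensional (fibre A B f n a)"
    and "\<And>m \<theta> b. (m, \<theta>, b) \<in> fibre A B f n a \<Longrightarrow> fst (s (m, \<theta>, b)) = b"
    and "\<And>m \<theta> b. (m, \<theta>, b) \<in> fibre A B f n a \<Longrightarrow> snd (s (m, \<theta>, b)) \<in> simplices X m"
    and "\<And>m \<theta> b. (m, \<theta>, b) \<in> fibre A B f n a \<Longrightarrow> p m (snd (s (m, \<theta>, b))) = h m b"
    and "\<And>m \<theta> b l \<psi>. (m, \<theta>, b) \<in> fibre A B f n a \<Longrightarrow> \<psi> \<in> \<Delta> l m \<Longrightarrow>
           snd (s (l, compose {..l} \<theta> \<psi>, act B l m \<psi> b)) = act X l m \<psi> (snd (s (m, \<theta>, b)))"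
  shows "(a, s) \<in> simplices (total_space (dpoly A B h f g (X, p))) n"
proof -
  obtain P r where P: "pullback B h (X, p) = (P, r)" by (cases "pullback B h (X, p)")
  have simplices_P: "(b, x) \<in> simplices P n \<longleftrightarrow> b \<in> simplices B n \<and> x \<in> simplices X n \<and> h n b = p n x"
    and act_P: "act P m n \<theta> (b, x) = (act B m n \<theta> b, act X m n \<theta> x)"
    and r: "r n (b, x) = b" for m n \<theta> b x
    using P by auto
  have s_eq: "s (m, \<theta>, b) = (b, snd (s (m, \<theta>, b)))" if "(m, \<theta>, b) \<in> fibre A B f n a" for m \<theta> b
    using assms(3)[OF that] by (simp add: prod_eq_iff)
  have "(a, s) \<in> simplices (total_space (dprod A B f (P, r))) n"
  proof (rule dprod_memI[OF A B f assms(1,2)], goal_cases)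
    case (1 m \<theta> b) then show ?case
      using assms(4,5)[OF 1] by (subst s_eq) (auto simp: simplices_P fibre_iff)
  next
    case (2 m \<theta> b) then show ?case by (subst s_eq) (auto simp: r)
  next
    case (3 m \<theta> b l \<psi>)
    have "s (l, compose {..l} \<theta> \<psi>, act B l m \<psi> b) =
        (act B l m \<psi> b, act X l m \<psi> (snd (s (m, \<theta>, b))))"
      using assms(3)[OF fibre_act[OF A B f 3 assms(1)]] assms(6)[OF 3] by (simp add: prod_eq_iff)
    also have "\<dots> = act P l m \<psi> (s (m, \<theta>, b))"
      by (subst (2) s_eq[OF 3(1)]) (simp add: act_P)
    finally show ?case .
  qed
  then show ?thesis by (simp only: dpoly_def P total_dsum)
qed

lemma dpoly_memD:
  assumes "(a, s) \<in> simplices (total_space (dpoly A B h f g (X, p))) n"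
  shows "a \<in> simplices A n" "s \<in> extensional (fibre A B f n a)"
    and "(m, \<theta>, b) \<in> fibre A B f n a \<Longrightarrow> fst (s (m, \<theta>, b)) = b"
    and "(m, \<theta>, b) \<in> fibre A B f n a \<Longrightarrow> snd (s (m, \<theta>, b)) \<in> simplices X m"
    and "(m, \<theta>, b) \<in> fibre A B f n a \<Longrightarrow> p m (snd (s (m, \<theta>, b))) = h m b"
    and "(m, \<theta>, b) \<in> fibre A B f n a \<Longrightarrow> \<psi> \<in> \<Delta> l m \<Longrightarrow>
           snd (s (l, compose {..l} \<theta> \<psi>, act B l m \<psi> b)) = act X l m \<psi> (snd (s (m, \<theta>, b)))"
proof -
  have s: "(a, s) \<in> simplices (total_space (dprod A B f (pullback B h (X, p)))) n"
    using assms by (simp add: dpoly_def)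
  note s' = s[unfolded pullback.simps]
  show "a \<in> simplices A n" "s \<in> extensional (fibre A B f n a)"
    using dprod_memD(1,2)[OF A B f s'] by auto
  show "fst (s (m, \<theta>, b)) = b" "snd (s (m, \<theta>, b)) \<in> simplices X m"
    "p m (snd (s (m, \<theta>, b))) = h m b" if "(m, \<theta>, b) \<in> fibre A B f n a"
    using dprod_memD(3,4)[OF A B f s' that] by auto
  show "snd (s (l, compose {..l} \<theta> \<psi>, act B l m \<psi> b)) = act X l m \<psi> (snd (s (m, \<theta>, b)))"
    if "(m, \<theta>, b) \<in> fibre A B f n a" "\<psi> \<in> \<Delta> l m"
    using dprod_memD(5)[OF A B f s' that] by (auto split: prod.splits)
qed

lemma dpoly_act:
  "act (total_space (dpoly A B h f g X)) m n \<theta> (a, s) =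
     (act A m n \<theta> a,
      \<lambda>(l, \<psi>, b)\<in>fibre A B f m (act A m n \<theta> a). s (l, compose {..l} \<theta> \<psi>, b))"
  by (cases X) (simp add: dpoly_def)

lemma dpoly_proj: "snd (dpoly A B h f g X) n (a, s) = g n a"
  by (cases X) (simp add: dpoly_def)

lemma dpoly_act_in:
  assumes "(a, s) \<in> simplices (total_space (dpoly A B h f g X)) n" "\<theta> \<in> \<Delta> m n"
  shows "act (total_space (dpoly A B h f g X)) m n \<theta> (a, s) \<in> simplices (total_space (dpoly A B h f g X)) m"
proof -
  obtain Y q where X: "X = (Y, q)" by (cases X)
  obtain P r where P: "pullback B h X = (P, r)" by (cases "pullback B h X")
  have "total_space (dpoly A B h f g X) = total_space (dprod A B f (P, r))"
    by (simp only: dpoly_def P total_dsum)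
  then show ?thesis using dprod_act_in[OF A B f] assms by metis
qed

lemma dpoly_over:
  assumes "is_sset C"
  shows "is_over C (dpoly A B h f g X)"
proof -
  obtain P r where P: "pullback B h X = (P, r)" by (cases "pullback B h X")
  obtain D e where D: "dprod A B f (P, r) = (D, e)" by (cases "dprod A B f (P, r)")
  have "is_over A (D, e)" using dprod_over[OF A B f, of P r] by (simp only: D)
  then have "is_sset D" "is_smap D A e" by auto
  then show ?thesis using g assms unfolding dpoly_def P D by (auto simp: is_smap_def)
qed

lemma dpoly_map_apply:
  "dpoly_map A B f k n (a, s) =
     (a, \<lambda>(m, \<theta>, b)\<in>fibre A B f n a. (fst (s (m, \<theta>, b)), k m (snd (s (m, \<theta>, b)))))"
  by (simp add: dpoly_map_def dprod_map_def pullback_map_def case_prod_unfold)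

lemma dpoly_map_in:
  assumes k: "over_map (X, p) (Y, q) k"
    and s: "(a, s) \<in> simplices (total_space (dpoly A B h f g (X, p))) n"
  shows "dpoly_map A B f k n (a, s) \<in> simplices (total_space (dpoly A B h f g (Y, q))) n"
  unfolding dpoly_map_apply
proof (rule dpoly_memI, goal_cases)
  case 1 show ?case by (rule dpoly_memD(1)[OF s])
next
  case 2 show ?case by simp
next
  case (3 m \<theta> b) then show ?case using dpoly_memD(3)[OF s 3] by simp
next
  case (4 m \<theta> b) then show ?case
    using smap_in[OF over_mapD(1)[OF k] dpoly_memD(4)[OF s 4]] by simp
next
  case (5 m \<theta> b) then show ?case
    using over_mapD(2)[OF k dpoly_memD(4)[OF s 5]] dpoly_memD(5)[OF s 5] by simp
next
  case (6 m \<theta> b l \<psi>) then show ?case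
    using smap_act[OF over_mapD(1)[OF k] 6(2) dpoly_memD(4)[OF s 6(1)]] dpoly_memD(6)[OF s 6]
      fibre_act[OF A B f 6 dpoly_memD(1)[OF s]] by simp
qed

lemma dpoly_map_over:
  assumes k: "over_map (X, p) (Y, q) k"
  shows "over_map (dpoly A B h f g (X, p)) (dpoly A B h f g (Y, q)) (dpoly_map A B f k)"
proof -
  let ?F = "dpoly A B h f g (X, p)" and ?G = "dpoly A B h f g (Y, q)"
  have "is_smap (total_space ?F) (total_space ?G) (dpoly_map A B f k)"
    unfolding is_smap_def
  proof (intro conjI allI ballI; clarify)
    fix n a s assume "(a, s) \<in> simplices (total_space ?F) n"
    then show "dpoly_map A B f k n (a, s) \<in> simplices (total_space ?G) n" by (rule dpoly_map_in[OF k])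
  next
    fix m n \<theta> a s assume \<theta>: "\<theta> \<in> \<Delta> m n" and s: "(a, s) \<in> simplices (total_space ?F) n"
    show "dpoly_map A B f k m (act (total_space ?F) m n \<theta> (a, s)) =
        act (total_space ?G) m n \<theta> (dpoly_map A B f k n (a, s))"
      unfolding dpoly_act dpoly_map_apply
      by (rule arg_cong[where f = "Pair _"], rule restrict_ext)
        (use fibre_shift[OF A B f _ \<theta> dpoly_memD(1)[OF s]] in auto)
  qed
  moreover have "snd ?G n (dpoly_map A B f k n t) = snd ?F n t" for n t
    by (cases t) (simp add: dpoly_map_apply dpoly_proj)
  ultimately show ?thesis unfolding over_map_iff smap_eq_def by blast
qed

lemma dpoly_map_cong:
  assumes "smap_eq X k k'" "(a, s) \<in> simplices (total_space (dpoly A B h f g (X, p))) n"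
  shows "dpoly_map A B f k n (a, s) = dpoly_map A B f k' n (a, s)"
  unfolding dpoly_map_apply
  by (rule arg_cong[where f = "Pair _"], rule restrict_ext)
    (use dpoly_memD(4)[OF assms(2)] assms(1) in \<open>auto simp: smap_eq_def\<close>)

lemma dpoly_map_id:
  assumes "(a, s) \<in> simplices (total_space (dpoly A B h f g (X, p))) n"
  shows "dpoly_map A B f (\<lambda>n x. x) n (a, s) = (a, s)"
proof -
  have "(\<lambda>(m, \<theta>, b)\<in>fibre A B f n a. (fst (s (m, \<theta>, b)), snd (s (m, \<theta>, b)))) = s"
    by (rule extensionalityI[OF restrict_extensional dpoly_memD(2)[OF assms]]) auto
  then show ?thesis by (simp add: dpoly_map_apply)
qed

lemma dpoly_map_comp:
  "dpoly_map A B f k' n (dpoly_map A B f k n (a, s)) = dpoly_map A B f (\<lambda>n x. k' n (k n x)) n (a, s)"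
  unfolding dpoly_map_apply
  by (rule arg_cong[where f = "Pair _"], rule restrict_ext) auto

lemma over_map_comp:
  assumes "over_map X Y k" "over_map Y Z k'"
  shows "over_map X Z (\<lambda>n x. k' n (k n x))"
  using assms by (cases X; cases Y; cases Z) (auto simp: is_smap_def smap_eq_def)

lemma algebra_map_comp:
  assumes k: "dpoly_algebra_map A B h f g X \<alpha> Y \<beta> k" and k': "dpoly_algebra_map A B h f g Y \<beta> Z \<gamma> k'"
  shows "dpoly_algebra_map A B h f g X \<alpha> Z \<gamma> (\<lambda>n x. k' n (k n x))"
proof -
  obtain X' p Y' q where [simp]: "X = (X', p)" "Y = (Y', q)" by (cases X, cases Y)
  have "k' n (k n (\<alpha> n t)) = \<gamma> n (dpoly_map A B f (\<lambda>n x. k' n (k n x)) n t)"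
    if t: "t \<in> simplices (total_space (dpoly A B h f g X)) n" for n t
  proof (cases t)
    case (Pair a s)
    have "dpoly_map A B f k n t \<in> simplices (total_space (dpoly A B h f g Y)) n"
      using dpoly_map_in[of X' p Y' q k a s n] k t by (simp add: Pair dpoly_algebra_map_def)
    then show ?thesis
      using k k' t dpoly_map_comp[of k' n k a s]
      by (simp add: dpoly_algebra_map_def smap_eq_def Pair)
  qed
  then show ?thesis
    using over_map_comp[of X Y k Z k'] k k' by (simp add: dpoly_algebra_map_def smap_eq_def)
qed

lemma algebra_map_id:
  assumes "dpoly_algebra A B C h f g X \<alpha>"
  shows "dpoly_algebra_map A B h f g X \<alpha> X \<alpha> (\<lambda>n x. x)"
proof -
  obtain X' p where [simp]: "X = (X', p)" by (cases X)
  have "over_map X X (\<lambda>n x. x)" by (simp add: is_smap_def smap_eq_def)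
  moreover have "dpoly_map A B f (\<lambda>n x. x) n t = t"
    if "t \<in> simplices (total_space (dpoly A B h f g X)) n" for n t
    using dpoly_map_id[of "fst t" "snd t" X' p n] that by simp
  ultimately show ?thesis by (simp add: dpoly_algebra_map_def smap_eq_def)
qed

context
  fixes X :: "'x sset" and p :: "('x, 'c) smap" and \<alpha> :: "(('a, 'b, 'x) dpoly, 'x) smap"
  assumes X: "initial_dpoly_algebra A B C h f g (X, p) \<alpha>"
begin

lemma alg: "dpoly_algebra A B C h f g (X, p) \<alpha>"
  using X by (simp add: initial_dpoly_algebra_def)

lemma Xs: "is_sset X" and Cs: "is_sset C" and ps: "is_smap X C p"
  using alg by (auto simp: dpoly_algebra_def)

lemma \<alpha>_over: "over_map (total_space (dpoly A B h f g (X, p)), snd (dpoly A B h f g (X, p))) (X, p) \<alpha>"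
  using alg by (simp add: dpoly_algebra_def)

lemma initial_minimal:
  assumes S: "\<And>n. S n \<subseteq> simplices X n"
    and S_act: "\<And>m n \<theta> x. \<theta> \<in> \<Delta> m n \<Longrightarrow> x \<in> S n \<Longrightarrow> act X m n \<theta> x \<in> S m"
    and S_alg: "\<And>n a s. (a, s) \<in> simplices (total_space (dpoly A B h f g (X, p))) n \<Longrightarrow>
        (\<And>m \<theta> b. (m, \<theta>, b) \<in> fibre A B f n a \<Longrightarrow> snd (s (m, \<theta>, b)) \<in> S m) \<Longrightarrow> \<alpha> n (a, s) \<in> S n"
  shows "S n = simplices X n"
proof -
  define Y where "Y = \<lparr>simplices = S, act = act X\<rparr>"
  let ?i = "\<lambda>(n::nat) (x::'x). x"
  have YX: "x \<in> simplices Y n \<Longrightarrow> x \<in> simplices X n" for x n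
    using S by (auto simp: Y_def)
  have Ys: "is_sset Y"
    unfolding is_sset_def
  proof (intro conjI allI ballI, goal_cases)
    case 1 then show ?case by (simp add: Y_def S_act)
  next
    case 2 then show ?case using YX act_id[OF Xs] by (simp add: Y_def)
  next
    case 3 then show ?case using YX act_comp[OF Xs] by (simp add: Y_def)
  qed
  have i: "over_map (Y, p) (X, p) ?i"
    using YX by (auto simp: is_smap_def smap_eq_def Y_def)
  have Yp: "is_over C (Y, p)"
    using Ys Cs ps YX by (auto simp: is_smap_def) (auto simp: Y_def)
  have F: "(a, s) \<in> simplices (total_space (dpoly A B h f g (X, p))) n"
    if s: "(a, s) \<in> simplices (total_space (dpoly A B h f g (Y, p))) n" for a s n
    by (rule dpoly_memI) (use dpoly_memD[OF s] YX in \<open>auto simp: Y_def\<close>)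
  have \<alpha>Y: "\<alpha> n (a, s) \<in> simplices Y n"
    if s: "(a, s) \<in> simplices (total_space (dpoly A B h f g (Y, p))) n" for a s n
    using S_alg[OF F[OF s]] dpoly_memD(4)[OF s] by (auto simp: Y_def)
  have act_eq: "act (total_space (dpoly A B h f g (Y, p))) m n \<theta> t =
      act (total_space (dpoly A B h f g (X, p))) m n \<theta> t" for m n \<theta> t
    by (cases t) (simp only: dpoly_act)
  have "is_smap (total_space (dpoly A B h f g (Y, p))) Y \<alpha>"
    unfolding is_smap_def
  proof (intro conjI allI ballI; clarify)
    fix n a s assume "(a, s) \<in> simplices (total_space (dpoly A B h f g (Y, p))) n"
    then show "\<alpha> n (a, s) \<in> simplices Y n" by (rule \<alpha>Y)
  next
    fix m n \<theta> a s
    assume \<theta>: "\<theta> \<in> \<Delta> m n" and s: "(a, s) \<in> simplices (total_space (dpoly A B h f g (Y, p))) n"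
    show "\<alpha> m (act (total_space (dpoly A B h f g (Y, p))) m n \<theta> (a, s)) = act Y m n \<theta> (\<alpha> n (a, s))"
      using smap_act[OF over_mapD(1)[OF \<alpha>_over] \<theta> F[OF s]] by (simp only: act_eq) (simp add: Y_def)
  qed
  moreover have "p n (\<alpha> n t) = snd (dpoly A B h f g (Y, p)) n t"
    if "t \<in> simplices (total_space (dpoly A B h f g (Y, p))) n" for n t
    using over_mapD(2)[OF \<alpha>_over F[of "fst t" "snd t" n]] that dpoly_proj[of _ n "fst t" "snd t"]
    by simp
  ultimately have "over_map (dpoly A B h f g (Y, p)) (Y, p) \<alpha>"
    unfolding over_map_iff smap_eq_def fst_conv snd_conv by blast
  with Yp have algY: "dpoly_algebra A B C h f g (Y, p) \<alpha>" by (simp add: dpoly_algebra_def)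
  have "dpoly_map A B f ?i n t = t"
    if "t \<in> simplices (total_space (dpoly A B h f g (Y, p))) n" for n t
    using dpoly_map_id[of "fst t" "snd t" Y p n] that by simp
  with i have iY: "dpoly_algebra_map A B h f g (Y, p) \<alpha> (X, p) \<alpha> ?i"
    by (simp add: dpoly_algebra_map_def smap_eq_def)
  obtain k where k: "dpoly_algebra_map A B h f g (X, p) \<alpha> (Y, p) \<alpha> k"
    using X algY unfolding initial_dpoly_algebra_def initial_among_def by blast
  have "smap_eq X k ?i"
    using X alg algebra_map_comp[OF k iY] algebra_map_id[OF alg]
    unfolding initial_dpoly_algebra_def initial_among_def by fastforce
  moreover have "is_smap X Y k" using k by (simp add: dpoly_algebra_map_def)
  ultimately have "simplices X n \<subseteq> S n"
    by (auto simp: is_smap_def smap_eq_def Y_def)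
  with S show ?thesis by blast
qed

lemma initial_inj:
  "inj_on (\<alpha> n) (simplices (total_space (dpoly A B h f g (X, p))) n)"
proof -
  let ?F = "dpoly A B h f g (X, p)"
  let ?\<beta> = "dpoly_map A B f \<alpha>"
  have "over_map (dpoly A B h f g ?F) ?F ?\<beta>"
    using dpoly_map_over[OF \<alpha>_over] by simp
  with dpoly_over[OF Cs, of "(X, p)"] have algF: "dpoly_algebra A B C h f g ?F ?\<beta>"
    by (simp only: dpoly_algebra_def)
  then obtain k where k: "dpoly_algebra_map A B h f g (X, p) \<alpha> ?F ?\<beta> k"
    using X unfolding initial_dpoly_algebra_def initial_among_def by blast
  have a: "dpoly_algebra_map A B h f g ?F ?\<beta> (X, p) \<alpha> \<alpha>"
    using \<alpha>_over by (simp add: dpoly_algebra_map_def smap_eq_def)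
  have eq: "smap_eq X (\<lambda>n x. \<alpha> n (k n x)) (\<lambda>n x. x)"
    using X alg algebra_map_comp[OF k a] algebra_map_id[OF alg]
    unfolding initial_dpoly_algebra_def initial_among_def by fastforce
  have "k n (\<alpha> n t) = t" if t: "t \<in> simplices (total_space ?F) n" for t
  proof (cases t)
    case (Pair a s)
    have "k n (\<alpha> n t) = ?\<beta> n (dpoly_map A B f k n t)"
      using k t by (simp add: dpoly_algebra_map_def smap_eq_def)
    also have "\<dots> = t"
      using dpoly_map_comp[of \<alpha> n k a s] dpoly_map_cong[OF eq, of a s p n] dpoly_map_id[of a s X p n] t
      by (simp add: Pair)
    finally show ?thesis .
  qed
  then show ?thesis by (rule inj_on_inverseI)
qed

context
  fixes Y :: "'y sset" and q :: "('y, 'c) smap" and \<beta> :: "(('a, 'b, 'y) dpoly, 'y) smap"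
  assumes Y: "dpoly_algebra A B C h f g (Y, q) \<beta>"
begin

lemma Ys: "is_sset Y" and qs: "is_smap Y C q"
  using Y by (auto simp: dpoly_algebra_def)

lemma \<beta>_over: "over_map (total_space (dpoly A B h f g (Y, q)), snd (dpoly A B h f g (Y, q))) (Y, q) \<beta>"
  using Y by (simp add: dpoly_algebra_def)

inductive fold_graph :: "nat \<Rightarrow> 'x \<Rightarrow> 'y \<Rightarrow> bool" where
  "(a, s) \<in> simplices (total_space (dpoly A B h f g (X, p))) n \<Longrightarrow>
   (a, s') \<in> simplices (total_space (dpoly A B h f g (Y, q))) n \<Longrightarrow>
   (\<And>m \<theta> b. (m, \<theta>, b) \<in> fibre A B f n a \<Longrightarrow>
      fold_graph m (snd (s (m, \<theta>, b))) (snd (s' (m, \<theta>, b)))) \<Longrightarrow>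
   fold_graph n (\<alpha> n (a, s)) (\<beta> n (a, s'))"

lemma fold_graph_in:
  assumes "fold_graph n x y"
  shows "x \<in> simplices X n" "y \<in> simplices Y n" "p n x = q n y"
proof -
  have "x \<in> simplices X n \<and> y \<in> simplices Y n \<and> p n x = q n y"
    using assms
  proof (cases rule: fold_graph.cases)
    case (1 a s s')
    then show ?thesis
      using smap_in[OF over_mapD(1)[OF \<alpha>_over] 1(3)] smap_in[OF over_mapD(1)[OF \<beta>_over] 1(4)]
        over_mapD(2)[OF \<alpha>_over 1(3)] over_mapD(2)[OF \<beta>_over 1(4)]
      by (simp add: dpoly_proj)
  qed
  then show "x \<in> simplices X n" "y \<in> simplices Y n" "p n x = q n y" by auto
qed

lemma fold_graph_act:
  assumes "fold_graph n x y" and \<theta>: "\<theta> \<in> \<Delta> m n"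
  shows "fold_graph m (act X m n \<theta> x) (act Y m n \<theta> y)"
  using assms(1)
proof (cases rule: fold_graph.cases)
  case (1 a s s')
  let ?s = "\<lambda>(l, \<psi>, b)\<in>fibre A B f m (act A m n \<theta> a). s (l, compose {..l} \<theta> \<psi>, b)"
  let ?s' = "\<lambda>(l, \<psi>, b)\<in>fibre A B f m (act A m n \<theta> a). s' (l, compose {..l} \<theta> \<psi>, b)"
  have "fold_graph m (\<alpha> m (act A m n \<theta> a, ?s)) (\<beta> m (act A m n \<theta> a, ?s'))"
  proof (rule fold_graph.intros)
    show "(act A m n \<theta> a, ?s) \<in> simplices (total_space (dpoly A B h f g (X, p))) m"
      using dpoly_act_in[OF 1(3) \<theta>] by (simp only: dpoly_act)
    show "(act A m n \<theta> a, ?s') \<in> simplices (total_space (dpoly A B h f g (Y, q))) m"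
      using dpoly_act_in[OF 1(4) \<theta>] by (simp only: dpoly_act)
    fix l \<psi> b assume t: "(l, \<psi>, b) \<in> fibre A B f m (act A m n \<theta> a)"
    then show "fold_graph l (snd (?s (l, \<psi>, b))) (snd (?s' (l, \<psi>, b)))"
      using 1(5)[OF fibre_shift[OF A B f t \<theta> dpoly_memD(1)[OF 1(3)]]] by simp
  qed
  then show ?thesis
    using smap_act[OF over_mapD(1)[OF \<alpha>_over] \<theta> 1(3)] smap_act[OF over_mapD(1)[OF \<beta>_over] \<theta> 1(4)]
    by (simp only: 1(1,2) dpoly_act)
qed

lemma fold_graph_unique: "fold_graph n x y \<Longrightarrow> fold_graph n x y' \<Longrightarrow> y = y'"
proof (induction arbitrary: y' rule: fold_graph.induct)
  case (1 a s n s')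
  note s = 1(1) and s' = 1(2) and IH = 1(4)
  from 1(5) obtain a2 s2 s2' where eq: "\<alpha> n (a, s) = \<alpha> n (a2, s2)" "y' = \<beta> n (a2, s2')"
    and s2: "(a2, s2) \<in> simplices (total_space (dpoly A B h f g (X, p))) n"
    and s2': "(a2, s2') \<in> simplices (total_space (dpoly A B h f g (Y, q))) n"
    and G: "\<And>m \<theta> b. (m, \<theta>, b) \<in> fibre A B f n a2 \<Longrightarrow>
        fold_graph m (snd (s2 (m, \<theta>, b))) (snd (s2' (m, \<theta>, b)))"
    by (cases rule: fold_graph.cases) blast
  have [simp]: "a2 = a" "s2 = s"
    using inj_onD[OF initial_inj eq(1) s s2] by auto
  have "s' = s2'"
  proof (rule extensionalityI)
    show "s' \<in> extensional (fibre A B f n a)" by (rule dpoly_memD(2)[OF s'])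
    show "s2' \<in> extensional (fibre A B f n a)" using dpoly_memD(2)[OF s2'] by simp
    fix t assume "t \<in> fibre A B f n a"
    then obtain m \<theta> b where t: "t = (m, \<theta>, b)" "(m, \<theta>, b) \<in> fibre A B f n a" by (cases t) auto
    have "fst (s' t) = fst (s2' t)"
      using dpoly_memD(3)[OF s' t(2)] dpoly_memD(3)[OF s2'] t by simp
    moreover have "snd (s' t) = snd (s2' t)"
      using IH[OF t(2)] G t by simp
    ultimately show "s' t = s2' t" by (simp add: prod_eq_iff)
  qed
  then show ?case using eq by simp
qed

lemma fold_graph_total: "x \<in> simplices X n \<Longrightarrow> \<exists>y. fold_graph n x y"
proof -
  define S where "S n = {x. \<exists>y. fold_graph n x y}" for n
  have "S n = simplices X n"
  proof (rule initial_minimal)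
    show "S n \<subseteq> simplices X n" for n using fold_graph_in by (auto simp: S_def)
    show "act X m n \<theta> x \<in> S m" if "\<theta> \<in> \<Delta> m n" "x \<in> S n" for m n \<theta> x
      using that fold_graph_act unfolding S_def by blast
    fix n a s
    assume s: "(a, s) \<in> simplices (total_space (dpoly A B h f g (X, p))) n"
      and "\<And>m \<theta> b. (m, \<theta>, b) \<in> fibre A B f n a \<Longrightarrow> snd (s (m, \<theta>, b)) \<in> S m"
    then have "\<exists>y. fold_graph m (snd (s (m, \<theta>, b))) y" if "(m, \<theta>, b) \<in> fibre A B f n a" for m \<theta> b
      using that by (simp add: S_def)
    then obtain Q where Q: "fold_graph m (snd (s (m, \<theta>, b))) (Q m \<theta> b)"
      if "(m, \<theta>, b) \<in> fibre A B f n a" for m \<theta> b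
      by metis
    let ?s = "\<lambda>(m, \<theta>, b)\<in>fibre A B f n a. (b, Q m \<theta> b)"
    have "(a, ?s) \<in> simplices (total_space (dpoly A B h f g (Y, q))) n"
    proof (rule dpoly_memI, goal_cases)
      case 1 show ?case by (rule dpoly_memD(1)[OF s])
    next
      case 2 show ?case by simp
    next
      case 3 then show ?case by simp
    next
      case 4 then show ?case using fold_graph_in(2)[OF Q[OF 4]] by simp
    next
      case 5 then show ?case using fold_graph_in(3)[OF Q[OF 5]] dpoly_memD(5)[OF s 5] by simp
    next
      case (6 m \<theta> b l \<psi>)
      have t: "(l, compose {..l} \<theta> \<psi>, act B l m \<psi> b) \<in> fibre A B f n a"
        using 6 dpoly_memD(1)[OF s] by (rule fibre_act[OF A B f])
      then show ?case
        using fold_graph_unique[OF Q[OF t, unfolded dpoly_memD(6)[OF s 6]] fold_graph_act[OF Q[OF 6(1)] 6(2)]] 6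
        by simp
    qed
    then have "fold_graph n (\<alpha> n (a, s)) (\<beta> n (a, ?s))"
      by (rule fold_graph.intros[OF s]) (simp add: Q)
    then show "\<alpha> n (a, s) \<in> S n" by (auto simp: S_def)
  qed
  then show "x \<in> simplices X n \<Longrightarrow> \<exists>y. fold_graph n x y" by (auto simp: S_def)
qed

lemma fold_exists: "\<exists>k. dpoly_algebra_map A B h f g (X, p) \<alpha> (Y, q) \<beta> k"
proof -
  define k where "k n x = (THE y. fold_graph n x y)" for n x
  have k: "fold_graph n x (k n x)" if "x \<in> simplices X n" for n x
    using fold_graph_total[OF that] fold_graph_unique unfolding k_def by (blast intro: theI)
  have k_eq: "k n x = y" if "fold_graph n x y" for n x y
    using k[OF fold_graph_in(1)[OF that]] that by (rule fold_graph_unique)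
  have ko: "over_map (X, p) (Y, q) k"
    unfolding over_map.simps is_smap_def smap_eq_def
  proof (intro conjI allI ballI)
    fix n x assume x: "x \<in> simplices X n"
    show "k n x \<in> simplices Y n" by (rule fold_graph_in(2)[OF k[OF x]])
    show "q n (k n x) = p n x" by (rule fold_graph_in(3)[OF k[OF x], symmetric])
  next
    fix m n \<theta> x assume "\<theta> \<in> \<Delta> m n" "x \<in> simplices X n"
    then show "k m (act X m n \<theta> x) = act Y m n \<theta> (k n x)"
      by (intro k_eq fold_graph_act k)
  qed
  moreover have "k n (\<alpha> n t) = \<beta> n (dpoly_map A B f k n t)"
    if "t \<in> simplices (total_space (dpoly A B h f g (X, p))) n" for n t
  proof (cases t)
    case (Pair a s)
    have s: "(a, s) \<in> simplices (total_space (dpoly A B h f g (X, p))) n" using that by (simp only: Pair)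
    show ?thesis
      unfolding Pair dpoly_map_apply
      by (rule k_eq, rule fold_graph.intros[OF s dpoly_map_in[OF ko s, unfolded dpoly_map_apply]])
        (simp add: k dpoly_memD(4)[OF s])
  qed
  ultimately show ?thesis by (auto simp: dpoly_algebra_map_def smap_eq_def)
qed

lemma fold_unique:
  assumes k: "dpoly_algebra_map A B h f g (X, p) \<alpha> (Y, q) \<beta> k"
    and k': "dpoly_algebra_map A B h f g (X, p) \<alpha> (Y, q) \<beta> k'"
  shows "smap_eq X k k'"
proof -
  have km: "is_smap X Y k" "is_smap X Y k'" using k k' by (auto simp: dpoly_algebra_map_def)
  define S where "S n = {x \<in> simplices X n. k n x = k' n x}" for n
  have "S n = simplices X n" for n
  proof (rule initial_minimal)
    show "S n \<subseteq> simplices X n" for n by (auto simp: S_def)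
    show "act X m n \<theta> x \<in> S m" if "\<theta> \<in> \<Delta> m n" "x \<in> S n" for m n \<theta> x
      using that smap_act[OF km(1)] smap_act[OF km(2)] act_in[OF Xs] by (simp add: S_def)
    fix n a s
    assume s: "(a, s) \<in> simplices (total_space (dpoly A B h f g (X, p))) n"
      and "\<And>m \<theta> b. (m, \<theta>, b) \<in> fibre A B f n a \<Longrightarrow> snd (s (m, \<theta>, b)) \<in> S m"
    then have "dpoly_map A B f k n (a, s) = dpoly_map A B f k' n (a, s)"
      unfolding dpoly_map_apply
      by (intro arg_cong[where f = "Pair _"] restrict_ext) (auto simp: S_def)
    then show "\<alpha> n (a, s) \<in> S n"
      using s k k' smap_in[OF over_mapD(1)[OF \<alpha>_over] s]
      by (simp add: S_def dpoly_algebra_map_def smap_eq_def)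
  qed
  then show ?thesis by (auto simp: S_def smap_eq_def)
qed

end

end

theorem initial_algebra_all_types:
  assumes "initial_dpoly_algebra A B C h f g X \<alpha>"
  shows "initial_among TYPE('y) A B C h f g X \<alpha>"
proof -
  obtain X' p where [simp]: "X = (X', p)" by (cases X)
  show ?thesis
    unfolding initial_among_def
    using fold_exists[of X' p \<alpha>] fold_unique[of X' p \<alpha>] assms by auto
qed

end

end

theory Submission
  imports Defs
begin

text \<open>
  Write \<open>\<Phi> S\<close> for the image under \<open>\<alpha>\<close> of the value of the functor at a subobject \<open>S\<close> of the initial
  algebra.  Among the subobjects \<open>S \<subseteq> \<Phi> S\<close> that are fibrant over \<open>C\<close> there is a maximal one by Zorn's
  lemma, because a horn in the union of a chain lies in a member of the chain.  As the functor
  preserves fibrations, a maximal \<open>S\<close> satisfies \<open>\<Phi> S = S\<close>, so it is a subalgebra and hence everything.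

  The functor preserves fibrations because the pullback of a horn inclusion along a Kan fibration
  lifts against Kan fibrations.  Indeed the simplex can be deformed into the horn, keeping the horn in
  itself; the deformation lifts along the first fibration, and the lifting problem is then solved by
  transporting it along the lifted homotopy.  Homotopy lifting itself comes from adding the cells of
  a cylinder one prism simplex at a time.
\<close>

section \<open>Lifting against sub-simplicial sets\<close>

text \<open>The functor takes sections over whole fibres of \<open>f\<close>, which may have
  infinitely many cells. So \<open>\<Phi>\<close> need not commute with unions of chains, and
  iterating it countably often from the empty subobject need not reach a fixed point; maximality
  replaces an ordinal iteration. The condition that \<open>S\<close> lies in \<open>\<Phi> S\<close>
  does two jobs: it passes to unions by monotonicity of \<open>\<Phi>\<close> alone, and it puts
  \<open>\<Phi> S\<close> above \<open>S\<close>, so that a maximal \<open>S\<close> is fixed. That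
  \<open>\<Phi> S\<close> is fibrant rests on injectivity of \<open>\<alpha>\<close>, the half of
  Lambek's lemma that makes \<open>\<Phi> S\<close> an isomorphic copy of the value of the functor
  at \<open>S\<close>. The possibly infinite fibres are also the reason why homotopy lifting is
  proved for an arbitrary simplicial set \<open>V\<close> and needs a second use of Zorn's lemma,
  over partial lifts.\<close>

lemma \<Delta>I:
  assumes "\<And>i. i \<le> m \<Longrightarrow> \<theta> i \<le> n" "\<And>i j. i \<le> j \<Longrightarrow> j \<le> m \<Longrightarrow> \<theta> i \<le> \<theta> j"
    and "\<theta> \<in> extensional {..m}"
  shows "\<theta> \<in> \<Delta> m n"
  using assms by (auto simp: \<Delta>_def mono_on_def PiE_def)

lemma \<Delta>D:
  assumes "\<theta> \<in> \<Delta> m n"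
  shows "i \<le> m \<Longrightarrow> \<theta> i \<le> n" "i \<le> j \<Longrightarrow> j \<le> m \<Longrightarrow> \<theta> i \<le> \<theta> j" "\<theta> \<in> extensional {..m}"
  using assms by (auto simp: \<Delta>_def mono_on_def PiE_def)

lemma \<Delta>_eqI:
  assumes "\<theta> \<in> \<Delta> m n" "\<theta>' \<in> \<Delta> m n'" "\<And>i. i \<le> m \<Longrightarrow> \<theta> i = \<theta>' i"
  shows "\<theta> = \<theta>'"
  using \<Delta>D(3)[OF assms(1)] \<Delta>D(3)[OF assms(2)] assms(3) by (auto intro: extensionalityI)

lemma is_smapI:
  assumes "\<And>n x. x \<in> simplices X n \<Longrightarrow> k n x \<in> simplices Y n"
    and "\<And>m n \<theta> x. \<theta> \<in> \<Delta> m n \<Longrightarrow> x \<in> simplices X n \<Longrightarrow> k m (act X m n \<theta> x) = act Y m n \<theta> (k n x)"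
  shows "is_smap X Y k"
  using assms by (simp add: is_smap_def)

lemma is_ssetI:
  assumes "\<And>m n \<theta> x. \<theta> \<in> \<Delta> m n \<Longrightarrow> x \<in> simplices X n \<Longrightarrow> act X m n \<theta> x \<in> simplices X m"
    and "\<And>n x. x \<in> simplices X n \<Longrightarrow> act X n n (\<Delta>_id n) x = x"
    and "\<And>l m n \<psi> \<theta> x. \<psi> \<in> \<Delta> l m \<Longrightarrow> \<theta> \<in> \<Delta> m n \<Longrightarrow> x \<in> simplices X n \<Longrightarrow>
      act X l n (compose {..l} \<theta> \<psi>) x = act X l m \<psi> (act X m n \<theta> x)"
  shows "is_sset X"
  using assms by (simp add: is_sset_def)

section \<open>Simplicial subsets of an ambient simplicial set, and lifting between them\<close>

definition closed_in :: "'a sset \<Rightarrow> (nat \<Rightarrow> 'a set) \<Rightarrow> bool" where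
  "closed_in X S \<longleftrightarrow> (\<forall>n. S n \<subseteq> simplices X n) \<and>
     (\<forall>m n. \<forall>\<theta>\<in>\<Delta> m n. \<forall>x\<in>S n. act X m n \<theta> x \<in> S m)"

text \<open>A subobject keeps the action of the ambient object. Since simplicial maps need not be
  extensional, one function then serves as a map on every smaller domain, and restriction leaves it
  unchanged.\<close>

definition subsset :: "'a sset \<Rightarrow> (nat \<Rightarrow> 'a set) \<Rightarrow> 'a sset" where
  "subsset X S = \<lparr>simplices = S, act = act X\<rparr>"

lemma subsset_simps [simp]: "simplices (subsset X S) = S" "act (subsset X S) = act X"
  by (simp_all add: subsset_def)

lemma subsset_simplices [simp]: "subsset X (simplices X) = X"
  by (simp add: subsset_def)

lemma closed_inD:
  assumes "closed_in X S"
  shows "x \<in> S n \<Longrightarrow> x \<in> simplices X n" "\<theta> \<in> \<Delta> m n \<Longrightarrow> x \<in> S n \<Longrightarrow> act X m n \<theta> x \<in> S m"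
  using assms by (auto simp: closed_in_def)

lemma closed_inI:
  assumes "\<And>n x. x \<in> S n \<Longrightarrow> x \<in> simplices X n"
    and "\<And>m n \<theta> x. \<theta> \<in> \<Delta> m n \<Longrightarrow> x \<in> S n \<Longrightarrow> act X m n \<theta> x \<in> S m"
  shows "closed_in X S"
  using assms by (auto simp: closed_in_def)

lemma is_sset_subsset: "is_sset X \<Longrightarrow> closed_in X S \<Longrightarrow> is_sset (subsset X S)"
  unfolding is_sset_def closed_in_def by (auto simp: subset_iff)

lemma horn_iff: "\<theta> \<in> simplices (horn n k) m \<longleftrightarrow> \<theta> \<in> \<Delta> m n \<and> (\<exists>j\<le>n. j \<noteq> k \<and> j \<notin> \<theta> ` {..m})"
  by (auto simp: horn_def)

lemma std_simplex_simps [simp]: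
  "simplices (std_simplex n) m = \<Delta> m n"
  "act (std_simplex n) l m \<psi> \<theta> = compose {..l} \<theta> \<psi>"
  "act (horn n k) l m \<psi> \<theta> = compose {..l} \<theta> \<psi>"
  by (simp_all add: std_simplex_def horn_def)

lemma horn_compose:
  assumes "\<theta> \<in> simplices (horn n k) m" "\<psi> \<in> \<Delta> l m"
  shows "compose {..l} \<theta> \<psi> \<in> simplices (horn n k) l"
proof -
  obtain j where j: "j \<le> n" "j \<noteq> k" "j \<notin> \<theta> ` {..m}" and \<theta>: "\<theta> \<in> \<Delta> m n"
    using assms(1) by (auto simp: horn_iff)
  have "j \<notin> compose {..l} \<theta> \<psi> ` {..l}"
    using j(3) \<Delta>D(1)[OF assms(2)] by (auto simp: compose_def)
  with j show ?thesis using compose_\<Delta>[OF \<theta> assms(2)] by (auto simp: horn_iff)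
qed

definition lifting :: "'e sset \<Rightarrow> 'b sset \<Rightarrow> ('e, 'b) smap \<Rightarrow> 'v sset
    \<Rightarrow> (nat \<Rightarrow> 'v set) \<Rightarrow> (nat \<Rightarrow> 'v set) \<Rightarrow> bool" where
  "lifting E B p V U U' \<longleftrightarrow>
     (\<forall>u v. is_smap (subsset V U) E u \<and> is_smap (subsset V U') B v \<and>
        smap_eq (subsset V U) (\<lambda>m x. p m (u m x)) v \<longrightarrow>
        (\<exists>w. is_smap (subsset V U') E w \<and> smap_eq (subsset V U) w u \<and>
             smap_eq (subsset V U') (\<lambda>m x. p m (w m x)) v))"

lemma kan_fibrationD:
  assumes "kan_fibration X Y p"
  shows "is_sset X" "is_sset Y" "is_smap X Y p"
    and "1 \<le> n \<Longrightarrow> k \<le> n \<Longrightarrow> lifting X Y p (std_simplex n) (simplices (horn n k)) (simplices (std_simplex n))"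
proof -
  have "subsset (std_simplex n) (simplices (horn n k)) = horn n k"
    by (simp add: horn_def subsset_def)
  then show "1 \<le> n \<Longrightarrow> k \<le> n \<Longrightarrow> lifting X Y p (std_simplex n) (simplices (horn n k)) (simplices (std_simplex n))"
    using assms by (simp add: lifting_def kan_fibration_def)
qed (use assms in \<open>auto simp: kan_fibration_def\<close>)

lemma liftingE:
  assumes "lifting E B p V U U'"
    and "is_smap (subsset V U) E u" "is_smap (subsset V U') B v"
    and "\<And>n x. x \<in> U n \<Longrightarrow> p n (u n x) = v n x"
  obtains w where "is_smap (subsset V U') E w" "\<And>n x. x \<in> U n \<Longrightarrow> w n x = u n x"
    "\<And>n x. x \<in> U' n \<Longrightarrow> p n (w n x) = v n x"
  using assms unfolding lifting_def by (simp add: smap_eq_def) metis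

lemma liftingI:
  assumes "\<And>u v. is_smap (subsset V U) E u \<Longrightarrow> is_smap (subsset V U') B v \<Longrightarrow>
      (\<And>n x. x \<in> U n \<Longrightarrow> p n (u n x) = v n x) \<Longrightarrow>
      \<exists>w. is_smap (subsset V U') E w \<and> (\<forall>n. \<forall>x\<in>U n. w n x = u n x) \<and>
        (\<forall>n. \<forall>x\<in>U' n. p n (w n x) = v n x)"
  shows "lifting E B p V U U'"
  unfolding lifting_def by (auto simp: smap_eq_def intro!: assms)

lemma is_smap_subset:
  assumes "is_smap (subsset V U') E u" "\<And>n. U n \<subseteq> U' n"
  shows "is_smap (subsset V U) E u"
  by (rule is_smapI) (use smap_in[OF assms(1)] smap_act[OF assms(1)] assms(2) in \<open>auto simp: subset_iff\<close>)

lemma lifting_refl: "lifting E B p V U U"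
  by (rule liftingI) auto

lemma lifting_trans:
  assumes 1: "lifting E B p V U U'" and 2: "lifting E B p V U' U''"
    and sub: "\<And>n. U n \<subseteq> U' n" "\<And>n. U' n \<subseteq> U'' n"
  shows "lifting E B p V U U''"
proof (rule liftingI)
  fix u v
  assume u: "is_smap (subsset V U) E u" and v: "is_smap (subsset V U'') B v"
    and uv: "\<And>n x. x \<in> U n \<Longrightarrow> p n (u n x) = v n x"
  obtain w where w: "is_smap (subsset V U') E w" "\<And>n x. x \<in> U n \<Longrightarrow> w n x = u n x"
    "\<And>n x. x \<in> U' n \<Longrightarrow> p n (w n x) = v n x"
    using liftingE[OF 1 u is_smap_subset[OF v sub(2)] uv] by blast
  obtain w' where w': "is_smap (subsset V U'') E w'" "\<And>n x. x \<in> U' n \<Longrightarrow> w' n x = w n x"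
    "\<And>n x. x \<in> U'' n \<Longrightarrow> p n (w' n x) = v n x"
    using liftingE[OF 2 w(1) v w(3)] by blast
  show "\<exists>w. is_smap (subsset V U'') E w \<and> (\<forall>n. \<forall>x\<in>U n. w n x = u n x) \<and>
        (\<forall>n. \<forall>x\<in>U'' n. p n (w n x) = v n x)"
    using w'(1,3) w(2) w'(2) sub(1) by (intro exI[of _ w']) (auto simp: subset_iff)
qed

text \<open>Hypotheses \<open>horn\<close> and \<open>inj\<close> say that adjoining
  \<open>z\<close> to \<open>W\<close> is a pushout of a horn inclusion: \<open>z\<close> meets
  \<open>W\<close> in exactly the horn, and outside the horn no two simplices of the standard
  simplex are identified. A filler for the horn therefore glues with \<open>u\<close>.\<close>

lemma lifting_cell:
  assumes kan: "kan_fibration E B p" and N: "1 \<le> N" "k \<le> N"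
    and V: "is_sset V" and z: "z \<in> simplices V N" and W: "closed_in V W"
    and horn: "\<And>m \<phi>. \<phi> \<in> \<Delta> m N \<Longrightarrow> act V m N \<phi> z \<in> W m \<longleftrightarrow> \<phi> \<in> simplices (horn N k) m"
    and inj: "\<And>m \<phi> \<phi>'. \<phi> \<in> \<Delta> m N \<Longrightarrow> \<phi>' \<in> \<Delta> m N \<Longrightarrow> \<phi> \<notin> simplices (horn N k) m \<Longrightarrow>
      \<phi>' \<notin> simplices (horn N k) m \<Longrightarrow> act V m N \<phi> z = act V m N \<phi>' z \<Longrightarrow> \<phi> = \<phi>'"
  shows "lifting E B p V W (\<lambda>m. W m \<union> (\<lambda>\<phi>. act V m N \<phi> z) ` \<Delta> m N)"
proof (rule liftingI)
  let ?W = "\<lambda>m. W m \<union> (\<lambda>\<phi>. act V m N \<phi> z) ` \<Delta> m N"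
  fix u v
  assume u: "is_smap (subsset V W) E u" and v: "is_smap (subsset V ?W) B v"
    and uv: "\<And>n x. x \<in> W n \<Longrightarrow> p n (u n x) = v n x"
  have zact: "act V l N (compose {..l} \<phi> \<psi>) z = act V l m \<psi> (act V m N \<phi> z)"
    if "\<phi> \<in> \<Delta> m N" "\<psi> \<in> \<Delta> l m" for l m \<phi> \<psi>
    using act_comp[OF V that(2,1) z] .
  have hornW: "act V m N \<phi> z \<in> W m" if "\<phi> \<in> simplices (horn N k) m" for m \<phi>
    using that horn by (auto simp: horn_iff)
  have h: "\<phi> \<in> \<Delta> m N" if "\<phi> \<in> simplices (horn N k) m" for m \<phi>
    using that by (simp add: horn_iff)
  obtain w where w: "is_smap (std_simplex N) E w"
    and wu: "\<And>n \<phi>. \<phi> \<in> simplices (horn N k) n \<Longrightarrow> w n \<phi> = u n (act V n N \<phi> z)"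
    and wv: "\<And>n \<phi>. \<phi> \<in> \<Delta> n N \<Longrightarrow> p n (w n \<phi>) = v n (act V n N \<phi> z)"
  proof (rule liftingE[OF kan_fibrationD(4)[OF kan N], of "\<lambda>m \<phi>. u m (act V m N \<phi> z)" "\<lambda>m \<phi>. v m (act V m N \<phi> z)"])
    show "is_smap (subsset (std_simplex N) (simplices (horn N k))) E (\<lambda>m \<phi>. u m (act V m N \<phi> z))"
      by (rule is_smapI) (use smap_in[OF u] smap_act[OF u] hornW zact[OF h] in auto)
    show "is_smap (subsset (std_simplex N) (simplices (std_simplex N))) B (\<lambda>m \<phi>. v m (act V m N \<phi> z))"
      by (rule is_smapI) (use smap_in[OF v] smap_act[OF v] zact in auto)
  qed (use uv hornW in auto)
  \<comment> \<open>Outside \<open>W\<close> the preimage of \<open>y\<close> under the cell is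
    unique by \<open>inj\<close>, so \<open>THE\<close> inverts the cell there.\<close>
  define K where "K n y = (if y \<in> W n then u n y else
      w n (THE \<phi>. \<phi> \<in> \<Delta> n N \<and> \<phi> \<notin> simplices (horn N k) n \<and> act V n N \<phi> z = y))" for n y
  have KW: "K n y = u n y" if "y \<in> W n" for n y using that by (simp add: K_def)
  have Kz: "K n (act V n N \<phi> z) = w n \<phi>" if \<phi>: "\<phi> \<in> \<Delta> n N" for n \<phi>
  proof (cases "\<phi> \<in> simplices (horn N k) n")
    case True then show ?thesis by (simp add: KW hornW wu)
  next
    case False
    have "(THE \<phi>'. \<phi>' \<in> \<Delta> n N \<and> \<phi>' \<notin> simplices (horn N k) n \<and> act V n N \<phi>' z = act V n N \<phi> z) = \<phi>"
      by (rule the_equality) (use False \<phi> inj in auto)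
    then show ?thesis using False horn[OF \<phi>] by (simp add: K_def)
  qed
  have "is_smap (subsset V ?W) E K"
  proof (rule is_smapI)
    fix n y assume "y \<in> simplices (subsset V ?W) n"
    then show "K n y \<in> simplices E n"
      using smap_in[OF u] smap_in[OF w] by (auto simp: KW Kz)
  next
    fix m n \<theta> y assume \<theta>: "\<theta> \<in> \<Delta> m n" and "y \<in> simplices (subsset V ?W) n"
    then show "K m (act (subsset V ?W) m n \<theta> y) = act E m n \<theta> (K n y)"
      using smap_act[OF u \<theta>] smap_act[OF w \<theta>] closed_inD(2)[OF W \<theta>]
      by (auto simp: KW Kz compose_\<Delta> simp flip: zact)
  qed
  moreover have "p n (K n y) = v n y" if "y \<in> ?W n" for n y
    using that by (auto simp: KW Kz uv wv)
  ultimately show "\<exists>w. is_smap (subsset V ?W) E w \<and> (\<forall>n. \<forall>x\<in>W n. w n x = u n x) \<and>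
        (\<forall>n. \<forall>x\<in>?W n. p n (w n x) = v n x)"
    using KW by blast
qed

section \<open>Homotopy lifting\<close>

definition cylinder :: "'v sset \<Rightarrow> ('v \<times> (nat \<Rightarrow> nat)) sset" where
  "cylinder V = \<lparr>simplices = (\<lambda>n. simplices V n \<times> \<Delta> n 1),
     act = (\<lambda>m n \<theta> (x, \<tau>). (act V m n \<theta> x, compose {..m} \<tau> \<theta>))\<rparr>"

definition const_path :: "nat \<Rightarrow> nat \<Rightarrow> nat \<Rightarrow> nat" where
  "const_path \<epsilon> n = (\<lambda>i\<in>{..n}. \<epsilon>)"

text \<open>The union of \<open>U \<times> \<Delta>[1]\<close> and
  \<open>V \<times> {\<epsilon>}\<close>; its inclusion into the cylinder is the pushout-product of
  \<open>U \<subseteq> V\<close> with an endpoint of the interval. For empty \<open>U\<close> it is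
  one end of the cylinder.\<close>

definition cyl_part :: "'v sset \<Rightarrow> (nat \<Rightarrow> 'v set) \<Rightarrow> nat \<Rightarrow> nat \<Rightarrow> ('v \<times> (nat \<Rightarrow> nat)) set" where
  "cyl_part V U \<epsilon> n = {(x, \<tau>). x \<in> simplices V n \<and> \<tau> \<in> \<Delta> n 1 \<and> (x \<in> U n \<or> \<tau> = const_path \<epsilon> n)}"

lemma cylinder_simps [simp]:
  "simplices (cylinder V) n = simplices V n \<times> \<Delta> n 1"
  "act (cylinder V) m n \<theta> (x, \<tau>) = (act V m n \<theta> x, compose {..m} \<tau> \<theta>)"
  by (simp_all add: cylinder_def)

lemma is_sset_cylinder: "is_sset V \<Longrightarrow> is_sset (cylinder V)"
  by (rule is_ssetI) (auto simp: is_ssetD compose_\<Delta> compose_\<Delta>_id_right compose_\<Delta>_assoc)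

lemma const_path_in: "\<epsilon> \<le> 1 \<Longrightarrow> const_path \<epsilon> n \<in> \<Delta> n 1"
  by (rule \<Delta>I) (auto simp: const_path_def)

lemma const_path_compose: "\<theta> \<in> \<Delta> m n \<Longrightarrow> compose {..m} (const_path \<epsilon> n) \<theta> = const_path \<epsilon> m"
  using \<Delta>D(1)[of \<theta> m n] by (auto simp: const_path_def compose_def)

lemma closed_cyl_part:
  assumes V: "is_sset V" and U: "closed_in V U"
  shows "closed_in (cylinder V) (cyl_part V U \<epsilon>)"
proof (rule closed_inI)
  fix m n \<theta> y assume \<theta>: "\<theta> \<in> \<Delta> m n" and y: "y \<in> cyl_part V U \<epsilon> n"
  then obtain x \<tau> where "y = (x, \<tau>)" "x \<in> simplices V n" "\<tau> \<in> \<Delta> n 1" "x \<in> U n \<or> \<tau> = const_path \<epsilon> n"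
    by (auto simp: cyl_part_def)
  then show "act (cylinder V) m n \<theta> y \<in> cyl_part V U \<epsilon> m"
    using act_in[OF V \<theta>] closed_inD(2)[OF U \<theta>] compose_\<Delta>[of \<tau> n 1 \<theta> m, OF _ \<theta>] const_path_compose[OF \<theta>]
    by (auto simp: cyl_part_def)
qed (auto simp: cyl_part_def)

section \<open>Surjections of ordinals and degenerate simplices\<close>

text \<open>A surjection between finite sets of equal size is injective, so \<open>\<theta>\<close>
  is strictly increasing. Climbing from 0 gives \<open>i \<le> \<theta> i\<close>, descending from
  \<open>m\<close> gives the converse.\<close>

lemma \<Delta>_surj_endo:
  assumes "\<theta> \<in> \<Delta> m m" "\<theta> ` {..m} = {..m}"
  shows "\<theta> = \<Delta>_id m"
proof (rule \<Delta>_eqI[OF assms(1) \<Delta>_id_in])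
  have inj: "inj_on \<theta> {..m}" using assms(2) by (intro eq_card_imp_inj_on) auto
  have less: "\<theta> i < \<theta> j" if "i < j" "j \<le> m" for i j
    using that \<Delta>D(2)[OF assms(1), of i j] inj_onD[OF inj, of i j] by fastforce
  have ge: "i \<le> \<theta> i" if "i \<le> m" for i
    using that by (induction i) (use less in \<open>auto dest!: Suc_leD simp: Suc_le_eq less_le_trans intro: le_less_trans\<close>)
  have le: "\<theta> (m - d) \<le> m - d" if "d \<le> m" for d
    using that
  proof (induction d)
    case 0 then show ?case using \<Delta>D(1)[OF assms(1), of m] by simp
  next
    case (Suc d)
    have "\<theta> (m - Suc d) < \<theta> (m - d)" by (rule less) (use Suc.prems in auto)
    with Suc show ?case by linarith
  qed
  fix i assume i: "i \<le> m"
  then show "\<theta> i = \<Delta>_id m i" using ge[OF i] le[of "m - i"] by (simp add: \<Delta>_id_def)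
qed

text \<open>Any choice of preimages under a monotone surjection is itself monotone. The choice at
  \<open>\<theta> i\<close> is free, and a section through a prescribed \<open>i\<close> is what
  tells two surjections apart in \<open>degeneracy_inj\<close>.\<close>

lemma \<Delta>_section:
  assumes \<theta>: "\<theta> \<in> \<Delta> l m" and surj: "\<theta> ` {..l} = {..m}" and i: "i \<le> l"
  obtains \<delta> where "\<delta> \<in> \<Delta> m l" "\<delta> (\<theta> i) = i" "compose {..m} \<theta> \<delta> = \<Delta>_id m"
proof -
  have "\<exists>t\<le>l. \<theta> t = j \<and> (j = \<theta> i \<longrightarrow> t = i)" if "j \<le> m" for j
    using surj i that by (metis atMost_iff imageE)
  then obtain s where s: "\<And>j. j \<le> m \<Longrightarrow> s j \<le> l \<and> \<theta> (s j) = j \<and> (j = \<theta> i \<longrightarrow> s j = i)" by metis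
  have "s a \<le> s b" if "a \<le> b" "b \<le> m" for a b
    using s[of a] s[of b] that \<Delta>D(2)[OF \<theta>, of "s b" "s a"] by (cases "a = b") force+
  then have "restrict s {..m} \<in> \<Delta> m l" using s by (intro \<Delta>I) auto
  moreover have "restrict s {..m} (\<theta> i) = i" using s[of "\<theta> i"] \<Delta>D(1)[OF \<theta> i] by simp
  moreover have "compose {..m} \<theta> (restrict s {..m}) = \<Delta>_id m"
    using s by (auto simp: compose_def \<Delta>_id_def)
  ultimately show thesis by (rule that)
qed

text \<open>
  The uniqueness half of the Eilenberg--Zilber lemma, relative to a subobject.
\<close>

lemma degeneracy_inj:
  assumes V: "is_sset V" and x: "x \<in> simplices V m" "x \<notin> U m"
    and faces: "\<And>l \<theta>. \<theta> \<in> \<Delta> l m \<Longrightarrow> \<theta> ` {..l} \<noteq> {..m} \<Longrightarrow> act V l m \<theta> x \<in> U l"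
    and \<theta>: "\<theta> \<in> \<Delta> l m" "\<theta> ` {..l} = {..m}" and \<theta>': "\<theta>' \<in> \<Delta> l m"
    and eq: "act V l m \<theta> x = act V l m \<theta>' x"
  shows "\<theta> = \<theta>'"
proof (rule \<Delta>_eqI[OF \<theta>(1) \<theta>'])
  fix i assume i: "i \<le> l"
  obtain \<delta> where \<delta>: "\<delta> \<in> \<Delta> m l" "\<delta> (\<theta> i) = i" "compose {..m} \<theta> \<delta> = \<Delta>_id m"
    using \<Delta>_section[OF \<theta> i] .
  have "act V m m (compose {..m} \<theta>' \<delta>) x = x"
    using act_comp[OF V \<delta>(1) \<theta>(1) x(1)] act_comp[OF V \<delta>(1) \<theta>' x(1)] act_id[OF V x(1)]
    by (simp add: eq \<delta>(3))
  \<comment> \<open>If this composite missed a vertex, \<open>faces\<close> would put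
    \<open>x\<close> itself into \<open>U\<close>.\<close>
  then have "compose {..m} \<theta>' \<delta> = \<Delta>_id m"
    using faces[OF compose_\<Delta>[OF \<theta>' \<delta>(1)]] x(2) \<Delta>_surj_endo[OF compose_\<Delta>[OF \<theta>' \<delta>(1)]] by metis
  from fun_cong[OF this, of "\<theta> i"] show "\<theta> i = \<theta>' i"
    using \<Delta>D(1)[OF \<theta>(1) i] \<delta>(2) by (simp add: compose_def \<Delta>_id_def)
qed

text \<open>A section of \<open>\<theta>\<close> restricts the degenerate simplex back to
  \<open>x\<close>, so \<open>U\<close> cannot contain the one without the other.\<close>

lemma act_in_surj:
  assumes V: "is_sset V" and U: "closed_in V U" and x: "x \<in> simplices V m" "x \<notin> U m"
    and \<theta>: "\<theta> \<in> \<Delta> l m" "\<theta> ` {..l} = {..m}"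
  shows "act V l m \<theta> x \<notin> U l"
proof
  assume *: "act V l m \<theta> x \<in> U l"
  obtain \<delta> where \<delta>: "\<delta> \<in> \<Delta> m l" "compose {..m} \<theta> \<delta> = \<Delta>_id m"
    using \<Delta>_section[OF \<theta>, of 0] by auto
  show False
    using closed_inD(2)[OF U \<delta>(1) *] act_comp[OF V \<delta>(1) \<theta>(1) x(1)] act_id[OF V x(1)] x(2)
    by (simp add: \<delta>(2))
qed

text \<open>
  The simplex \<open>(\<theta>, \<tau>)\<close> of \<open>\<Delta>[m] \<times> \<Delta>[1]\<close> lies on the \<open>j\<close>-th simplex of the prism, the one
  with vertices \<open>(0,0), \<dots>, (j,0), (j,1), \<dots>, (m,1)\<close>.
\<close>

definition on_prism_simplex :: "nat \<Rightarrow> (nat \<Rightarrow> nat) \<Rightarrow> (nat \<Rightarrow> nat) \<Rightarrow> nat \<Rightarrow> bool" where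
  "on_prism_simplex l \<theta> \<tau> j \<longleftrightarrow> (\<forall>t\<le>l. (\<tau> t = 0 \<longrightarrow> \<theta> t \<le> j) \<and> (\<tau> t = 1 \<longrightarrow> j \<le> \<theta> t))"

text \<open>The stages between \<open>cyl_part\<close> of \<open>U\<close> and
  \<open>cyl_part\<close> of \<open>U\<close> with \<open>x\<close> adjoined; \<open>J\<close> lists
  the prism simplices over \<open>x\<close> that are already present.\<close>

definition prism_part :: "'v sset \<Rightarrow> (nat \<Rightarrow> 'v set) \<Rightarrow> nat \<Rightarrow> nat \<Rightarrow> 'v \<Rightarrow> nat set
    \<Rightarrow> nat \<Rightarrow> ('v \<times> (nat \<Rightarrow> nat)) set" where
  "prism_part V U \<epsilon> m x J l = cyl_part V U \<epsilon> l \<union>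
     {(act V l m \<theta> x, \<tau>) | \<theta> \<tau>. \<theta> \<in> \<Delta> l m \<and> \<tau> \<in> \<Delta> l 1 \<and> (\<exists>j\<in>J. on_prism_simplex l \<theta> \<tau> j)}"

text \<open>The situation of one cell \<open>x\<close> attached to \<open>U\<close> along its whole
  boundary: \<open>x\<close> is new, while its restrictions along non-surjective maps are in
  \<open>U\<close>.\<close>

context
  fixes V :: "'v sset" and U :: "nat \<Rightarrow> 'v set" and m :: nat and x :: 'v and \<epsilon> :: nat
  assumes V: "is_sset V" and U: "closed_in V U" and x: "x \<in> simplices V m" "x \<notin> U m"
    and faces: "\<And>l \<theta>. \<theta> \<in> \<Delta> l m \<Longrightarrow> \<theta> ` {..l} \<noteq> {..m} \<Longrightarrow> act V l m \<theta> x \<in> U l"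
    and \<epsilon>: "\<epsilon> \<le> 1"
begin

lemma closed_prism_part: "closed_in (cylinder V) (prism_part V U \<epsilon> m x J)"
proof (rule closed_inI)
  fix l y assume "y \<in> prism_part V U \<epsilon> m x J l"
  then show "y \<in> simplices (cylinder V) l"
    by (auto simp: prism_part_def cyl_part_def act_in[OF V _ x(1)])
next
  fix l' l \<psi> y assume \<psi>: "\<psi> \<in> \<Delta> l' l" and y: "y \<in> prism_part V U \<epsilon> m x J l"
  then consider "y \<in> cyl_part V U \<epsilon> l" | \<theta> \<tau> j where "y = (act V l m \<theta> x, \<tau>)" "\<theta> \<in> \<Delta> l m" "\<tau> \<in> \<Delta> l 1"
    "j \<in> J" "on_prism_simplex l \<theta> \<tau> j"
    by (auto simp: prism_part_def)
  then show "act (cylinder V) l' l \<psi> y \<in> prism_part V U \<epsilon> m x J l'"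
  proof cases
    case 1 then show ?thesis
      using closed_inD(2)[OF closed_cyl_part[OF V U] \<psi>] by (simp add: prism_part_def)
  next
    case 2
    have "on_prism_simplex l' (compose {..l'} \<theta> \<psi>) (compose {..l'} \<tau> \<psi>) j"
      using 2(5) \<Delta>D(1)[OF \<psi>] by (auto simp: on_prism_simplex_def compose_def)
    then show ?thesis
      using 2(1-4) compose_\<Delta>[OF 2(2) \<psi>] compose_\<Delta>[OF 2(3) \<psi>] act_comp[OF V \<psi> 2(2) x(1)]
      by (auto simp: prism_part_def)
  qed
qed

text \<open>A face of the \<open>i\<close>-th prism simplex that omits a vertex other than
  \<open>i\<close> and \<open>i + 1\<close> lies over the boundary of \<open>x\<close>. The face
  omitting \<open>i\<close> is shared with prism simplex \<open>i - 1\<close>, or is in the end 1 if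
  \<open>i = 0\<close>; the face omitting \<open>i + 1\<close> is shared with prism simplex
  \<open>i + 1\<close>, or is in the end 0 if \<open>i = m\<close>. Working upwards from the end 1,
  or downwards from the end 0, exactly the face omitting \<open>i + \<epsilon>\<close> is absent, so
  the step fills a horn.\<close>

lemma lifting_prism_step:
  assumes kan: "kan_fibration E B p" and i: "i \<le> m"
    and J: "\<epsilon> = 1 \<and> J = {..<i} \<or> \<epsilon> = 0 \<and> J = {i<..m}"
  shows "lifting E B p (cylinder V) (prism_part V U \<epsilon> m x J) (prism_part V U \<epsilon> m x (insert i J))"
proof -
  define \<sigma> where "\<sigma> = (\<lambda>t\<in>{..Suc m}. if t \<le> i then t else t - 1)"
  define \<chi> where "\<chi> = (\<lambda>t\<in>{..Suc m}. if t \<le> i then 0 else 1 :: nat)"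
  define z where "z = (act V (Suc m) m \<sigma> x, \<chi>)"
  have \<sigma>: "\<sigma> \<in> \<Delta> (Suc m) m" and \<chi>: "\<chi> \<in> \<Delta> (Suc m) 1"
    using i by (auto simp: \<sigma>_def \<chi>_def intro!: \<Delta>I)
  have z: "z \<in> simplices (cylinder V) (Suc m)"
    using \<chi> act_in[OF V \<sigma> x(1)] by (simp add: z_def)
  have zact: "act (cylinder V) l (Suc m) \<phi> z = (act V l m (compose {..l} \<sigma> \<phi>) x, compose {..l} \<chi> \<phi>)"
    if "\<phi> \<in> \<Delta> l (Suc m)" for l \<phi>
    by (simp add: z_def act_comp[OF V that \<sigma> x(1)])
  have \<sigma>\<phi>: "compose {..l} \<sigma> \<phi> t = (if \<phi> t \<le> i then \<phi> t else \<phi> t - 1)"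
    and \<chi>\<phi>: "compose {..l} \<chi> \<phi> t = (if \<phi> t \<le> i then 0 else 1)"
    if "\<phi> \<in> \<Delta> l (Suc m)" "t \<le> l" for l \<phi> t
    using that \<Delta>D(1)[OF that] by (auto simp: compose_def \<sigma>_def \<chi>_def)
  let ?k = "i + \<epsilon>" and ?W = "prism_part V U \<epsilon> m x J"
  \<comment> \<open>Outside the horn, \<open>\<phi>\<close> hits every vertex except possibly
    \<open>i + \<epsilon>\<close>. As \<open>\<sigma>\<close> identifies the vertices
    \<open>i\<close> and \<open>i + 1\<close>, the composite is still onto, and the other vertex
    over \<open>i\<close> is certainly hit.\<close>
  have surj: "compose {..l} \<sigma> \<phi> ` {..l} = {..m}" "i + (1 - \<epsilon>) \<in> \<phi> ` {..l}"
    if \<phi>: "\<phi> \<in> \<Delta> l (Suc m)" "\<phi> \<notin> simplices (horn (Suc m) ?k) l" for l \<phi>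
  proof -
    have *: "\<exists>t\<le>l. j = \<phi> t" if "j \<le> Suc m" "j \<noteq> ?k" for j
      using \<phi> that by (auto simp: horn_iff)
    show "i + (1 - \<epsilon>) \<in> \<phi> ` {..l}" using *[of "i + (1 - \<epsilon>)"] i \<epsilon> by (cases \<epsilon>) auto
    then obtain t0 where t0: "t0 \<le> l" "i + (1 - \<epsilon>) = \<phi> t0" by auto
    have "j \<in> compose {..l} \<sigma> \<phi> ` {..l}" if "j \<le> m" for j
    proof -
      consider "j < i" | "j = i" | "j > i" by linarith
      then have "\<exists>t\<le>l. compose {..l} \<sigma> \<phi> t = j"
      proof cases
        case 1 with *[of j] that show ?thesis using \<sigma>\<phi>[OF \<phi>(1)] by auto
      next
        case 2 with t0 \<epsilon> show ?thesis using \<sigma>\<phi>[OF \<phi>(1) t0(1)] by (intro exI[of _ t0]) auto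
      next
        case 3 with *[of "Suc j"] that \<epsilon> show ?thesis using \<sigma>\<phi>[OF \<phi>(1)] by force
      qed
      then show ?thesis by force
    qed
    then show "compose {..l} \<sigma> \<phi> ` {..l} = {..m}"
      using \<Delta>D(1)[OF compose_\<Delta>[OF \<sigma> \<phi>(1)]] by blast
  qed
  have "lifting E B p (cylinder V) ?W (\<lambda>l. ?W l \<union> (\<lambda>\<phi>. act (cylinder V) l (Suc m) \<phi> z) ` \<Delta> l (Suc m))"
  proof (rule lifting_cell[OF kan _ _ is_sset_cylinder[OF V] z closed_prism_part, where k = ?k])
    fix l \<phi> assume \<phi>: "\<phi> \<in> \<Delta> l (Suc m)"
    note \<sigma>\<phi>_in = compose_\<Delta>[OF \<sigma> \<phi>] and \<chi>\<phi>_in = compose_\<Delta>[OF \<chi> \<phi>]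
    have in_V: "act V l m (compose {..l} \<sigma> \<phi>) x \<in> simplices V l" by (rule act_in[OF V \<sigma>\<phi>_in x(1)])
    show "act (cylinder V) l (Suc m) \<phi> z \<in> ?W l \<longleftrightarrow> \<phi> \<in> simplices (horn (Suc m) ?k) l"
    proof
      assume "\<phi> \<in> simplices (horn (Suc m) ?k) l"
      then obtain j where j: "j \<le> Suc m" "j \<noteq> ?k" and "j \<notin> \<phi> ` {..l}" by (auto simp: horn_iff)
      then have miss: "\<phi> t \<noteq> j" if "t \<le> l" for t using that by force
      consider "j \<noteq> i" "j \<noteq> Suc i" | "j = i" "\<epsilon> = 1" | "j = Suc i" "\<epsilon> = 0" using j(2) \<epsilon> by (cases \<epsilon>) auto
      then show "act (cylinder V) l (Suc m) \<phi> z \<in> ?W l"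
      proof cases
        case 1
        \<comment> \<open>\<open>j\<close> is the only vertex that \<open>\<sigma>\<close> sends to
          \<open>j'\<close>, so missing \<open>j\<close> upstairs means missing \<open>j'\<close> in
          the base.\<close>
        define j' where "j' = (if j < i then j else j - 1)"
        have "compose {..l} \<sigma> \<phi> t \<noteq> j'" if "t \<le> l" for t
          using miss[OF that] 1 by (auto simp: \<sigma>\<phi>[OF \<phi> that] j'_def)
        moreover have "j' \<le> m" using j i 1 by (auto simp: j'_def)
        ultimately have "compose {..l} \<sigma> \<phi> ` {..l} \<noteq> {..m}" by force
        then show ?thesis using faces[OF \<sigma>\<phi>_in] in_V \<chi>\<phi>_in
          by (simp add: zact[OF \<phi>] prism_part_def cyl_part_def)
      next
        case 2
        show ?thesis
        proof (cases i)
          case 0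
          have "compose {..l} \<chi> \<phi> = const_path \<epsilon> l"
            by (rule \<Delta>_eqI[OF \<chi>\<phi>_in const_path_in[OF \<epsilon>]])
              (use miss 2 0 in \<open>auto simp: \<chi>\<phi>[OF \<phi>] const_path_def\<close>)
          then show ?thesis using in_V \<chi>\<phi>_in by (simp add: zact[OF \<phi>] prism_part_def cyl_part_def)
        next
          case (Suc i')
          have "on_prism_simplex l (compose {..l} \<sigma> \<phi>) (compose {..l} \<chi> \<phi>) i'"
            unfolding on_prism_simplex_def
          proof (intro allI impI)
            fix t assume t: "t \<le> l"
            then show "(compose {..l} \<chi> \<phi> t = 0 \<longrightarrow> compose {..l} \<sigma> \<phi> t \<le> i') \<and>
              (compose {..l} \<chi> \<phi> t = 1 \<longrightarrow> i' \<le> compose {..l} \<sigma> \<phi> t)"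
              using miss[OF t] 2 Suc by (auto simp: \<sigma>\<phi>[OF \<phi> t] \<chi>\<phi>[OF \<phi> t])
          qed
          moreover have "i' \<in> J" using J 2 Suc by auto
          ultimately show ?thesis using \<sigma>\<phi>_in \<chi>\<phi>_in by (auto simp: zact[OF \<phi>] prism_part_def)
        qed
      next
        case 3
        show ?thesis
        proof (cases "i = m")
          case True
          have "compose {..l} \<chi> \<phi> = const_path \<epsilon> l"
          proof (rule \<Delta>_eqI[OF \<chi>\<phi>_in const_path_in[OF \<epsilon>]])
            fix t assume t: "t \<le> l"
            then show "compose {..l} \<chi> \<phi> t = const_path \<epsilon> l t"
              using miss[OF t] 3 True \<Delta>D(1)[OF \<phi> t] by (simp add: \<chi>\<phi>[OF \<phi> t] const_path_def)
          qed
          then show ?thesis using in_V \<chi>\<phi>_in by (simp add: zact[OF \<phi>] prism_part_def cyl_part_def)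
        next
          case False
          have "on_prism_simplex l (compose {..l} \<sigma> \<phi>) (compose {..l} \<chi> \<phi>) (Suc i)"
            unfolding on_prism_simplex_def
          proof (intro allI impI)
            fix t assume t: "t \<le> l"
            then show "(compose {..l} \<chi> \<phi> t = 0 \<longrightarrow> compose {..l} \<sigma> \<phi> t \<le> Suc i) \<and>
              (compose {..l} \<chi> \<phi> t = 1 \<longrightarrow> Suc i \<le> compose {..l} \<sigma> \<phi> t)"
              using miss[OF t] 3 by (auto simp: \<sigma>\<phi>[OF \<phi> t] \<chi>\<phi>[OF \<phi> t])
          qed
          moreover have "Suc i \<in> J" using J 3 False i by auto
          ultimately show ?thesis using \<sigma>\<phi>_in \<chi>\<phi>_in by (auto simp: zact[OF \<phi>] prism_part_def)
        qed
      qed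
    next
      assume in_W: "act (cylinder V) l (Suc m) \<phi> z \<in> ?W l"
      show "\<phi> \<in> simplices (horn (Suc m) ?k) l"
      proof (rule ccontr)
        assume \<phi>': "\<phi> \<notin> simplices (horn (Suc m) ?k) l"
        note s = surj[OF \<phi> \<phi>']
        have not_U: "act V l m (compose {..l} \<sigma> \<phi>) x \<notin> U l"
          by (rule act_in_surj[OF V U x \<sigma>\<phi>_in s(1)])
        \<comment> \<open>This vertex is the point \<open>(i, 1 - \<epsilon>)\<close> of the prism.
          It is off the end \<open>\<epsilon>\<close>, and off every prism simplex in
          \<open>J\<close>: for \<open>\<epsilon> = 1\<close> these have \<open>j < i\<close> and do
          not contain \<open>(i, 0)\<close>, for \<open>\<epsilon> = 0\<close> they have
          \<open>j > i\<close> and do not contain \<open>(i, 1)\<close>.\<close>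
        obtain t0 where t0: "t0 \<le> l" "\<phi> t0 = i + (1 - \<epsilon>)" using s(2) by auto
        have "compose {..l} \<chi> \<phi> t0 \<noteq> \<epsilon>" using \<epsilon> t0 by (cases \<epsilon>) (auto simp: \<chi>\<phi>[OF \<phi> t0(1)])
        then have "compose {..l} \<chi> \<phi> \<noteq> const_path \<epsilon> l" using t0(1) by (auto simp: const_path_def)
        with not_U in_W obtain \<theta> j where \<theta>: "act V l m (compose {..l} \<sigma> \<phi>) x = act V l m \<theta> x"
          "\<theta> \<in> \<Delta> l m" "j \<in> J" "on_prism_simplex l \<theta> (compose {..l} \<chi> \<phi>) j"
          by (auto simp: zact[OF \<phi>] prism_part_def cyl_part_def)
        have "compose {..l} \<sigma> \<phi> = \<theta>"
          by (rule degeneracy_inj[where U = U, OF V x faces \<sigma>\<phi>_in s(1) \<theta>(2,1)])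
        then show False
          using \<theta>(3,4) t0 J \<epsilon> \<sigma>\<phi>[OF \<phi> t0(1)] \<chi>\<phi>[OF \<phi> t0(1)]
          by (auto simp: on_prism_simplex_def)
      qed
    qed
  next
    fix l \<phi> \<phi>' assume \<phi>: "\<phi> \<in> \<Delta> l (Suc m)" "\<phi>' \<in> \<Delta> l (Suc m)"
      "\<phi> \<notin> simplices (horn (Suc m) ?k) l" "\<phi>' \<notin> simplices (horn (Suc m) ?k) l"
      and eq: "act (cylinder V) l (Suc m) \<phi> z = act (cylinder V) l (Suc m) \<phi>' z"
    have 1: "compose {..l} \<sigma> \<phi> = compose {..l} \<sigma> \<phi>'"
      by (rule degeneracy_inj[where U = U, OF V x faces compose_\<Delta>[OF \<sigma> \<phi>(1)] surj(1)[OF \<phi>(1,3)]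
            compose_\<Delta>[OF \<sigma> \<phi>(2)]]) (use eq in \<open>simp_all add: zact \<phi>\<close>)
    have 2: "compose {..l} \<chi> \<phi> = compose {..l} \<chi> \<phi>'" using eq by (simp add: zact \<phi>)
    show "\<phi> = \<phi>'"
    proof (rule \<Delta>_eqI[OF \<phi>(1,2)])
      fix t assume t: "t \<le> l"
      \<comment> \<open>The vertices of a prism simplex are distinct points of the prism, so the two
        coordinates together recover \<open>\<phi>\<close>.\<close>
      have aux: "a = b" if "(if a \<le> i then a else a - 1) = (if b \<le> i then b else b - 1)"
        "(if a \<le> i then 0 else 1 :: nat) = (if b \<le> i then 0 else 1)" for a b :: nat
        using that by presburger
      have "(if \<phi> t \<le> i then \<phi> t else \<phi> t - 1) = (if \<phi>' t \<le> i then \<phi>' t else \<phi>' t - 1)"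
        using fun_cong[OF 1, of t] by (simp only: \<sigma>\<phi>[OF \<phi>(1) t] \<sigma>\<phi>[OF \<phi>(2) t])
      moreover have "(if \<phi> t \<le> i then 0 else 1 :: nat) = (if \<phi>' t \<le> i then 0 else 1)"
        using fun_cong[OF 2, of t] by (simp only: \<chi>\<phi>[OF \<phi>(1) t] \<chi>\<phi>[OF \<phi>(2) t])
      ultimately show "\<phi> t = \<phi>' t" by (rule aux)
    qed
  qed (use i \<epsilon> in auto)
  also have "(\<lambda>l. ?W l \<union> (\<lambda>\<phi>. act (cylinder V) l (Suc m) \<phi> z) ` \<Delta> l (Suc m)) =
      prism_part V U \<epsilon> m x (insert i J)"
  proof (rule ext, rule set_eqI, rule iffI)
    fix l y assume "y \<in> ?W l \<union> (\<lambda>\<phi>. act (cylinder V) l (Suc m) \<phi> z) ` \<Delta> l (Suc m)"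
    then consider "y \<in> ?W l" | \<phi> where "\<phi> \<in> \<Delta> l (Suc m)" "y = act (cylinder V) l (Suc m) \<phi> z" by auto
    then show "y \<in> prism_part V U \<epsilon> m x (insert i J) l"
    proof cases
      case 1 then show ?thesis by (auto simp: prism_part_def)
    next
      case 2
      have "on_prism_simplex l (compose {..l} \<sigma> \<phi>) (compose {..l} \<chi> \<phi>) i"
        using \<sigma>\<phi>[OF 2(1)] \<chi>\<phi>[OF 2(1)] by (auto simp: on_prism_simplex_def)
      then show ?thesis
        using compose_\<Delta>[OF \<sigma> 2(1)] compose_\<Delta>[OF \<chi> 2(1)]
        by (auto simp: 2(2) zact[OF 2(1)] prism_part_def)
    qed
  next
    fix l y assume "y \<in> prism_part V U \<epsilon> m x (insert i J) l"
    then consider "y \<in> ?W l" | \<theta> \<tau> where "y = (act V l m \<theta> x, \<tau>)" "\<theta> \<in> \<Delta> l m" "\<tau> \<in> \<Delta> l 1"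
      "on_prism_simplex l \<theta> \<tau> i" by (auto simp: prism_part_def)
    then show "y \<in> ?W l \<union> (\<lambda>\<phi>. act (cylinder V) l (Suc m) \<phi> z) ` \<Delta> l (Suc m)"
    proof cases
      case 2
      \<comment> \<open>The point \<open>(t, 0)\<close> with \<open>t \<le> i\<close> is vertex
        number \<open>t\<close> of the \<open>i\<close>-th prism simplex, and \<open>(t, 1)\<close>
        with \<open>i \<le> t\<close> is vertex number \<open>t + 1\<close>; in both cases the
        number is the sum of the coordinates.\<close>
      define \<phi> where "\<phi> = (\<lambda>t\<in>{..l}. \<theta> t + \<tau> t)"
      have \<phi>: "\<phi> \<in> \<Delta> l (Suc m)"
        unfolding \<phi>_def
      proof (rule \<Delta>I)
        fix t assume "t \<le> l"
        then show "restrict (\<lambda>t. \<theta> t + \<tau> t) {..l} t \<le> Suc m"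
          using \<Delta>D(1)[OF 2(2), of t] \<Delta>D(1)[OF 2(3), of t] by simp
      next
        fix t t' assume "t \<le> t'" "t' \<le> l"
        then show "restrict (\<lambda>t. \<theta> t + \<tau> t) {..l} t \<le> restrict (\<lambda>t. \<theta> t + \<tau> t) {..l} t'"
          using \<Delta>D(2)[OF 2(2), of t t'] \<Delta>D(2)[OF 2(3), of t t'] by simp
      qed simp
      have \<tau>01: "\<tau> t = 0 \<and> \<theta> t \<le> i \<or> \<tau> t = 1 \<and> i \<le> \<theta> t" if "t \<le> l" for t
        using \<Delta>D(1)[OF 2(3) that] 2(4) that unfolding on_prism_simplex_def
        by (cases "\<tau> t") auto
      have "compose {..l} \<sigma> \<phi> = \<theta>"
      proof (rule \<Delta>_eqI[OF compose_\<Delta>[OF \<sigma> \<phi>] 2(2)])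
        fix t assume t: "t \<le> l"
        then show "compose {..l} \<sigma> \<phi> t = \<theta> t"
          using \<tau>01[OF t] by (auto simp: \<sigma>\<phi>[OF \<phi> t]) (auto simp: \<phi>_def)
      qed
      moreover have "compose {..l} \<chi> \<phi> = \<tau>"
      proof (rule \<Delta>_eqI[OF compose_\<Delta>[OF \<chi> \<phi>] 2(3)])
        fix t assume t: "t \<le> l"
        then show "compose {..l} \<chi> \<phi> t = \<tau> t"
          using \<tau>01[OF t] by (auto simp: \<chi>\<phi>[OF \<phi> t]) (auto simp: \<phi>_def)
      qed
      ultimately show ?thesis using 2(1) zact[OF \<phi>] \<phi> by force
    qed auto
  qed
  finally show ?thesis .
qed

lemma prism_part_mono: "J \<subseteq> J' \<Longrightarrow> prism_part V U \<epsilon> m x J l \<subseteq> prism_part V U \<epsilon> m x J' l"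
  by (auto simp: prism_part_def)

lemma prism_part_all:
  "prism_part V U \<epsilon> m x {..m} = cyl_part V (\<lambda>l. U l \<union> (\<lambda>\<theta>. act V l m \<theta> x) ` \<Delta> l m) \<epsilon>"
proof (rule ext, rule set_eqI, rule iffI)
  fix l y assume "y \<in> prism_part V U \<epsilon> m x {..m} l"
  then show "y \<in> cyl_part V (\<lambda>l. U l \<union> (\<lambda>\<theta>. act V l m \<theta> x) ` \<Delta> l m) \<epsilon> l"
    using act_in[OF V _ x(1)] by (auto simp: prism_part_def cyl_part_def)
next
  fix l y assume y: "y \<in> cyl_part V (\<lambda>l. U l \<union> (\<lambda>\<theta>. act V l m \<theta> x) ` \<Delta> l m) \<epsilon> l"
  show "y \<in> prism_part V U \<epsilon> m x {..m} l"
  proof (cases "y \<in> cyl_part V U \<epsilon> l")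
    case False
    then obtain \<theta> \<tau> where y: "y = (act V l m \<theta> x, \<tau>)" "\<theta> \<in> \<Delta> l m" "\<tau> \<in> \<Delta> l 1"
      using y by (auto simp: cyl_part_def)
    \<comment> \<open>Since \<open>\<tau>\<close> is monotone, its zeros precede its ones, so the
      largest base vertex reached at the end 0 is a lower bound for those reached at the end 1.
      Inserting 0 covers a \<open>\<tau>\<close> without zeros.\<close>
    define j where "j = Max (insert 0 {\<theta> t | t. t \<le> l \<and> \<tau> t = 0})"
    have fin: "finite (insert 0 {\<theta> t | t. t \<le> l \<and> \<tau> t = 0})" by simp
    have "j \<in> insert 0 {\<theta> t | t. t \<le> l \<and> \<tau> t = 0}" unfolding j_def by (rule Max_in[OF fin]) simp
    moreover have "\<theta> t \<le> j" if "t \<le> l" "\<tau> t = 0" for t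
      unfolding j_def by (rule Max_ge[OF fin]) (use that in auto)
    moreover have "\<theta> t' \<le> \<theta> t" if "t \<le> l" "t' \<le> l" "\<tau> t' = 0" "\<tau> t = 1" for t t'
      using \<Delta>D(2)[OF y(2), of t' t] \<Delta>D(2)[OF y(3), of t t'] that by (cases "t' \<le> t") auto
    ultimately have "on_prism_simplex l \<theta> \<tau> j" "j \<le> m"
      using \<Delta>D(1)[OF y(2)] by (auto simp: on_prism_simplex_def)
    with y show ?thesis by (auto simp: prism_part_def)
  qed (simp add: prism_part_def)
qed

lemma lifting_prism:
  assumes kan: "kan_fibration E B p"
  shows "lifting E B p (cylinder V) (cyl_part V U \<epsilon>)
    (cyl_part V (\<lambda>l. U l \<union> (\<lambda>\<theta>. act V l m \<theta> x) ` \<Delta> l m) \<epsilon>)"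
proof -
  \<comment> \<open>The first \<open>i\<close> prism simplices in filling order. The second case is
    written additively because \<open>m - i\<close> truncates: at \<open>i = Suc m\<close> the
    interval above \<open>m - i\<close> would lack 0.\<close>
  define J where "J i = (if \<epsilon> = 1 then {..<i} else {j. j \<le> m \<and> m < i + j})" for i
  have *: "lifting E B p (cylinder V) (prism_part V U \<epsilon> m x {}) (prism_part V U \<epsilon> m x (J i))" if "i \<le> Suc m" for i
    using that
  proof (induction i)
    case 0
    have "J 0 = {}" by (auto simp: J_def)
    then show ?case by (simp add: lifting_refl)
  next
    case (Suc i)
    have "lifting E B p (cylinder V) (prism_part V U \<epsilon> m x (J i)) (prism_part V U \<epsilon> m x (J (Suc i)))"
    proof (cases "\<epsilon> = 1")
      case True
      then have "J (Suc i) = insert i (J i)" by (auto simp: J_def)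
      with lifting_prism_step[OF kan, of i "J i"] Suc.prems True show ?thesis by (simp add: J_def)
    next
      case False
      then have "J (Suc i) = insert (m - i) (J i)" "J i = {m - i<..m}" "\<epsilon> = 0"
        using Suc.prems \<epsilon> by (auto simp: J_def)
      with lifting_prism_step[OF kan, of "m - i" "J i"] show ?thesis by simp
    qed
    moreover have "J i \<subseteq> J (Suc i)" using Suc.prems by (auto simp: J_def)
    ultimately show ?case
      using Suc by (auto intro!: lifting_trans[OF Suc.IH] prism_part_mono)
  qed
  have "J (Suc m) = {..m}" by (auto simp: J_def)
  with *[of "Suc m"] have "lifting E B p (cylinder V) (prism_part V U \<epsilon> m x {}) (prism_part V U \<epsilon> m x {..m})"
    by simp
  moreover have "prism_part V U \<epsilon> m x {} = cyl_part V U \<epsilon>" by (auto simp: prism_part_def)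
  ultimately show ?thesis by (simp only: prism_part_all)
qed

end

section \<open>Extending lifts through infinitely many cells\<close>

text \<open>A transfinite composite of single extensions, without ordinals: a maximal partial lift
  must be total, as \<open>step\<close> would enlarge it. \<open>P\<close> confines the stages to
  those for which a next step is known.\<close>

lemma lifting_Zorn:
  fixes Z :: "'z sset" and E :: "'e sset"
  assumes W0: "P W0" and closed: "\<And>W. P W \<Longrightarrow> closed_in Z W"
    and Union: "\<And>\<W>. \<W> \<noteq> {} \<Longrightarrow> (\<And>W. W \<in> \<W> \<Longrightarrow> P W) \<Longrightarrow> P (\<lambda>n. \<Union>W\<in>\<W>. W n)"
    and step: "\<And>W. P W \<Longrightarrow> W \<noteq> simplices Z \<Longrightarrow>
      \<exists>W'. P W' \<and> W' \<noteq> W \<and> (\<forall>n. W n \<subseteq> W' n) \<and> lifting E B p Z W W'"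
  shows "lifting E B p Z W0 (simplices Z)"
proof (rule liftingI)
  fix u v
  assume u: "is_smap (subsset Z W0) E u" and v: "is_smap (subsset Z (simplices Z)) B v"
    and uv: "\<And>n x. x \<in> W0 n \<Longrightarrow> p n (u n x) = v n x"
  define ext where "ext W w \<longleftrightarrow>
     P W \<and> (\<forall>n. W0 n \<subseteq> W n) \<and> is_smap (subsset Z W) E w \<and>
     (\<forall>n. \<forall>x\<in>W0 n. w n x = u n x) \<and> (\<forall>n. \<forall>x\<in>W n. p n (w n x) = v n x)"
    for W :: "nat \<Rightarrow> 'z set" and w :: "('z, 'e) smap"
  \<comment> \<open>Maps have arbitrary values off their domain, so only their graphs make extension
    of partial lifts an inclusion of sets.\<close>
  define graph where "graph W w = {(n, x, w n x) | n x. x \<in> W n}"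
    for W :: "nat \<Rightarrow> 'z set" and w :: "('z, 'e) smap"
  have graph_iff: "(n, x, e) \<in> graph W w \<longleftrightarrow> x \<in> W n \<and> e = w n x" for n x e W w
    by (auto simp: graph_def)
  let ?A = "{graph W w | W w. ext W w}"
  have "\<exists>M\<in>?A. \<forall>R\<in>?A. M \<subseteq> R \<longrightarrow> R = M"
  proof (rule subset_Zorn_nonempty)
    show "?A \<noteq> {}" using u uv W0 by (auto simp: ext_def)
  next
    fix \<R> assume ne: "\<R> \<noteq> {}" and "subset.chain ?A \<R>"
    then have chain: "R \<in> ?A" "R \<subseteq> R' \<or> R' \<subseteq> R" if "R \<in> \<R>" "R' \<in> \<R>" for R R'
      using that by (auto simp: subset_chain_def)
    have "\<exists>W w. R = graph W w \<and> ext W w" if "R \<in> \<R>" for R using chain(1)[OF that that] by auto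
    then obtain D d where D: "\<And>R. R \<in> \<R> \<Longrightarrow> R = graph (D R) (d R)" "\<And>R. R \<in> \<R> \<Longrightarrow> ext (D R) (d R)"
      by metis
    have mem: "(n, x, e) \<in> R \<longleftrightarrow> x \<in> D R n \<and> e = d R n x" if "R \<in> \<R>" for n x e R
      by (subst D(1)[OF that]) (rule graph_iff)
    define W where "W n = (\<Union>R\<in>\<R>. D R n)" for n
    define w where "w n x = (THE e. (n, x, e) \<in> \<Union>\<R>)" for n x
    have w: "w n x = d R n x" if R: "R \<in> \<R>" and x: "x \<in> D R n" for R n x
      unfolding w_def
    proof (rule the_equality)
      show "(n, x, d R n x) \<in> \<Union>\<R>" using R x mem[OF R, of n x "d R n x"] by auto
      fix e assume "(n, x, e) \<in> \<Union>\<R>"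
      then obtain R' where R': "R' \<in> \<R>" "(n, x, e) \<in> R'" by auto
      moreover have "(n, x, d R n x) \<in> R" using mem[OF R] x by simp
      ultimately have "(n, x, e) \<in> R' \<and> (n, x, d R n x) \<in> R' \<or> (n, x, e) \<in> R"
        using chain(2)[OF R R'(1)] by auto
      then show "e = d R n x" using mem[OF R] mem[OF R'(1)] by auto
    qed
    have "W = (\<lambda>n. \<Union>W\<in>D ` \<R>. W n)" by (simp add: W_def fun_eq_iff)
    moreover have "P (\<lambda>n. \<Union>W\<in>D ` \<R>. W n)"
      by (rule Union) (use ne D(2) in \<open>auto simp: ext_def\<close>)
    ultimately have "P W" by simp
    moreover have "is_smap (subsset Z W) E w"
    proof (rule is_smapI)
      fix n x assume "x \<in> simplices (subsset Z W) n"
      then obtain R where R: "R \<in> \<R>" "x \<in> D R n" by (auto simp: W_def)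
      have "is_smap (subsset Z (D R)) E (d R)" using D(2)[OF R(1)] by (simp add: ext_def)
      from smap_in[OF this, of x n] R show "w n x \<in> simplices E n" by (simp add: w)
    next
      fix m n \<theta> x assume \<theta>: "\<theta> \<in> \<Delta> m n" and "x \<in> simplices (subsset Z W) n"
      then obtain R where R: "R \<in> \<R>" "x \<in> D R n" by (auto simp: W_def)
      have 1: "is_smap (subsset Z (D R)) E (d R)" and 2: "closed_in Z (D R)"
        using D(2)[OF R(1)] closed by (auto simp: ext_def)
      from smap_act[OF 1 \<theta>, of x] R closed_inD(2)[OF 2 \<theta> R(2)]
      show "w m (act (subsset Z W) m n \<theta> x) = act E m n \<theta> (w n x)" by (simp add: w)
    qed
    moreover have W0W: "x \<in> W n \<and> w n x = u n x" if "x \<in> W0 n" for n x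
    proof -
      obtain R where R: "R \<in> \<R>" using ne by auto
      then have "x \<in> D R n" "d R n x = u n x" using D(2)[OF R] that by (auto simp: ext_def)
      with R show ?thesis by (auto simp: w W_def)
    qed
    moreover have "p n (w n x) = v n x" if x: "x \<in> W n" for n x
    proof -
      obtain R where R: "R \<in> \<R>" "x \<in> D R n" using x by (auto simp: W_def)
      then show ?thesis using D(2)[OF R(1)] by (simp add: w ext_def)
    qed
    ultimately have "ext W w" by (auto simp: ext_def)
    moreover have "(n, x, e) \<in> \<Union>\<R> \<longleftrightarrow> (n, x, e) \<in> graph W w" for n x e
    proof
      assume "(n, x, e) \<in> \<Union>\<R>"
      then obtain R where R: "R \<in> \<R>" "(n, x, e) \<in> R" by auto
      then have "x \<in> D R n" "e = d R n x"
        using mem[OF R(1)] by auto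
      then show "(n, x, e) \<in> graph W w" using R(1) by (auto simp: graph_iff w W_def)
    next
      assume "(n, x, e) \<in> graph W w"
      then obtain R where R: "R \<in> \<R>" "x \<in> D R n" "e = w n x" by (auto simp: graph_iff W_def)
      then have "(n, x, e) \<in> R" by (simp add: mem w)
      then show "(n, x, e) \<in> \<Union>\<R>" using R(1) by blast
    qed
    then have "\<Union>\<R> = graph W w" by auto
    ultimately show "\<Union>\<R> \<in> ?A" by blast
  qed
  then obtain W w where W: "ext W w"
    and "\<forall>R\<in>?A. graph W w \<subseteq> R \<longrightarrow> R = graph W w"
    by blast
  then have max: "graph W' w' = graph W w" if "ext W' w'" "graph W w \<subseteq> graph W' w'" for W' w'
    using that by blast
  have "W = simplices Z"
  proof (rule ccontr)
    assume "W \<noteq> simplices Z"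
    then obtain W' where W': "P W'" "W' \<noteq> W" "\<And>n. W n \<subseteq> W' n" "lifting E B p Z W W'"
      using step[of W] W by (auto simp: ext_def)
    have "is_smap (subsset Z W') B v"
      by (rule is_smap_subset[OF v]) (use closed[OF W'(1)] in \<open>auto simp: closed_in_def\<close>)
    then obtain w' where w': "is_smap (subsset Z W') E w'" "\<And>n x. x \<in> W n \<Longrightarrow> w' n x = w n x"
      "\<And>n x. x \<in> W' n \<Longrightarrow> p n (w' n x) = v n x"
      using W liftingE[OF W'(4), of w v] unfolding ext_def by metis
    have W0W: "x \<in> W n \<and> w n x = u n x" if "x \<in> W0 n" for n x using W that by (auto simp: ext_def)
    have "ext W' w'"
      using w' W'(1) subsetD[OF W'(3)] W0W by (auto simp: ext_def subset_iff)
    moreover have "graph W w \<subseteq> graph W' w'" using subsetD[OF W'(3)] w'(2) by (auto simp: graph_def)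
    ultimately have eq: "graph W' w' = graph W w" by (rule max)
    have "W' n = W n" for n
      using graph_iff[of n _ _ W' w'] graph_iff[of n _ _ W w] by (auto simp: eq)
    with W'(2) show False by auto
  qed
  with W show "\<exists>w. is_smap (subsset Z (simplices Z)) E w \<and> (\<forall>n. \<forall>x\<in>W0 n. w n x = u n x) \<and>
        (\<forall>n. \<forall>x\<in>simplices Z n. p n (w n x) = v n x)"
    by (auto simp: ext_def)
qed

text \<open>Some vertex \<open>j\<close> is missed; \<open>\<delta>\<close> is the coface skipping
  \<open>j\<close>, and \<open>\<sigma>\<close> is \<open>\<theta>\<close> with the values above
  \<open>j\<close> lowered by one. Faces of a simplex are thereby reduced to simplices of smaller
  dimension.\<close>

lemma \<Delta>_factor:
  assumes \<theta>: "\<theta> \<in> \<Delta> l m" and "\<theta> ` {..l} \<noteq> {..m}"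
  obtains k \<delta> \<sigma> where "k < m" "\<delta> \<in> \<Delta> k m" "\<sigma> \<in> \<Delta> l k" "\<theta> = compose {..l} \<delta> \<sigma>"
proof -
  have "\<theta> ` {..l} \<subseteq> {..m}" using \<Delta>D(1)[OF \<theta>] by auto
  with assms(2) obtain j where j: "j \<le> m" "j \<notin> \<theta> ` {..l}" by auto
  then have \<theta>j: "\<theta> t \<noteq> j" if "t \<le> l" for t using that by force
  have m: "0 < m" using \<theta>j[of 0] \<Delta>D(1)[OF \<theta>, of 0] j(1) by auto
  define \<delta> where "\<delta> = (\<lambda>i\<in>{..m - 1}. if i < j then i else Suc i)"
  define \<sigma> where "\<sigma> = (\<lambda>t\<in>{..l}. if \<theta> t < j then \<theta> t else \<theta> t - 1)"
  have \<sigma>_le: "(if \<theta> t < j then \<theta> t else \<theta> t - 1) \<le> m - 1" if "t \<le> l" for t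
    using \<Delta>D(1)[OF \<theta> that] j(1) by auto
  have "\<delta> \<in> \<Delta> (m - 1) m" using m by (auto simp: \<delta>_def intro!: \<Delta>I)
  moreover have "\<sigma> \<in> \<Delta> l (m - 1)"
    unfolding \<sigma>_def
  proof (rule \<Delta>I)
    fix t t' assume t: "t \<le> t'" "t' \<le> l"
    then show "(\<lambda>t\<in>{..l}. if \<theta> t < j then \<theta> t else \<theta> t - 1) t \<le> (\<lambda>t\<in>{..l}. if \<theta> t < j then \<theta> t else \<theta> t - 1) t'"
      using \<Delta>D(2)[OF \<theta> t] by auto
  qed (use \<sigma>_le in auto)
  moreover have "\<theta> t = compose {..l} \<delta> \<sigma> t" for t
  proof (cases "t \<le> l")
    case True
    then show ?thesis using \<theta>j[OF True] \<sigma>_le[OF True] by (auto simp: compose_def \<delta>_def \<sigma>_def)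
  next
    case False
    then show ?thesis using \<Delta>D(3)[OF \<theta>] by (auto simp: compose_def extensional_def)
  qed
  ultimately show thesis using that[of "m - 1" \<delta> \<sigma>] m by auto
qed

theorem homotopy_lifting:
  fixes V :: "'v sset"
  assumes kan: "kan_fibration E B p" and V: "is_sset V" and U: "closed_in V U" and \<epsilon>: "\<epsilon> \<le> 1"
  shows "lifting E B p (cylinder V) (cyl_part V U \<epsilon>) (simplices (cylinder V))"
proof (rule lifting_Zorn[where P = "\<lambda>W. \<exists>U. closed_in V U \<and> W = cyl_part V U \<epsilon>"])
  show "\<exists>U'. closed_in V U' \<and> cyl_part V U \<epsilon> = cyl_part V U' \<epsilon>" using U by blast
  show "closed_in (cylinder V) W" if "\<exists>U. closed_in V U \<and> W = cyl_part V U \<epsilon>" for W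
    using that closed_cyl_part[OF V] by auto
next
  fix \<W> :: "(nat \<Rightarrow> ('v \<times> (nat \<Rightarrow> nat)) set) set"
  assume ne: "\<W> \<noteq> {}" and "\<And>W. W \<in> \<W> \<Longrightarrow> \<exists>U. closed_in V U \<and> W = cyl_part V U \<epsilon>"
  then obtain D where D: "\<And>W. W \<in> \<W> \<Longrightarrow> closed_in V (D W)" "\<And>W. W \<in> \<W> \<Longrightarrow> W = cyl_part V (D W) \<epsilon>"
    by metis
  have "closed_in V (\<lambda>n. \<Union>W\<in>\<W>. D W n)"
  proof (rule closed_inI)
    fix n x assume "x \<in> (\<Union>W\<in>\<W>. D W n)"
    then show "x \<in> simplices V n" using closed_inD(1)[OF D(1)] by auto
  next
    fix m n \<theta> x assume \<theta>: "\<theta> \<in> \<Delta> m n" and "x \<in> (\<Union>W\<in>\<W>. D W n)"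
    then show "act V m n \<theta> x \<in> (\<Union>W\<in>\<W>. D W m)" using closed_inD(2)[OF D(1) \<theta>] by auto
  qed
  moreover have "(\<Union>W\<in>\<W>. W n) = cyl_part V (\<lambda>n. \<Union>W\<in>\<W>. D W n) \<epsilon> n" for n
  proof -
    have "(\<Union>W\<in>\<W>. W n) = (\<Union>W\<in>\<W>. cyl_part V (D W) \<epsilon> n)"
      using D(2) by (intro SUP_cong refl) metis
    also have "\<dots> = cyl_part V (\<lambda>n. \<Union>W\<in>\<W>. D W n) \<epsilon> n"
      using ne by (auto simp: cyl_part_def)
    finally show ?thesis .
  qed
  ultimately show "\<exists>U. closed_in V U \<and> (\<lambda>n. \<Union>W\<in>\<W>. W n) = cyl_part V U \<epsilon>" by blast
next
  fix W assume "\<exists>U. closed_in V U \<and> W = cyl_part V U \<epsilon>" and neq: "W \<noteq> simplices (cylinder V)"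
  then obtain U where U: "closed_in V U" and W: "W = cyl_part V U \<epsilon>" by blast
  have "\<exists>m x. x \<in> simplices V m \<and> x \<notin> U m"
  proof (rule ccontr)
    assume "\<not> ?thesis"
    then have "cyl_part V U \<epsilon> n = simplices (cylinder V) n" for n by (auto simp: cyl_part_def)
    with neq W show False by (simp add: fun_eq_iff)
  qed
  \<comment> \<open>Leastness does the work of a skeletal filtration: all simplices of smaller
    dimension are in \<open>U\<close>, so the new simplex has its boundary in \<open>U\<close> and
    is nondegenerate, and no existence part of the Eilenberg--Zilber lemma is called for.\<close>
  define m where "m = (LEAST m. \<exists>x. x \<in> simplices V m \<and> x \<notin> U m)"
  have "\<exists>x. x \<in> simplices V m \<and> x \<notin> U m" unfolding m_def by (rule LeastI_ex) fact
  then obtain x where x: "x \<in> simplices V m" "x \<notin> U m" by blast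
  have below: "simplices V k \<subseteq> U k" if "k < m" for k
    using not_less_Least[OF that[unfolded m_def]] by blast
  have faces: "act V l m \<theta> x \<in> U l" if \<theta>: "\<theta> \<in> \<Delta> l m" "\<theta> ` {..l} \<noteq> {..m}" for l \<theta>
  proof -
    obtain k \<delta> \<sigma> where "k < m" "\<delta> \<in> \<Delta> k m" "\<sigma> \<in> \<Delta> l k" "\<theta> = compose {..l} \<delta> \<sigma>"
      by (rule \<Delta>_factor[OF \<theta>])
    then show ?thesis
      using closed_inD(2)[OF U, of \<sigma> l k "act V k m \<delta> x"] below act_in[OF V, of \<delta> k m x] x(1)
        act_comp[OF V, of \<sigma> l k \<delta> m x] by auto
  qed
  let ?U = "\<lambda>l. U l \<union> (\<lambda>\<theta>. act V l m \<theta> x) ` \<Delta> l m"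
  have "closed_in V ?U"
  proof (rule closed_inI)
    fix l' l \<psi> y assume \<psi>: "\<psi> \<in> \<Delta> l' l" and "y \<in> ?U l"
    then show "act V l' l \<psi> y \<in> ?U l'"
      using closed_inD(2)[OF U \<psi>] act_comp[OF V \<psi> _ x(1)] compose_\<Delta>[OF _ \<psi>] by force
  qed (use closed_inD(1)[OF U] act_in[OF V _ x(1)] in auto)
  moreover have "cyl_part V ?U \<epsilon> \<noteq> W"
  proof -
    have "x \<in> (\<lambda>\<theta>. act V m m \<theta> x) ` \<Delta> m m" using act_id[OF V x(1)] \<Delta>_id_in by (auto intro!: image_eqI[of _ _ "\<Delta>_id m"])
    then have "x \<in> ?U m" by blast
    \<comment> \<open>The stage really grows: at the end \<open>\<epsilon>\<close> the simplex
      \<open>x\<close> was present all along, so the witness is taken at the opposite end.\<close>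
    then have "(x, const_path (1 - \<epsilon>) m) \<in> cyl_part V ?U \<epsilon> m"
      using x(1) const_path_in[of "1 - \<epsilon>" m, OF diff_le_self[of 1 \<epsilon>]] unfolding cyl_part_def by blast
    moreover have "const_path (1 - \<epsilon>) m 0 \<noteq> const_path \<epsilon> m 0"
      using \<epsilon> by (cases \<epsilon>) (auto simp: const_path_def)
    then have "(x, const_path (1 - \<epsilon>) m) \<notin> W m" using x(2) by (auto simp: W cyl_part_def)
    ultimately show ?thesis by auto
  qed
  moreover have "W n \<subseteq> cyl_part V ?U \<epsilon> n" for n by (auto simp: W cyl_part_def)
  moreover have "lifting E B p (cylinder V) W (cyl_part V ?U \<epsilon>)"
    unfolding W by (rule lifting_prism[OF V U x faces \<epsilon> kan])
  ultimately show "\<exists>W'. (\<exists>U. closed_in V U \<and> W' = cyl_part V U \<epsilon>) \<and> W' \<noteq> W \<and>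
      (\<forall>n. W n \<subseteq> W' n) \<and> lifting E B p (cylinder V) W W'"
    by blast
qed

section \<open>The dependent polynomial functor preserves Kan fibrations\<close>

lemma kan_fibrationI:
  assumes "is_sset X" "is_sset Y" "is_smap X Y p"
    and "\<And>n k u v. 1 \<le> n \<Longrightarrow> k \<le> n \<Longrightarrow> is_smap (horn n k) X u \<Longrightarrow> is_smap (std_simplex n) Y v \<Longrightarrow>
      (\<And>m \<theta>. \<theta> \<in> simplices (horn n k) m \<Longrightarrow> p m (u m \<theta>) = v m \<theta>) \<Longrightarrow>
      \<exists>w. is_smap (std_simplex n) X w \<and> (\<forall>m. \<forall>\<theta>\<in>simplices (horn n k) m. w m \<theta> = u m \<theta>) \<and>
        (\<forall>m. \<forall>\<theta>\<in>\<Delta> m n. p m (w m \<theta>) = v m \<theta>)"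
  shows "kan_fibration X Y p"
  unfolding kan_fibration_def by (auto simp: smap_eq_def intro!: assms)

lemma kan_fibrationE:
  assumes "kan_fibration X Y p" "1 \<le> n" "k \<le> n" "is_smap (horn n k) X u" "is_smap (std_simplex n) Y v"
    and "\<And>m \<theta>. \<theta> \<in> simplices (horn n k) m \<Longrightarrow> p m (u m \<theta>) = v m \<theta>"
  obtains w where "is_smap (std_simplex n) X w" "\<And>m \<theta>. \<theta> \<in> simplices (horn n k) m \<Longrightarrow> w m \<theta> = u m \<theta>"
    "\<And>m \<theta>. \<theta> \<in> \<Delta> m n \<Longrightarrow> p m (w m \<theta>) = v m \<theta>"
  using assms unfolding kan_fibration_def smap_eq_def by (simp del: One_nat_def) metis

lemma is_smap_comp: "is_smap X Y k \<Longrightarrow> is_smap Y Z k' \<Longrightarrow> is_smap X Z (\<lambda>n x. k' n (k n x))"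
  by (auto simp: is_smap_def)

lemma horn_\<Delta>: "\<theta> \<in> simplices (horn n k) m \<Longrightarrow> \<theta> \<in> \<Delta> m n"
  by (simp add: horn_iff)

lemma is_smap_std_simplex:
  assumes "is_smap (std_simplex n) Y v" "\<theta> \<in> \<Delta> m n"
  shows "v m \<theta> = act Y m n \<theta> (v n (\<Delta>_id n))"
  using smap_act[OF assms(1,2), of "\<Delta>_id n"] by (simp add: \<Delta>_id_in compose_\<Delta>_id_left[OF assms(2)])

lemma is_smap_Yoneda:
  assumes "is_sset X" "x \<in> simplices X n"
  shows "is_smap (std_simplex n) X (\<lambda>m \<theta>. act X m n \<theta> x)"
  by (rule is_smapI) (use assms in \<open>auto simp: act_in act_comp\<close>)

lemma kan_comp:
  assumes p: "kan_fibration X Y p" and q: "kan_fibration Y Z q"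
  shows "kan_fibration X Z (\<lambda>n x. q n (p n x))"
proof (rule kan_fibrationI)
  fix n k u v assume n: "1 \<le> n" "k \<le> n" and u: "is_smap (horn n k) X u"
    and v: "is_smap (std_simplex n) Z v" "\<And>m \<theta>. \<theta> \<in> simplices (horn n k) m \<Longrightarrow> q m (p m (u m \<theta>)) = v m \<theta>"
  obtain w where w: "is_smap (std_simplex n) Y w"
    "\<And>m \<theta>. \<theta> \<in> simplices (horn n k) m \<Longrightarrow> w m \<theta> = p m (u m \<theta>)"
    "\<And>m \<theta>. \<theta> \<in> \<Delta> m n \<Longrightarrow> q m (w m \<theta>) = v m \<theta>"
    using kan_fibrationE[OF q n is_smap_comp[OF u kan_fibrationD(3)[OF p]] v] by blast
  obtain w' where "is_smap (std_simplex n) X w'"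
    "\<And>m \<theta>. \<theta> \<in> simplices (horn n k) m \<Longrightarrow> w' m \<theta> = u m \<theta>"
    "\<And>m \<theta>. \<theta> \<in> \<Delta> m n \<Longrightarrow> p m (w' m \<theta>) = w m \<theta>"
    using kan_fibrationE[OF p n u w(1) w(2)[symmetric]] by blast
  with w(3) show "\<exists>w. is_smap (std_simplex n) X w \<and> (\<forall>m. \<forall>\<theta>\<in>simplices (horn n k) m. w m \<theta> = u m \<theta>) \<and>
        (\<forall>m. \<forall>\<theta>\<in>\<Delta> m n. q m (p m (w m \<theta>)) = v m \<theta>)"
    by (intro exI[of _ w']) simp
qed (use kan_fibrationD[OF p] kan_fibrationD[OF q] in \<open>auto intro: is_smap_comp\<close>)

text \<open>The inverse of a levelwise bijective simplicial map is simplicial. This carries fibrancy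
  from the value of the functor to its image under \<open>\<alpha>\<close>.\<close>

lemma kan_iso:
  assumes p: "kan_fibration X Z p" and Y: "is_sset Y" and q: "is_smap Y Z q" and k: "is_smap X Y k"
    and bij: "\<And>n. bij_betw (k n) (simplices X n) (simplices Y n)"
    and qk: "\<And>n x. x \<in> simplices X n \<Longrightarrow> q n (k n x) = p n x"
  shows "kan_fibration Y Z q"
proof (rule kan_fibrationI[OF Y kan_fibrationD(2)[OF p] q])
  define i where "i n = inv_into (simplices X n) (k n)" for n
  have i: "i n y \<in> simplices X n" "k n (i n y) = y" if "y \<in> simplices Y n" for n y
    using bij_betwE[OF bij_betw_inv_into[OF bij]] bij_betw_inv_into_right[OF bij] that by (auto simp: i_def)
  have ik: "i n (k n x) = x" if "x \<in> simplices X n" for n x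
    using bij_betw_inv_into_left[OF bij that] by (simp add: i_def)
  have im: "is_smap Y X i"
  proof (rule is_smapI)
    fix m n \<theta> y assume \<theta>: "\<theta> \<in> \<Delta> m n" and y: "y \<in> simplices Y n"
    have "i m (act Y m n \<theta> y) = i m (k m (act X m n \<theta> (i n y)))"
      using smap_act[OF k \<theta> i(1)[OF y]] i(2)[OF y] by simp
    also have "\<dots> = act X m n \<theta> (i n y)"
      by (rule ik) (rule act_in[OF kan_fibrationD(1)[OF p] \<theta> i(1)[OF y]])
    finally show "i m (act Y m n \<theta> y) = act X m n \<theta> (i n y)" .
  qed (rule i(1))
  fix n j u v assume n: "1 \<le> n" "j \<le> n" and u: "is_smap (horn n j) Y u"
    and v: "is_smap (std_simplex n) Z v" "\<And>m \<theta>. \<theta> \<in> simplices (horn n j) m \<Longrightarrow> q m (u m \<theta>) = v m \<theta>"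
  have iuv: "p m (i m (u m \<theta>)) = v m \<theta>" if "\<theta> \<in> simplices (horn n j) m" for m \<theta>
    using that v(2) i[OF smap_in[OF u]] qk[OF i(1)[OF smap_in[OF u]]] by metis
  obtain w where w: "is_smap (std_simplex n) X w"
    "\<And>m \<theta>. \<theta> \<in> simplices (horn n j) m \<Longrightarrow> w m \<theta> = i m (u m \<theta>)"
    "\<And>m \<theta>. \<theta> \<in> \<Delta> m n \<Longrightarrow> p m (w m \<theta>) = v m \<theta>"
    using kan_fibrationE[OF p n is_smap_comp[OF u im] v(1) iuv] by blast
  have "is_smap (std_simplex n) Y (\<lambda>m \<theta>. k m (w m \<theta>))" by (rule is_smap_comp[OF w(1) k])
  moreover have "k m (w m \<theta>) = u m \<theta>" if "\<theta> \<in> simplices (horn n j) m" for m \<theta>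
    using that i(2)[OF smap_in[OF u]] w(2) by simp
  moreover have "q m (k m (w m \<theta>)) = v m \<theta>" if "\<theta> \<in> \<Delta> m n" for m \<theta>
    using that w(3) qk smap_in[OF w(1)] by simp
  ultimately show "\<exists>w. is_smap (std_simplex n) Y w \<and> (\<forall>m. \<forall>\<theta>\<in>simplices (horn n j) m. w m \<theta> = u m \<theta>) \<and>
        (\<forall>m. \<forall>\<theta>\<in>\<Delta> m n. q m (w m \<theta>) = v m \<theta>)"
    by blast
qed

lemma kan_pullback:
  assumes B: "is_sset B" and h: "is_smap B C h" and p: "kan_fibration X C p"
  shows "kan_fibration (total_space (pullback B h (X, p))) B (\<lambda>n. fst)"
proof (rule kan_fibrationI)
  have "is_over B (pullback B h (X, p))"
    by (rule pullback_over[OF B h]) (use kan_fibrationD[OF p] in simp)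
  then show "is_sset (total_space (pullback B h (X, p)))" "is_sset B"
    "is_smap (total_space (pullback B h (X, p))) B (\<lambda>n. fst)" by auto
  fix n k u v assume n: "1 \<le> n" "k \<le> n" and u: "is_smap (horn n k) (total_space (pullback B h (X, p))) u"
    and v: "is_smap (std_simplex n) B v" "\<And>m \<theta>. \<theta> \<in> simplices (horn n k) m \<Longrightarrow> fst (u m \<theta>) = v m \<theta>"
  have snd: "is_smap (total_space (pullback B h (X, p))) X (\<lambda>n. snd)"
    by (rule is_smapI) auto
  have hv: "is_smap (std_simplex n) C (\<lambda>m \<theta>. h m (v m \<theta>))" by (rule is_smap_comp[OF v(1) h])
  have uhv: "p m (snd (u m \<theta>)) = h m (v m \<theta>)" if \<theta>: "\<theta> \<in> simplices (horn n k) m" for m \<theta>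
    using smap_in[OF u \<theta>] v(2)[OF \<theta>] by auto
  obtain w where w: "is_smap (std_simplex n) X w"
    "\<And>m \<theta>. \<theta> \<in> simplices (horn n k) m \<Longrightarrow> w m \<theta> = snd (u m \<theta>)"
    "\<And>m \<theta>. \<theta> \<in> \<Delta> m n \<Longrightarrow> p m (w m \<theta>) = h m (v m \<theta>)"
    using kan_fibrationE[OF p n is_smap_comp[OF u snd] hv uhv] by blast
  have "is_smap (std_simplex n) (total_space (pullback B h (X, p))) (\<lambda>m \<theta>. (v m \<theta>, w m \<theta>))"
    by (rule is_smapI)
      (use smap_in[OF v(1)] smap_in[OF w(1)] smap_act[OF v(1)] smap_act[OF w(1)] w(3) in auto)
  then show "\<exists>w. is_smap (std_simplex n) (total_space (pullback B h (X, p))) w \<and>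
        (\<forall>m. \<forall>\<theta>\<in>simplices (horn n k) m. w m \<theta> = u m \<theta>) \<and>
        (\<forall>m. \<forall>\<theta>\<in>\<Delta> m n. fst (w m \<theta>) = v m \<theta>)"
    using w(2) v(2) by (intro exI[of _ "\<lambda>m \<theta>. (v m \<theta>, w m \<theta>)"]) (simp add: prod_eq_iff)
qed

section \<open>Horn inclusions pulled back along a Kan fibration\<close>

text \<open>The pullback of \<open>f\<close> to the simplex classified by \<open>a\<close>, now as a
  simplicial set: the dimension stored in the triples of \<open>fibre\<close> becomes the
  index.\<close>

definition fibre_sset :: "'a sset \<Rightarrow> 'b sset \<Rightarrow> ('b, 'a) smap \<Rightarrow> nat \<Rightarrow> 'a \<Rightarrow> ((nat \<Rightarrow> nat) \<times> 'b) sset" where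
  "fibre_sset A B f n a = \<lparr>simplices = (\<lambda>m. {(\<theta>, b). (m, \<theta>, b) \<in> fibre A B f n a}),
     act = (\<lambda>l m \<psi> (\<theta>, b). (compose {..l} \<theta> \<psi>, act B l m \<psi> b))\<rparr>"

lemma fibre_sset_simps [simp]:
  "(\<theta>, b) \<in> simplices (fibre_sset A B f n a) m \<longleftrightarrow> (m, \<theta>, b) \<in> fibre A B f n a"
  "act (fibre_sset A B f n a) l m \<psi> (\<theta>, b) = (compose {..l} \<theta> \<psi>, act B l m \<psi> b)"
  by (simp_all add: fibre_sset_def)

lemma is_sset_fibre:
  assumes A: "is_sset A" and B: "is_sset B" and f: "is_smap B A f" and a: "a \<in> simplices A n"
  shows "is_sset (fibre_sset A B f n a)"
proof (rule is_ssetI; clarify)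
  fix m k \<theta> \<psi> b assume "\<theta> \<in> \<Delta> m k" "(\<psi>, b) \<in> simplices (fibre_sset A B f n a) k"
  then show "act (fibre_sset A B f n a) m k \<theta> (\<psi>, b) \<in> simplices (fibre_sset A B f n a) m"
    using fibre_act[OF A B f _ _ a] by simp
qed (auto simp: fibre_iff compose_\<Delta>_id_right compose_\<Delta>_assoc act_id[OF B] act_comp[OF B])

definition fibre_horn :: "'a sset \<Rightarrow> 'b sset \<Rightarrow> ('b, 'a) smap \<Rightarrow> nat \<Rightarrow> nat \<Rightarrow> 'a
    \<Rightarrow> nat \<Rightarrow> ((nat \<Rightarrow> nat) \<times> 'b) set" where
  "fibre_horn A B f n k a m =
     {(\<theta>, b) \<in> simplices (fibre_sset A B f n a) m. \<theta> \<in> simplices (horn n k) m}"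

lemma closed_fibre_horn:
  assumes A: "is_sset A" and B: "is_sset B" and f: "is_smap B A f" and a: "a \<in> simplices A n"
  shows "closed_in (fibre_sset A B f n a) (fibre_horn A B f n k a)"
proof (rule closed_inI)
  fix m n' \<theta> y assume \<theta>: "\<theta> \<in> \<Delta> m n'" and y: "y \<in> fibre_horn A B f n k a n'"
  then show "act (fibre_sset A B f n a) m n' \<theta> y \<in> fibre_horn A B f n k a m"
    using horn_compose[OF _ \<theta>] fibre_act[OF A B f _ \<theta> a] by (auto simp: fibre_horn_def)
qed (auto simp: fibre_horn_def)

text \<open>
  The vertex map at the end \<open>\<epsilon>\<close> of the homotopy \<open>R\<close> is \<open>i \<mapsto> min i k\<close> (with \<open>\<epsilon> = 0\<close>) if \<open>k < n\<close>, and
  \<open>i \<mapsto> max i k\<close> (with \<open>\<epsilon> = 1\<close>) if \<open>k = n\<close>.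
\<close>

lemma horn_homotopy:
  assumes n: "1 \<le> n" "k \<le> n"
  obtains \<epsilon> :: nat and R :: "nat \<Rightarrow> (nat \<Rightarrow> nat) \<Rightarrow> (nat \<Rightarrow> nat) \<Rightarrow> nat \<Rightarrow> nat" where
    "\<epsilon> \<le> 1"
    "\<And>m \<theta> \<tau>. \<theta> \<in> \<Delta> m n \<Longrightarrow> \<tau> \<in> \<Delta> m 1 \<Longrightarrow> R m \<theta> \<tau> \<in> \<Delta> m n"
    "\<And>l m \<theta> \<tau> \<psi>. \<theta> \<in> \<Delta> m n \<Longrightarrow> \<tau> \<in> \<Delta> m 1 \<Longrightarrow> \<psi> \<in> \<Delta> l m \<Longrightarrow>
      R l (compose {..l} \<theta> \<psi>) (compose {..l} \<tau> \<psi>) = compose {..l} (R m \<theta> \<tau>) \<psi>"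
    "\<And>m \<theta>. \<theta> \<in> \<Delta> m n \<Longrightarrow> R m \<theta> (const_path (1 - \<epsilon>) m) = \<theta>"
    "\<And>m \<theta>. \<theta> \<in> \<Delta> m n \<Longrightarrow> R m \<theta> (const_path \<epsilon> m) \<in> simplices (horn n k) m"
    "\<And>m \<theta> \<tau>. \<theta> \<in> simplices (horn n k) m \<Longrightarrow> \<tau> \<in> \<Delta> m 1 \<Longrightarrow> R m \<theta> \<tau> \<in> simplices (horn n k) m"
proof -
  \<comment> \<open>As \<open>c i\<close> is \<open>i\<close> or \<open>k\<close>, a simplex that
    misses some \<open>j \<noteq> k\<close> misses it throughout the homotopy. The vertex
    \<open>j0\<close> is missed by \<open>c\<close> altogether, which puts the end
    \<open>\<epsilon>\<close> into the horn. The inequality tied to \<open>\<epsilon>\<close> makes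
    the homotopy run in the direction of the interval, hence monotone. Two cases arise because
    \<open>min i k\<close> is the identity on the vertices when \<open>k = n\<close>.\<close>
  obtain \<epsilon> :: nat and c :: "nat \<Rightarrow> nat" and j0 where \<epsilon>: "\<epsilon> \<le> 1"
    and c: "\<And>i. c i = i \<or> c i = k" "\<And>i i'. i \<le> i' \<Longrightarrow> c i \<le> c i'"
    and c\<epsilon>: "\<And>i. \<epsilon> = 0 \<and> c i \<le> i \<or> \<epsilon> = 1 \<and> i \<le> c i"
    and j0: "j0 \<le> n" "j0 \<noteq> k" "\<And>i. i \<le> n \<Longrightarrow> c i \<noteq> j0"
  proof (cases "k = n")
    case True
    show thesis by (rule that[of 1 "\<lambda>i. max i k" 0]) (use True n in auto)
  next
    case False
    show thesis by (rule that[of 0 "\<lambda>i. min i k" n]) (use False n in auto)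
  qed
  define R where "R m \<theta> \<tau> = (\<lambda>t\<in>{..m}. if \<tau> t = \<epsilon> then c (\<theta> t) else \<theta> t)"
    for m and \<theta> :: "nat \<Rightarrow> nat" and \<tau> :: "nat \<Rightarrow> nat"
  have R: "R m \<theta> \<tau> t = (if \<tau> t = \<epsilon> then c (\<theta> t) else \<theta> t)" if "t \<le> m" for m \<theta> \<tau> t
    using that by (simp add: R_def)
  have R_in: "R m \<theta> \<tau> \<in> \<Delta> m n" if \<theta>: "\<theta> \<in> \<Delta> m n" and \<tau>: "\<tau> \<in> \<Delta> m 1" for m \<theta> \<tau>
  proof (rule \<Delta>I)
    fix t assume t: "t \<le> m"
    then show "R m \<theta> \<tau> t \<le> n" using \<Delta>D(1)[OF \<theta> t] c(1)[of "\<theta> t"] n by (auto simp: R)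
  next
    fix t t' assume t: "t \<le> t'" "t' \<le> m"
    show "R m \<theta> \<tau> t \<le> R m \<theta> \<tau> t'"
      using \<Delta>D(2)[OF \<theta> t] \<Delta>D(2)[OF \<tau> t] \<Delta>D(1)[OF \<tau> t(2)] c(2)[of "\<theta> t" "\<theta> t'"]
        c\<epsilon>[of "\<theta> t"] c\<epsilon>[of "\<theta> t'"] t by (auto simp: R)
  qed (simp add: R_def)
  show thesis
  proof (rule that[of \<epsilon> R])
    show "R l (compose {..l} \<theta> \<psi>) (compose {..l} \<tau> \<psi>) = compose {..l} (R m \<theta> \<tau>) \<psi>"
      if "\<psi> \<in> \<Delta> l m" for l m \<theta> \<tau> \<psi>
      using \<Delta>D(1)[OF that] by (auto simp: R_def compose_def)
    show "R m \<theta> (const_path (1 - \<epsilon>) m) = \<theta>" if "\<theta> \<in> \<Delta> m n" for m \<theta>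
      using \<epsilon> \<Delta>D(3)[OF that] by (cases \<epsilon>) (auto simp: R_def const_path_def extensional_def)
    show "R m \<theta> (const_path \<epsilon> m) \<in> simplices (horn n k) m" if \<theta>: "\<theta> \<in> \<Delta> m n" for m \<theta>
    proof -
      have "j0 \<notin> R m \<theta> (const_path \<epsilon> m) ` {..m}"
        using j0(3) \<Delta>D(1)[OF \<theta>] by (auto simp: R const_path_def)
      with j0 R_in[OF \<theta> const_path_in[OF \<epsilon>]] show ?thesis by (auto simp: horn_iff)
    qed
    show "R m \<theta> \<tau> \<in> simplices (horn n k) m" if \<theta>: "\<theta> \<in> simplices (horn n k) m" and \<tau>: "\<tau> \<in> \<Delta> m 1" for m \<theta> \<tau>
    proof -
      obtain j where j: "j \<le> n" "j \<noteq> k" "j \<notin> \<theta> ` {..m}" using \<theta> by (auto simp: horn_iff)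
      have "R m \<theta> \<tau> t \<noteq> j" if "t \<le> m" for t
        using j(2,3) that c(1)[of "\<theta> t"] by (auto simp: R)
      then have "j \<notin> R m \<theta> \<tau> ` {..m}" by auto
      with j R_in[OF horn_\<Delta>[OF \<theta>] \<tau>] show ?thesis by (auto simp: horn_iff)
    qed
  qed (use \<epsilon> R_in in auto)
qed

text \<open>
  The Frobenius property: lift the homotopy into the horn along \<open>f\<close>, and extend the given
  partial lift along it by homotopy lifting for \<open>q\<close>.
\<close>

theorem lifting_fibre_horn:
  assumes f: "kan_fibration B A f" and q: "kan_fibration E D q"
    and a: "a \<in> simplices A n" and n: "1 \<le> n" "k \<le> n"
  shows "lifting E D q (fibre_sset A B f n a) (fibre_horn A B f n k a) (simplices (fibre_sset A B f n a))"
proof (rule liftingI)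
  note A = kan_fibrationD(2)[OF f] and B = kan_fibrationD(1)[OF f] and fm = kan_fibrationD(3)[OF f]
  let ?T = "fibre_sset A B f n a" and ?H = "fibre_horn A B f n k a"
  note T = is_sset_fibre[OF A B fm a]
  fix u v assume u: "is_smap (subsset ?T ?H) E u" and v: "is_smap (subsset ?T (simplices ?T)) D v"
    and uv: "\<And>m x. x \<in> ?H m \<Longrightarrow> q m (u m x) = v m x"
  obtain \<epsilon> R where \<epsilon>: "\<epsilon> \<le> 1" and R: "\<And>m \<theta> \<tau>. \<theta> \<in> \<Delta> m n \<Longrightarrow> \<tau> \<in> \<Delta> m 1 \<Longrightarrow> R m \<theta> \<tau> \<in> \<Delta> m n"
    and R_nat: "\<And>l m \<theta> \<tau> \<psi>. \<theta> \<in> \<Delta> m n \<Longrightarrow> \<tau> \<in> \<Delta> m 1 \<Longrightarrow> \<psi> \<in> \<Delta> l m \<Longrightarrow>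
      R l (compose {..l} \<theta> \<psi>) (compose {..l} \<tau> \<psi>) = compose {..l} (R m \<theta> \<tau>) \<psi>"
    and R0: "\<And>m \<theta>. \<theta> \<in> \<Delta> m n \<Longrightarrow> R m \<theta> (const_path (1 - \<epsilon>) m) = \<theta>"
    and R1: "\<And>m \<theta>. \<theta> \<in> \<Delta> m n \<Longrightarrow> R m \<theta> (const_path \<epsilon> m) \<in> simplices (horn n k) m"
    and R_horn: "\<And>m \<theta> \<tau>. \<theta> \<in> simplices (horn n k) m \<Longrightarrow> \<tau> \<in> \<Delta> m 1 \<Longrightarrow> R m \<theta> \<tau> \<in> simplices (horn n k) m"
    using horn_homotopy[OF n] by blast
  have \<epsilon>': "1 - \<epsilon> \<le> 1" by simp
  have Tm: "\<theta> \<in> \<Delta> m n" "b \<in> simplices B m" "f m b = act A m n \<theta> a" if "(\<theta>, b) \<in> simplices ?T m" for m \<theta> b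
    using that by (auto simp: fibre_iff)
  \<comment> \<open>At the end \<open>1 - \<epsilon>\<close> the homotopy is the identity, and its
    lift to \<open>B\<close> starts there with the projection.\<close>
  have "lifting B A f (cylinder ?T) (cyl_part ?T (\<lambda>_. {}) (1 - \<epsilon>)) (simplices (cylinder ?T))"
    by (rule homotopy_lifting[OF f T _ \<epsilon>']) (simp add: closed_in_def)
  then obtain H where H: "is_smap (subsset (cylinder ?T) (simplices (cylinder ?T))) B H"
    "\<And>m y. y \<in> cyl_part ?T (\<lambda>_. {}) (1 - \<epsilon>) m \<Longrightarrow> H m y = snd (fst y)"
    "\<And>m y. y \<in> simplices (cylinder ?T) m \<Longrightarrow> f m (H m y) = act A m n (R m (fst (fst y)) (snd y)) a"
  proof (rule liftingE)
    show "is_smap (subsset (cylinder ?T) (cyl_part ?T (\<lambda>_. {}) (1 - \<epsilon>))) B (\<lambda>m y. snd (fst y))"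
      by (rule is_smapI) (auto simp: cyl_part_def fibre_iff)
    show "is_smap (subsset (cylinder ?T) (simplices (cylinder ?T))) A
        (\<lambda>m y. act A m n (R m (fst (fst y)) (snd y)) a)"
    proof (rule is_smapI)
      fix m y assume "y \<in> simplices (subsset (cylinder ?T) (simplices (cylinder ?T))) m"
      then show "act A m n (R m (fst (fst y)) (snd y)) a \<in> simplices A m"
        using act_in[OF A R a] Tm(1) by auto
    next
      fix l m \<psi> y assume \<psi>: "\<psi> \<in> \<Delta> l m"
        and "y \<in> simplices (subsset (cylinder ?T) (simplices (cylinder ?T))) m"
      then obtain \<theta> b \<tau> where "y = ((\<theta>, b), \<tau>)" "\<theta> \<in> \<Delta> m n" "\<tau> \<in> \<Delta> m 1"
        using Tm(1) by auto
      then show "act A l n (R l (fst (fst (act (subsset (cylinder ?T) (simplices (cylinder ?T))) l m \<psi> y)))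
            (snd (act (subsset (cylinder ?T) (simplices (cylinder ?T))) l m \<psi> y))) a =
          act A l m \<psi> (act A m n (R m (fst (fst y)) (snd y)) a)"
        using R_nat[OF _ _ \<psi>] act_comp[OF A \<psi> R a] by auto
    qed
    fix m y assume "y \<in> cyl_part ?T (\<lambda>_. {}) (1 - \<epsilon>) m"
    then show "f m (snd (fst y)) = act A m n (R m (fst (fst y)) (snd y)) a"
      using R0 Tm by (auto simp: cyl_part_def simp del: fibre_sset_simps)
  qed blast
  note H = H(1)[unfolded subsset_simplices] H(2,3)
  \<comment> \<open>A homotopy of the pullback itself, from the identity at
    \<open>1 - \<epsilon>\<close> to a map into \<open>?H\<close> at \<open>\<epsilon>\<close>,
    under which \<open>?H\<close> stays in \<open>?H\<close>.\<close>
  define G where "G m y = (R m (fst (fst y)) (snd y), H m y)" for m y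
  have G: "is_smap (cylinder ?T) ?T G"
  proof (rule is_smapI)
    fix m y assume y: "y \<in> simplices (cylinder ?T) m"
    then show "G m y \<in> simplices ?T m"
      using R[of "fst (fst y)" m "snd y"] Tm(1) H(3)[OF y] smap_in[OF H(1) y]
      by (auto simp: G_def fibre_iff)
  next
    fix l m \<psi> y assume \<psi>: "\<psi> \<in> \<Delta> l m" and y: "y \<in> simplices (cylinder ?T) m"
    obtain \<theta> b \<tau> where "y = ((\<theta>, b), \<tau>)" "\<theta> \<in> \<Delta> m n" "\<tau> \<in> \<Delta> m 1" using y Tm(1) by auto
    then show "G l (act (cylinder ?T) l m \<psi> y) = act ?T l m \<psi> (G m y)"
      using R_nat[OF _ _ \<psi>] smap_act[OF H(1) \<psi> y] by (auto simp: G_def)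
  qed
  have G_horn: "G m y \<in> ?H m" if y: "y \<in> cyl_part ?T ?H \<epsilon> m" for m y
  proof -
    have yT: "y \<in> simplices (cylinder ?T) m" using y by (auto simp: cyl_part_def)
    have "R m (fst (fst y)) (snd y) \<in> simplices (horn n k) m"
      using y R_horn R1 Tm(1) by (auto simp: cyl_part_def fibre_horn_def simp del: fibre_sset_simps)
    with smap_in[OF G yT] show ?thesis by (simp add: fibre_horn_def G_def)
  qed
  have v': "is_smap ?T D v" using v by simp
  \<comment> \<open>The second lifting runs the other way, from the end \<open>\<epsilon>\<close>:
    there, and over \<open>?H\<close>, \<open>G\<close> lands in \<open>?H\<close>, where
    \<open>u\<close> is defined.\<close>
  have "lifting E D q (cylinder ?T) (cyl_part ?T ?H \<epsilon>) (simplices (cylinder ?T))"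
    by (rule homotopy_lifting[OF q T closed_fibre_horn[OF A B fm a] \<epsilon>])
  then obtain w where w: "is_smap (subsset (cylinder ?T) (simplices (cylinder ?T))) E w"
    "\<And>m y. y \<in> cyl_part ?T ?H \<epsilon> m \<Longrightarrow> w m y = u m (G m y)"
    "\<And>m y. y \<in> simplices (cylinder ?T) m \<Longrightarrow> q m (w m y) = v m (G m y)"
  proof (rule liftingE)
    show "is_smap (subsset (cylinder ?T) (cyl_part ?T ?H \<epsilon>)) E (\<lambda>m y. u m (G m y))"
    proof (rule is_smapI)
      fix m y assume "y \<in> simplices (subsset (cylinder ?T) (cyl_part ?T ?H \<epsilon>)) m"
      then show "u m (G m y) \<in> simplices E m" using smap_in[OF u] G_horn by simp
    next
      fix l m \<psi> y assume \<psi>: "\<psi> \<in> \<Delta> l m" and y: "y \<in> simplices (subsset (cylinder ?T) (cyl_part ?T ?H \<epsilon>)) m"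
      have "y \<in> simplices (cylinder ?T) m" using y by (auto simp: cyl_part_def)
      then show "u l (G l (act (subsset (cylinder ?T) (cyl_part ?T ?H \<epsilon>)) l m \<psi> y)) = act E l m \<psi> (u m (G m y))"
        using smap_act[OF G \<psi>, of y] smap_act[OF u \<psi>, of "G m y"] G_horn[of y m] y by simp
    qed
    show "is_smap (subsset (cylinder ?T) (simplices (cylinder ?T))) D (\<lambda>m y. v m (G m y))"
      using is_smap_comp[OF G v'] by simp
    show "q m (u m (G m y)) = v m (G m y)" if "y \<in> cyl_part ?T ?H \<epsilon> m" for m y
      by (rule uv[OF G_horn[OF that]])
  qed blast
  \<comment> \<open>At this end \<open>G\<close> is the identity, so the transported lift solves the
    original problem.\<close>
  define w' where "w' m y = w m (y, const_path (1 - \<epsilon>) m)" for m y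
  have cyl: "(y, const_path (1 - \<epsilon>) m) \<in> simplices (cylinder ?T) m" if "y \<in> simplices ?T m" for m y
    using that const_path_in[OF \<epsilon>', of m] by simp
  have G0: "G m (y, const_path (1 - \<epsilon>) m) = y" if y: "y \<in> simplices ?T m" for m y
  proof -
    have "(y, const_path (1 - \<epsilon>) m) \<in> cyl_part ?T (\<lambda>_. {}) (1 - \<epsilon>) m"
      using y const_path_in[OF \<epsilon>', of m] by (simp add: cyl_part_def)
    from H(2)[OF this] show ?thesis
      using R0[OF Tm(1), of "fst y" "snd y" m] y by (simp add: G_def)
  qed
  have "is_smap ?T E w'"
  proof (rule is_smapI)
    fix m y assume "y \<in> simplices ?T m"
    from smap_in[OF w(1)[unfolded subsset_simplices] cyl[OF this]]
    show "w' m y \<in> simplices E m" by (simp add: w'_def)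
  next
    fix l m \<psi> y assume \<psi>: "\<psi> \<in> \<Delta> l m" and "y \<in> simplices ?T m"
    from smap_act[OF w(1)[unfolded subsset_simplices] \<psi> cyl[OF this(2)]]
    show "w' l (act ?T l m \<psi> y) = act E l m \<psi> (w' m y)"
      by (simp add: w'_def const_path_compose[OF \<psi>])
  qed
  moreover have "w' m y = u m y" if y: "y \<in> ?H m" for m y
  proof -
    have yT: "y \<in> simplices ?T m" using closed_inD(1)[OF closed_fibre_horn[OF A B fm a] y] .
    then have "(y, const_path (1 - \<epsilon>) m) \<in> cyl_part ?T ?H \<epsilon> m"
      using y const_path_in[OF \<epsilon>', of m] by (simp add: cyl_part_def)
    from w(2)[OF this] G0[OF yT] show ?thesis by (simp add: w'_def)
  qed
  moreover have "q m (w' m y) = v m y" if y: "y \<in> simplices ?T m" for m y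
    using w(3)[OF cyl[OF y]] G0[OF y] by (simp add: w'_def)
  ultimately show "\<exists>w. is_smap (subsset ?T (simplices ?T)) E w \<and> (\<forall>m. \<forall>x\<in>?H m. w m x = u m x) \<and>
        (\<forall>m. \<forall>x\<in>simplices ?T m. q m (w m x) = v m x)"
    by auto
qed

section \<open>Dependent products of Kan fibrations\<close>

lemma dprod_snd: "snd (dprod A B f Eq) = (\<lambda>n. fst)"
  by (cases Eq) simp

declare dprod.simps [simp del] pullback.simps [simp del]

text \<open>By adjunction, a horn in the dependent product over the simplex \<open>a\<close> is a
  map over \<open>B\<close> from the pulled-back horn to \<open>E\<close>, and a filler is an
  extension to the whole pullback. This is the problem that \<open>lifting_fibre_horn\<close>
  solves.\<close>

theorem kan_dprod:
  assumes f: "kan_fibration B A f" and q: "kan_fibration E B q"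
  shows "kan_fibration (total_space (dprod A B f (E, q))) A (\<lambda>n. fst)"
proof (rule kan_fibrationI)
  note A = kan_fibrationD(2)[OF f] and B = kan_fibrationD(1)[OF f] and fm = kan_fibrationD(3)[OF f]
  let ?P = "total_space (dprod A B f (E, q))"
  have "is_over A (?P, snd (dprod A B f (E, q)))"
    using dprod_over[OF A B fm, of E q] by simp
  then show P: "is_sset ?P" and "is_sset A" "is_smap ?P A (\<lambda>n. fst)"
    by (auto simp: dprod_snd)
  fix n k u v assume n: "1 \<le> n" "k \<le> n" and u: "is_smap (horn n k) ?P u"
    and v: "is_smap (std_simplex n) A v" "\<And>m \<theta>. \<theta> \<in> simplices (horn n k) m \<Longrightarrow> fst (u m \<theta>) = v m \<theta>"
  define a where "a = v n (\<Delta>_id n)"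
  have a: "a \<in> simplices A n" using smap_in[OF v(1), of "\<Delta>_id n" n] by (simp add: a_def \<Delta>_id_in)
  have va: "v m \<theta> = act A m n \<theta> a" if "\<theta> \<in> \<Delta> m n" for m \<theta>
    unfolding a_def by (rule is_smap_std_simplex[OF v(1) that])
  define s where "s m \<theta> = snd (u m \<theta>)" for m \<theta>
  have us: "u m \<theta> = (act A m n \<theta> a, s m \<theta>)" if "\<theta> \<in> simplices (horn n k) m" for m \<theta>
    using v(2)[OF that] va[OF horn_\<Delta>[OF that]] by (simp add: s_def prod_eq_iff)
  have s: "(act A m n \<theta> a, s m \<theta>) \<in> simplices ?P m" if "\<theta> \<in> simplices (horn n k) m" for m \<theta>
    using smap_in[OF u that] us[OF that] by simp
  have s_act: "s l (compose {..l} \<theta> \<psi>) (l', \<phi>, b) = s m \<theta> (l', compose {..l'} \<psi> \<phi>, b)"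
    if \<theta>: "\<theta> \<in> simplices (horn n k) m" and \<psi>: "\<psi> \<in> \<Delta> l m"
      and t: "(l', \<phi>, b) \<in> fibre A B f l (act A l n (compose {..l} \<theta> \<psi>) a)" for l m l' \<theta> \<psi> \<phi> b
  proof -
    have eq: "act A l n (compose {..l} \<theta> \<psi>) a = act A l m \<psi> (act A m n \<theta> a)"
      by (rule act_comp[OF A \<psi> horn_\<Delta>[OF \<theta>] a])
    have "u l (compose {..l} \<theta> \<psi>) = act ?P l m \<psi> (u m \<theta>)"
      using smap_act[OF u \<psi> \<theta>] by simp
    then show ?thesis
      using us[OF \<theta>] us[OF horn_compose[OF \<theta> \<psi>]] t by (simp add: dprod_act[OF A B fm] eq)
  qed
  let ?T = "fibre_sset A B f n a" and ?H = "fibre_horn A B f n k a"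
  \<comment> \<open>Evaluation at the identity, as in the counit: \<open>e\<close> is the transpose
    of \<open>u\<close>.\<close>
  define e where "e m y = s m (fst y) (m, \<Delta>_id m, snd y)" for m y
  have Hm: "\<theta> \<in> simplices (horn n k) m" "b \<in> simplices B m" "f m b = act A m n \<theta> a"
    "(m, \<Delta>_id m, b) \<in> fibre A B f m (act A m n \<theta> a)"
    if "(\<theta>, b) \<in> ?H m" for m \<theta> b
    using that act_id[OF A act_in[OF A horn_\<Delta> a]]
    by (auto simp: fibre_horn_def fibre_iff \<Delta>_id_in)
  have e: "is_smap (subsset ?T ?H) E e"
  proof (rule is_smapI)
    fix m y assume "y \<in> simplices (subsset ?T ?H) m"
    then obtain \<theta> b where y: "y = (\<theta>, b)" "(\<theta>, b) \<in> ?H m" by (cases y) auto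
    show "e m y \<in> simplices E m"
      using dprod_memD(3)[OF A B fm s[OF Hm(1)[OF y(2)]] Hm(4)[OF y(2)]] by (simp add: e_def y)
  next
    fix l m \<psi> y assume \<psi>: "\<psi> \<in> \<Delta> l m" and "y \<in> simplices (subsset ?T ?H) m"
    then obtain \<theta> b where y: "y = (\<theta>, b)" "(\<theta>, b) \<in> ?H m" by (cases y) auto
    note Hy = Hm[OF y(2)]
    have "(compose {..l} \<theta> \<psi>, act B l m \<psi> b) \<in> ?H l"
      using closed_inD(2)[OF closed_fibre_horn[OF A B fm a] \<psi> y(2)] by simp
    note t = Hm(4)[OF this]
    have "s l (compose {..l} \<theta> \<psi>) (l, \<Delta>_id l, act B l m \<psi> b) =
        s m \<theta> (l, compose {..l} (\<Delta>_id m) \<psi>, act B l m \<psi> b)"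
      using s_act[OF Hy(1) \<psi> t] by (simp add: compose_\<Delta>_id_left[OF \<psi>] compose_\<Delta>_id_right[OF \<psi>])
    also have "\<dots> = act E l m \<psi> (s m \<theta> (m, \<Delta>_id m, b))"
      by (rule dprod_memD(5)[OF A B fm s[OF Hy(1)] Hy(4) \<psi>])
    finally show "e l (act (subsset ?T ?H) l m \<psi> y) = act E l m \<psi> (e m y)"
      by (simp add: e_def y)
  qed
  have snd: "is_smap (subsset ?T (simplices ?T)) B (\<lambda>m. snd)"
    by (rule is_smapI) (auto simp: fibre_iff)
  have qe: "q m (e m y) = snd y" if "y \<in> ?H m" for m y
    using dprod_memD(4)[OF A B fm s[OF Hm(1)] Hm(4), of "fst y" "snd y" m] that by (simp add: e_def)
  obtain w where w: "is_smap ?T E w" "\<And>m y. y \<in> ?H m \<Longrightarrow> w m y = e m y"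
    "\<And>m y. y \<in> simplices ?T m \<Longrightarrow> q m (w m y) = snd y"
    using liftingE[OF lifting_fibre_horn[OF f q a n] e snd qe] by (simp only: subsset_simplices) blast
  \<comment> \<open>Transposing back: \<open>w\<close> is a section over all of \<open>a\<close>,
    hence a single simplex of the dependent product whose restrictions form the filler.\<close>
  define S where "S = (\<lambda>(m, \<theta>, b)\<in>fibre A B f n a. w m (\<theta>, b))"
  have S: "(a, S) \<in> simplices ?P n"
  proof (rule dprod_memI[OF A B fm a])
    fix m \<theta> b assume t: "(m, \<theta>, b) \<in> fibre A B f n a"
    then show "S (m, \<theta>, b) \<in> simplices E m" "q m (S (m, \<theta>, b)) = b"
      using smap_in[OF w(1), of "(\<theta>, b)" m] w(3)[of "(\<theta>, b)" m] by (simp_all add: S_def)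
    fix l \<psi> assume \<psi>: "\<psi> \<in> \<Delta> l m"
    show "S (l, compose {..l} \<theta> \<psi>, act B l m \<psi> b) = act E l m \<psi> (S (m, \<theta>, b))"
      using smap_act[OF w(1) \<psi>, of "(\<theta>, b)"] fibre_act[OF A B fm t \<psi> a] t by (simp add: S_def)
  qed (simp add: S_def)
  have "act ?P m n \<theta> (a, S) = u m \<theta>" if \<theta>: "\<theta> \<in> simplices (horn n k) m" for m \<theta>
  proof -
    have "(\<lambda>(l, \<psi>, b)\<in>fibre A B f m (act A m n \<theta> a). S (l, compose {..l} \<theta> \<psi>, b)) = s m \<theta>"
    proof (rule extensionalityI[OF restrict_extensional dprod_memD(2)[OF A B fm s[OF \<theta>]]], clarify)
      fix l \<psi> b assume t: "(l, \<psi>, b) \<in> fibre A B f m (act A m n \<theta> a)"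
      note t' = fibre_shift[OF A B fm t horn_\<Delta>[OF \<theta>] a]
      have \<psi>: "\<psi> \<in> \<Delta> l m" using t by (simp add: fibre_iff)
      have H: "(compose {..l} \<theta> \<psi>, b) \<in> ?H l"
        using t' horn_compose[OF \<theta> \<psi>] by (simp add: fibre_horn_def)
      show "(\<lambda>(l, \<psi>, b)\<in>fibre A B f m (act A m n \<theta> a). S (l, compose {..l} \<theta> \<psi>, b)) (l, \<psi>, b) = s m \<theta> (l, \<psi>, b)"
        using t t' w(2)[OF H] s_act[OF \<theta> \<psi> Hm(4)[OF H]]
        by (simp add: S_def e_def compose_\<Delta>_id_right[OF \<psi>])
    qed
    then show ?thesis by (simp add: dprod_act[OF A B fm] us[OF \<theta>])
  qed
  moreover have "fst (act ?P m n \<theta> (a, S)) = v m \<theta>" if "\<theta> \<in> \<Delta> m n" for m \<theta>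
    by (simp add: dprod_act[OF A B fm] va[OF that])
  ultimately show "\<exists>w. is_smap (std_simplex n) ?P w \<and> (\<forall>m. \<forall>\<theta>\<in>simplices (horn n k) m. w m \<theta> = u m \<theta>) \<and>
        (\<forall>m. \<forall>\<theta>\<in>\<Delta> m n. fst (w m \<theta>) = v m \<theta>)"
    using is_smap_Yoneda[OF P S] by blast
qed

theorem kan_dpoly:
  assumes h: "kan_fibration B C h" and f: "kan_fibration B A f" and g: "kan_fibration A C g"
    and p: "kan_fibration X C p"
  shows "kan_fibration (total_space (dpoly A B h f g (X, p))) C (\<lambda>n t. g n (fst t))"
proof -
  obtain P r where P: "pullback B h (X, p) = (P, r)" by (cases "pullback B h (X, p)")
  then have r: "r = (\<lambda>n. fst)" by (simp add: pullback.simps)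
  have "kan_fibration P B r"
    using kan_pullback[OF kan_fibrationD(1)[OF h] kan_fibrationD(3)[OF h] p] by (simp add: P r)
  from kan_comp[OF kan_dprod[OF f this] g] show ?thesis
    by (cases "dprod A B f (P, r)") (simp add: dpoly_def P)
qed

section \<open>Exhausting the initial algebra\<close>

text \<open>
  A horn is generated by finitely many simplices, namely the idempotents of the standard simplex
  that miss one vertex; hence a horn in the union of a chain already lies in one of its members.
\<close>

lemma horn_generators:
  assumes n: "1 \<le> n" and j: "j \<le> n" "j \<noteq> k"
  obtains \<delta> where "\<delta> \<in> simplices (horn n k) n"
    "\<And>m \<theta>. \<theta> \<in> \<Delta> m n \<Longrightarrow> j \<notin> \<theta> ` {..m} \<Longrightarrow> compose {..m} \<delta> \<theta> = \<theta>"
\<comment> \<open>Moving \<open>j\<close> to a neighbour is monotone and fixes the other vertices;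
  \<open>n \<ge> 1\<close> provides the neighbour 1 of 0. Endomaps of \<open>[n]\<close>, in place
  of cofaces, keep all generators in dimension \<open>n\<close>.\<close>
proof (rule that[of "\<lambda>i\<in>{..n}. if i \<noteq> j then i else if j = 0 then 1 else j - 1"])
  let ?\<delta> = "\<lambda>i\<in>{..n}. if i \<noteq> j then i else if j = 0 then 1 else j - 1"
  have "?\<delta> \<in> \<Delta> n n" using n j by (intro \<Delta>I) auto
  moreover have "j \<notin> ?\<delta> ` {..n}" by auto
  ultimately show "?\<delta> \<in> simplices (horn n k) n" using j by (auto simp: horn_iff)
  fix m \<theta> assume \<theta>: "\<theta> \<in> \<Delta> m n" "j \<notin> \<theta> ` {..m}"
  show "compose {..m} ?\<delta> \<theta> = \<theta>"
  proof (rule extensionalityI[OF _ \<Delta>D(3)[OF \<theta>(1)]])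
    fix t assume "t \<in> {..m}"
    then show "compose {..m} ?\<delta> \<theta> t = \<theta> t" using \<theta>(2) \<Delta>D(1)[OF \<theta>(1)] by (auto simp: compose_def)
  qed (simp add: compose_def)
qed

text \<open>Members are sets of pairs of a dimension and a simplex, so that the chain is ordered by
  plain inclusion and the finitely many generating pairs of a horn fall into one member.\<close>

lemma kan_chain_Union:
  assumes X: "is_sset X" and C: "is_sset C" and p: "is_smap X C p" and chain: "subset.chain \<A> \<S>"
    and \<S>: "\<And>S. S \<in> \<S> \<Longrightarrow> closed_in X (\<lambda>n. S `` {n})"
      "\<And>S. S \<in> \<S> \<Longrightarrow> kan_fibration (subsset X (\<lambda>n. S `` {n})) C p"
  shows "closed_in X (\<lambda>n. \<Union>\<S> `` {n})" "kan_fibration (subsset X (\<lambda>n. \<Union>\<S> `` {n})) C p"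
proof -
  let ?X = "subsset X (\<lambda>n. \<Union>\<S> `` {n})"
  show closed: "closed_in X (\<lambda>n. \<Union>\<S> `` {n})"
  proof (rule closed_inI)
    fix n x assume "x \<in> \<Union>\<S> `` {n}"
    then obtain S where S: "S \<in> \<S>" "x \<in> S `` {n}" by auto
    show "x \<in> simplices X n" by (rule closed_inD(1)[OF \<S>(1)[OF S(1)] S(2)])
  next
    fix m n \<theta> x assume \<theta>: "\<theta> \<in> \<Delta> m n" and "x \<in> \<Union>\<S> `` {n}"
    then obtain S where S: "S \<in> \<S>" "x \<in> S `` {n}" by auto
    show "act X m n \<theta> x \<in> \<Union>\<S> `` {m}"
      using closed_inD(2)[OF \<S>(1)[OF S(1)] \<theta> S(2)] S(1) by auto
  qed
  show "kan_fibration ?X C p"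
  proof (rule kan_fibrationI[OF is_sset_subsset[OF X closed] C])
    show "is_smap ?X C p" by (rule is_smap_subset[of _ "simplices X"]) (use p closed in \<open>auto simp: closed_in_def\<close>)
    fix n k u v assume n: "1 \<le> n" "k \<le> n" and u: "is_smap (horn n k) ?X u"
      and v: "is_smap (std_simplex n) C v" "\<And>m \<theta>. \<theta> \<in> simplices (horn n k) m \<Longrightarrow> p m (u m \<theta>) = v m \<theta>"
    let ?J = "{..n} - {k}"
    have "\<exists>\<delta>. \<delta> \<in> simplices (horn n k) n \<and> (\<forall>m. \<forall>\<theta>\<in>\<Delta> m n. j \<notin> \<theta> ` {..m} \<longrightarrow> compose {..m} \<delta> \<theta> = \<theta>)"
      if "j \<in> ?J" for j
      using horn_generators[OF n(1), of j k] that by (metis DiffD1 DiffD2 atMost_iff singletonI)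
    then obtain \<delta> where \<delta>: "\<And>j. j \<in> ?J \<Longrightarrow> \<delta> j \<in> simplices (horn n k) n"
      "\<And>j m \<theta>. j \<in> ?J \<Longrightarrow> \<theta> \<in> \<Delta> m n \<Longrightarrow> j \<notin> \<theta> ` {..m} \<Longrightarrow> compose {..m} (\<delta> j) \<theta> = \<theta>"
      by metis
    have sub: "(\<lambda>j. (n, u n (\<delta> j))) ` ?J \<subseteq> \<Union>\<S>"
      using smap_in[OF u \<delta>(1)] by auto
    \<comment> \<open>A horn with \<open>n \<ge> 1\<close> has at least one generator, so it cannot
      map to an empty union; this lets the empty chain through as well.\<close>
    have "(if k = 0 then n else 0) \<in> ?J" using n by auto
    with sub have "\<S> \<noteq> {}" by blast
    then obtain S where S: "S \<in> \<S>" "(\<lambda>j. (n, u n (\<delta> j))) ` ?J \<subseteq> S"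
      using finite_subset_Union_chain[OF _ sub _ chain] by auto
    let ?S = "subsset X (\<lambda>n. S `` {n})"
    have "is_smap (horn n k) ?S u"
    proof (rule is_smapI)
      fix m \<theta> assume \<theta>: "\<theta> \<in> simplices (horn n k) m"
      then obtain j where j: "j \<in> ?J" "j \<notin> \<theta> ` {..m}" by (auto simp: horn_iff)
      have "u m \<theta> = act X m n \<theta> (u n (\<delta> j))"
        using smap_act[OF u horn_\<Delta>[OF \<theta>] \<delta>(1)[OF j(1)]] \<delta>(2)[OF j(1) horn_\<Delta>[OF \<theta>] j(2)] by simp
      moreover have "u n (\<delta> j) \<in> S `` {n}" using S(2) j(1) by auto
      ultimately show "u m \<theta> \<in> simplices ?S m"
        using closed_inD(2)[OF \<S>(1)[OF S(1)] horn_\<Delta>[OF \<theta>]] by simp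
    next
      fix l m \<psi> \<theta> assume "\<psi> \<in> \<Delta> l m" "\<theta> \<in> simplices (horn n k) m"
      from smap_act[OF u this] show "u l (act (horn n k) l m \<psi> \<theta>) = act ?S l m \<psi> (u m \<theta>)" by simp
    qed
    then obtain w where w: "is_smap (std_simplex n) ?S w"
      "\<And>m \<theta>. \<theta> \<in> simplices (horn n k) m \<Longrightarrow> w m \<theta> = u m \<theta>"
      "\<And>m \<theta>. \<theta> \<in> \<Delta> m n \<Longrightarrow> p m (w m \<theta>) = v m \<theta>"
      using kan_fibrationE[OF \<S>(2)[OF S(1)] n _ v] by blast
    have "is_smap (std_simplex n) ?X w"
      by (rule is_smapI) (use smap_in[OF w(1)] smap_act[OF w(1)] S(1) in auto)
    with w(2,3) show "\<exists>w. is_smap (std_simplex n) ?X w \<and>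
        (\<forall>m. \<forall>\<theta>\<in>simplices (horn n k) m. w m \<theta> = u m \<theta>) \<and> (\<forall>m. \<forall>\<theta>\<in>\<Delta> m n. p m (w m \<theta>) = v m \<theta>)"
      by blast
  qed
qed

theorem theorem3p5:
  fixes A :: "'a sset" and B :: "'b sset" and C :: "'c sset"
    and h :: "('b, 'c) smap" and f :: "('b, 'a) smap" and g :: "('a, 'c) smap"
    and X :: "'x sset" and p :: "('x, 'c) smap"
    and \<alpha> :: "(('a, 'b, 'x) dpoly, 'x) smap"
  assumes "kan_fibration B C h"
    and "kan_fibration B A f"
    and "kan_fibration A C g"
    and "initial_dpoly_algebra A B C h f g (X, p) \<alpha>"
  shows "kan_fibration X C p"
proof -
  note A = kan_fibrationD(1)[OF assms(3)] and B = kan_fibrationD(1)[OF assms(1)]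
    and hm = kan_fibrationD(3)[OF assms(1)] and fm = kan_fibrationD(3)[OF assms(2)]
    and gm = kan_fibrationD(3)[OF assms(3)] and C = kan_fibrationD(2)[OF assms(1)]
  note ctxt = A B hm fm gm
  note X = Xs[OF ctxt assms(4)] and p = ps[OF ctxt assms(4)]
    and \<alpha> = \<alpha>_over[OF ctxt assms(4)] and inj = initial_inj[OF ctxt assms(4)]
  define D where "D S = total_space (dpoly A B h f g (subsset X (\<lambda>n. S `` {n}), p))" for S
  let ?DX = "total_space (dpoly A B h f g (X, p))"
  define \<Phi> where "\<Phi> S = {(n, \<alpha> n t) | n t. t \<in> simplices (D S) n}" for S
  have \<Phi>_iff: "\<Phi> S `` {n} = \<alpha> n ` simplices (D S) n" for S n by (auto simp: \<Phi>_def)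
  \<comment> \<open>On subobjects the functor gives literal subsets: the sections with values in
    \<open>S\<close>.\<close>
  have D_iff: "(a, s) \<in> simplices (D S) n \<longleftrightarrow> (a, s) \<in> simplices ?DX n \<and>
      (\<forall>m \<theta> b. (m, \<theta>, b) \<in> fibre A B f n a \<longrightarrow> snd (s (m, \<theta>, b)) \<in> S `` {m})"
    if S: "closed_in X (\<lambda>n. S `` {n})" for a s n S
  proof (intro iffI conjI allI impI)
    assume *: "(a, s) \<in> simplices (D S) n"
    note D = dpoly_memD[OF ctxt *[unfolded D_def]]
    show "(a, s) \<in> simplices ?DX n"
      by (rule dpoly_memI[OF ctxt D(1,2)]) (use D(3-6) closed_inD(1)[OF S] in auto)
    show "snd (s (m, \<theta>, b)) \<in> S `` {m}" if "(m, \<theta>, b) \<in> fibre A B f n a" for m \<theta> b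
      using D(4)[OF that] by simp
  next
    assume *: "(a, s) \<in> simplices ?DX n \<and>
      (\<forall>m \<theta> b. (m, \<theta>, b) \<in> fibre A B f n a \<longrightarrow> snd (s (m, \<theta>, b)) \<in> S `` {m})"
    note D = dpoly_memD[OF ctxt conjunct1[OF *]]
    show "(a, s) \<in> simplices (D S) n" unfolding D_def
      by (rule dpoly_memI[OF ctxt D(1,2)]) (use D(3-6) * in auto)
  qed
  have D_act: "act (D S) m n \<theta> t = act ?DX m n \<theta> t" for S m n \<theta> t
    by (cases t) (simp only: D_def dpoly_act[OF ctxt])
  have D_sub: "t \<in> simplices ?DX n" if "closed_in X (\<lambda>n. S `` {n})" "t \<in> simplices (D S) n" for S t n
    using D_iff[OF that(1), of "fst t" "snd t" n] that(2) by simp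
  have \<Phi>_mono: "\<Phi> S \<subseteq> \<Phi> S'"
    if "closed_in X (\<lambda>n. S `` {n})" "closed_in X (\<lambda>n. S' `` {n})" "S \<subseteq> S'" for S S'
  proof -
    have "t \<in> simplices (D S') n" if "t \<in> simplices (D S) n" for t n
    proof (cases t)
      case (Pair a s)
      with \<open>t \<in> simplices (D S) n\<close> show ?thesis
        unfolding Pair D_iff[OF \<open>closed_in X (\<lambda>n. S `` {n})\<close>] D_iff[OF \<open>closed_in X (\<lambda>n. S' `` {n})\<close>]
        using \<open>S \<subseteq> S'\<close> by blast
    qed
    then show ?thesis unfolding \<Phi>_def by blast
  qed
  have \<Phi>_kan: "closed_in X (\<lambda>n. \<Phi> S `` {n}) \<and> kan_fibration (subsset X (\<lambda>n. \<Phi> S `` {n})) C p"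
    if S: "closed_in X (\<lambda>n. S `` {n})" and kan: "kan_fibration (subsset X (\<lambda>n. S `` {n})) C p" for S
  proof -
    note kD = kan_dpoly[OF assms(1-3) kan, folded D_def]
    have \<alpha>m: "is_smap (D S) X \<alpha>"
    proof (rule is_smapI)
      fix n t assume "t \<in> simplices (D S) n"
      then show "\<alpha> n t \<in> simplices X n" using smap_in[OF over_mapD(1)[OF \<alpha>]] D_sub[OF S] by blast
    next
      fix m n \<theta> t assume \<theta>: "\<theta> \<in> \<Delta> m n" and "t \<in> simplices (D S) n"
      then show "\<alpha> m (act (D S) m n \<theta> t) = act X m n \<theta> (\<alpha> n t)"
        using smap_act[OF over_mapD(1)[OF \<alpha>] \<theta>] D_sub[OF S] by (simp add: D_act)
    qed
    have closed: "closed_in X (\<lambda>n. \<Phi> S `` {n})"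
    proof (rule closed_inI)
      fix n x assume "x \<in> \<Phi> S `` {n}"
      then show "x \<in> simplices X n" using smap_in[OF \<alpha>m] by (auto simp: \<Phi>_iff)
    next
      fix m n \<theta> x assume \<theta>: "\<theta> \<in> \<Delta> m n" and "x \<in> \<Phi> S `` {n}"
      then obtain t where t: "t \<in> simplices (D S) n" "x = \<alpha> n t" by (auto simp: \<Phi>_iff)
      have "act X m n \<theta> x = \<alpha> m (act (D S) m n \<theta> t)"
        using smap_act[OF \<alpha>m \<theta> t(1)] t(2) by simp
      then show "act X m n \<theta> x \<in> \<Phi> S `` {m}"
        unfolding \<Phi>_iff using act_in[OF kan_fibrationD(1)[OF kD] \<theta> t(1)] by (rule image_eqI)
    qed
    have "kan_fibration (subsset X (\<lambda>n. \<Phi> S `` {n})) C p"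
    proof (rule kan_iso[OF kD])
      show "is_sset (subsset X (\<lambda>n. \<Phi> S `` {n}))" by (rule is_sset_subsset[OF X closed])
      show "is_smap (subsset X (\<lambda>n. \<Phi> S `` {n})) C p"
        by (rule is_smap_subset[of _ "simplices X"]) (use p closed in \<open>auto simp: closed_in_def\<close>)
      show "is_smap (D S) (subsset X (\<lambda>n. \<Phi> S `` {n})) \<alpha>"
        by (rule is_smapI) (use smap_act[OF \<alpha>m] in \<open>auto simp: \<Phi>_iff\<close>)
      have "inj_on (\<alpha> n) (simplices (D S) n)" for n
        by (rule inj_on_subset[OF inj]) (use D_sub[OF S] in blast)
      then show "bij_betw (\<alpha> n) (simplices (D S) n) (simplices (subsset X (\<lambda>n. \<Phi> S `` {n})) n)" for n
        by (simp add: bij_betw_def \<Phi>_iff)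
      show "p n (\<alpha> n t) = g n (fst t)" if "t \<in> simplices (D S) n" for n t
        using over_mapD(2)[OF \<alpha> D_sub[OF S that]] dpoly_proj[OF ctxt, of _ n "fst t" "snd t"] by simp
    qed
    with closed show ?thesis by blast
  qed
  let ?A = "{S. closed_in X (\<lambda>n. S `` {n}) \<and> kan_fibration (subsset X (\<lambda>n. S `` {n})) C p \<and> S \<subseteq> \<Phi> S}"
  have Union: "\<Union>\<S> \<in> ?A" if chain: "subset.chain ?A \<S>" for \<S>
  proof -
    have \<S>: "S \<in> ?A" if "S \<in> \<S>" for S using chain that by (auto simp: subset_chain_def)
    note U = kan_chain_Union[OF X C p chain]
    have "closed_in X (\<lambda>n. \<Union>\<S> `` {n})" "kan_fibration (subsset X (\<lambda>n. \<Union>\<S> `` {n})) C p"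
      by (rule U; use \<S> in blast)+
    \<comment> \<open>Only monotonicity enters here; equality of \<open>\<Phi>\<close> of the union
      with the union of the values may fail.\<close>
    moreover have "\<Union>\<S> \<subseteq> \<Phi> (\<Union>\<S>)"
    proof (rule Union_least)
      fix S assume S: "S \<in> \<S>"
      have "\<Phi> S \<subseteq> \<Phi> (\<Union>\<S>)" by (rule \<Phi>_mono) (use \<S>[OF S] S calculation(1) in auto)
      with \<S>[OF S] show "S \<subseteq> \<Phi> (\<Union>\<S>)" by blast
    qed
    ultimately show ?thesis by blast
  qed
  have "\<exists>M\<in>?A. \<forall>S\<in>?A. M \<subseteq> S \<longrightarrow> S = M"
  proof (rule subset_Zorn_nonempty)
    \<comment> \<open>The empty subobject is fibrant because no horn maps to it.\<close>
    have "\<Union>{} \<in> ?A" by (rule Union) (simp add: subset_chain_def)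
    then show "?A \<noteq> {}" by blast
  qed (rule Union)
  then obtain M where M: "M \<in> ?A" and max: "\<forall>S\<in>?A. M \<subseteq> S \<longrightarrow> S = M" ..
  note M' = M[unfolded mem_Collect_eq]
  note closed = conjunct1[OF M'] and kan = conjunct1[OF conjunct2[OF M']]
    and sub = conjunct2[OF conjunct2[OF M']]
  note \<Phi>_fib = \<Phi>_kan[OF closed kan]
  \<comment> \<open>This readmits \<open>\<Phi> M\<close> to \<open>?A\<close>, so maximality of
    \<open>M\<close> applies to it.\<close>
  have "\<Phi> M \<subseteq> \<Phi> (\<Phi> M)" by (rule \<Phi>_mono[OF closed conjunct1[OF \<Phi>_fib] sub])
  then have \<Phi>M: "\<Phi> M = M" by (intro max[rule_format] CollectI conjI conjunct1[OF \<Phi>_fib] conjunct2[OF \<Phi>_fib] sub)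
  \<comment> \<open>The inclusion of \<open>\<Phi> M\<close> in \<open>M\<close> says that
    \<open>M\<close> is a subalgebra, and an initial algebra has no proper one.\<close>
  have "M `` {n} = simplices X n" for n
  proof (rule initial_minimal[OF ctxt assms(4), of "\<lambda>n. M `` {n}"])
    show "M `` {n} \<subseteq> simplices X n" for n using closed_inD(1)[OF closed] by blast
    show "act X m n \<theta> x \<in> M `` {m}" if "\<theta> \<in> \<Delta> m n" "x \<in> M `` {n}" for m n \<theta> x
      using closed_inD(2)[OF closed that] .
    fix n a s assume "(a, s) \<in> simplices ?DX n"
      "\<And>m \<theta> b. (m, \<theta>, b) \<in> fibre A B f n a \<Longrightarrow> snd (s (m, \<theta>, b)) \<in> M `` {m}"
    then have "(a, s) \<in> simplices (D M) n" using D_iff[OF closed] by blast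
    then show "\<alpha> n (a, s) \<in> M `` {n}" using \<Phi>_iff[of M n] by (simp only: \<Phi>M) blast
  qed
  then have "subsset X (\<lambda>n. M `` {n}) = X" by simp
  with kan show ?thesis by simp
qed

end
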